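(* For all $k\geq 2$, we have $$\overline{C}_k\setminus C_k\subseteq \mathrm{Abn}_0(\mathbb{G}_k)\subsetneq \overline{C}_k .$$ For each $k\geq 4$, the first inclusion is strict, and thus $\mathrm{Cut}_0(\mathbb{G}_k)\cap\mathrm{Abn}_0(\mathbb{G}_k)\neq\emptyset$. Moreover (for each $k\geq 4$), there exist abnormal geodesics of $\mathbb{G}_k$ with finite cut time.
   Context: Let $k\geq 2$. Identify $\wedge^2\mathbb{R}^k$ with the space of $k\times k$ real skew-symmetric matrices, via $v\wedge w=vw^*-wv^*$ ($^*$ = transpose). Let $\mathbb{G}_k=\mathbb{R}^k\oplus\wedge^2\mathbb{R}^k$, with points denoted $(x,Y)$ and origin $0=(0,0)$. It is the free, step $2$ Carnot group of rank $k$, i.e. the sub-Riemannian structure for which the vector fields $X_i=\partial_{x_i}-\frac12\sum_{1\leq\ell<m\leq k}(e_i\wedge x)_{\ell m}\partial_{Y_{\ell m}}$, $i=1,\dots,k$, are a global orthonormal frame of the horizontal distribution ($e_1,\dots,e_k$ is the standard basis of $\mathbb{R}^k$). A Lipschitz curve $\gamma=(x(\cdot),Y(\cdot)):[0,T]\to\mathbb{G}_k$ is horizontal if $\dot\gamma=\sum_iu_iX_i(\gamma)$ a.e. for some control $u\in L^\infty([0,T],\mathbb{R}^k)$, equivalently $\dot x=u$, $\dot Y=\frac12x\wedge u$; its length is $L(\gamma)=\int_0^T|u(t)|\,dt$. The distance $d$ is the infimum of lengths of horizontal curves joining two points; it is complete. A geodesic is a non-trivial constant-speed horizontal curve that locally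 minimizes the length between its endpoints; it is minimizing if its length equals the distance between its endpoints; it is maximal if it is not the restriction of a geodesic defined on a larger interval $[0,T']$. Every geodesic of $\mathbb{G}_k$ is real-analytic and extends uniquely to a maximal geodesic on $[0,+\infty)$. The cut time of a maximal geodesic $\gamma$ is $t_{\mathrm{cut}}(\gamma)=\sup\{t>0:\gamma|_{[0,t]}\text{ is a minimizing geodesic}\}$ (the cut time of a geodesic is that of its maximal extension), and $\mathrm{Cut}_0(\mathbb{G}_k)=\{\gamma(t_{\mathrm{cut}}(\gamma)):\gamma\text{ maximal geodesic starting at }0\text{ (with }t_{\mathrm{cut}}(\gamma)<\infty)\}$. The end-point map $\mathrm{End}:L^\infty([0,1],\mathbb{R}^k)\to\mathbb{G}_k$ sends a control $u$ to the point at time $1$ of the horizontal curve starting at $0$ with control $u$. Horizontal curves whose control is a critical point of $\mathrm{End}$ (i.e. where the differential of $\mathrm{End}$ is not surjective) are called singular curves; an abnormal geodesic is a geodesic that is a singular curve (curves defined on other intervals are reparametrized affinely on $[0,1]$). The abnormal set $\mathrm{Abn}_0(\mathbb{G}_k)$ is the set of critical values of $\mathrm{End}$. $C_k$ is the set of $(x,Y)\in\mathbb{G}_k$ with $Y\neq0$ such that there exists $M\in\mathrm{O}(k)$, $M\neq\mathbb{1}$, with $Mx=x$, $MYM^*=Y$ and $Mv=v$ for all $v\in\ker Y$. The closure $\overline{C}_k$ is taken in $\mathbb{G}_k$ with its usual topology. *)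

theory Defs
  imports "HOL-Analysis.Analysis"
begin

definition ess_bounded_on :: "real set \<Rightarrow> (real \<Rightarrow> 'a::euclidean_space) \<Rightarrow> bool" where
  "ess_bounded_on I f \<longleftrightarrow> f \<in> borel_measurable (lebesgue_on I) \<and>
     (\<exists>c. AE t in lebesgue_on I. norm (f t) \<le> c)"

definition Linf_rel :: "(real \<Rightarrow> 'a::euclidean_space) \<Rightarrow> (real \<Rightarrow> 'a) \<Rightarrow> bool" where
  "Linf_rel f g \<longleftrightarrow> ess_bounded_on {0..1} f \<and> ess_bounded_on {0..1} g \<and>
     (AE t in lebesgue_on {0..1}. f t = g t)"

lemma ess_bounded_on_0: "ess_bounded_on I (\<lambda>t. 0)"
  by (auto simp: ess_bounded_on_def intro!: exI[of _ 0])

lemma ess_bounded_on_add: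
  assumes "ess_bounded_on I f" "ess_bounded_on I g"
  shows "ess_bounded_on I (\<lambda>t. f t + g t)"
proof -
  obtain c d where "AE t in lebesgue_on I. norm (f t) \<le> c" "AE t in lebesgue_on I. norm (g t) \<le> d"
    using assms unfolding ess_bounded_on_def by blast
  then have "AE t in lebesgue_on I. norm (f t + g t) \<le> c + d"
    by eventually_elim (rule norm_triangle_mono)
  then show ?thesis
    using assms unfolding ess_bounded_on_def by (blast intro: borel_measurable_add)
qed

lemma ess_bounded_on_scaleR:
  assumes "ess_bounded_on I f"
  shows "ess_bounded_on I (\<lambda>t. r *\<^sub>R f t)"
proof -
  obtain c where "AE t in lebesgue_on I. norm (f t) \<le> c"
    using assms unfolding ess_bounded_on_def by blast
  then have "AE t in lebesgue_on I. norm (r *\<^sub>R f t) \<le> \<bar>r\<bar> * c"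
    by eventually_elim (simp add: mult_left_mono)
  then show ?thesis
    using assms unfolding ess_bounded_on_def by (auto intro: borel_measurable_scaleR)
qed

lemma part_equivp_Linf_rel: "part_equivp (Linf_rel :: (real \<Rightarrow> 'a::euclidean_space) \<Rightarrow> _)"
proof (rule part_equivpI)
  show "\<exists>f :: real \<Rightarrow> 'a. Linf_rel f f"
    by (rule exI[of _ "\<lambda>t. 0"]) (simp add: Linf_rel_def ess_bounded_on_0)
  show "symp (Linf_rel :: (real \<Rightarrow> 'a) \<Rightarrow> _)"
    by (rule sympI) (auto simp: Linf_rel_def eq_commute)
  show "transp (Linf_rel :: (real \<Rightarrow> 'a) \<Rightarrow> _)"
  proof (rule transpI)
    fix f g h :: "real \<Rightarrow> 'a"
    assume fg: "Linf_rel f g" and gh: "Linf_rel g h"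
    then have "AE t in lebesgue_on {0..1}. f t = g t" "AE t in lebesgue_on {0..1}. g t = h t"
      by (simp_all add: Linf_rel_def)
    then have "AE t in lebesgue_on {0..1}. f t = h t"
      by eventually_elim simp
    then show "Linf_rel f h" using fg gh by (simp add: Linf_rel_def)
  qed
qed

quotient_type (overloaded) 'a Linf = "real \<Rightarrow> 'a::euclidean_space" / partial: Linf_rel
  by (rule part_equivp_Linf_rel)

instantiation Linf :: (euclidean_space) real_vector
begin

lift_definition zero_Linf :: "'a Linf" is "\<lambda>t. 0"
  by (simp add: Linf_rel_def ess_bounded_on_0)

lift_definition plus_Linf :: "'a Linf \<Rightarrow> 'a Linf \<Rightarrow> 'a Linf" is "\<lambda>f g t. f t + g t"
  unfolding Linf_rel_def by (auto intro: ess_bounded_on_add elim: AE_mp)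

lift_definition scaleR_Linf :: "real \<Rightarrow> 'a Linf \<Rightarrow> 'a Linf" is "\<lambda>r f t. r *\<^sub>R f t"
  unfolding Linf_rel_def by (auto intro: ess_bounded_on_scaleR elim: AE_mp)

definition uminus_Linf :: "'a Linf \<Rightarrow> 'a Linf" where "uminus_Linf f = (- 1) *\<^sub>R f"

definition minus_Linf :: "'a Linf \<Rightarrow> 'a Linf \<Rightarrow> 'a Linf" where "minus_Linf f g = f + - g"

instance
proof
  fix f g h :: "'a Linf" and r s :: real
  show "f + g + h = f + (g + h)"
    by transfer (auto simp: Linf_rel_def add.assoc intro!: ess_bounded_on_add)
  show "f + g = g + f"
    by transfer (auto simp: Linf_rel_def add.commute intro!: ess_bounded_on_add)
  show "0 + f = f"
    by transfer (auto simp: Linf_rel_def)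
  show "- f + f = 0"
    unfolding uminus_Linf_def
    by transfer (use ess_bounded_on_0 in \<open>auto simp: Linf_rel_def\<close>)
  show "f - g = f + - g" by (simp add: minus_Linf_def)
  show "r *\<^sub>R (f + g) = r *\<^sub>R f + r *\<^sub>R g"
    by transfer (auto simp: Linf_rel_def scaleR_add_right intro!: ess_bounded_on_add ess_bounded_on_scaleR)
  show "(r + s) *\<^sub>R f = r *\<^sub>R f + s *\<^sub>R f"
    by transfer (auto simp: Linf_rel_def scaleR_add_left intro!: ess_bounded_on_add ess_bounded_on_scaleR)
  show "r *\<^sub>R s *\<^sub>R f = (r * s) *\<^sub>R f"
    by transfer (auto simp: Linf_rel_def intro!: ess_bounded_on_scaleR)
  show "1 *\<^sub>R f = f"
    by transfer (auto simp: Linf_rel_def)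
qed

end

definition ess_norm :: "(real \<Rightarrow> 'a::euclidean_space) \<Rightarrow> real" where
  "ess_norm f = Inf {c. 0 \<le> c \<and> (AE t in lebesgue_on {0..1}. norm (f t) \<le> c)}"

lemma ess_norm_AE:
  assumes "ess_bounded_on {0..1} f"
  shows "AE t in lebesgue_on {0..1}. norm (f t) \<le> ess_norm f"
proof -
  let ?S = "{c. 0 \<le> c \<and> (AE t in lebesgue_on {0..1}. norm (f t) \<le> c)}"
  obtain c where c: "AE t in lebesgue_on {0..1}. norm (f t) \<le> c"
    using assms unfolding ess_bounded_on_def by blast
  have "max c 0 \<in> ?S"
    using c by (auto elim!: AE_mp)
  then have ne: "?S \<noteq> {}" by blast
  have "AE t in lebesgue_on {0..1}. norm (f t) \<le> ess_norm f + 1 / Suc n" for n :: nat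
  proof -
    have "Inf ?S < ess_norm f + 1 / Suc n" by (simp add: ess_norm_def)
    then obtain d where "d \<in> ?S" "d < ess_norm f + 1 / Suc n"
      using cInf_lessD[OF ne] by blast
    then show ?thesis by (auto elim!: AE_mp)
  qed
  then have "AE t in lebesgue_on {0..1}. \<forall>n::nat. norm (f t) \<le> ess_norm f + 1 / Suc n"
    by (simp add: AE_all_countable)
  then show ?thesis
  proof eventually_elim
    case (elim t)
    have "(\<lambda>n. ess_norm f + 1 / Suc n) \<longlonglongrightarrow> ess_norm f + 0"
      by (intro tendsto_add tendsto_const) (use LIMSEQ_Suc[OF lim_1_over_n] in simp)
    then show ?case using elim by (intro LIMSEQ_le_const) auto
  qed
qed

lemma ess_norm_le:
  assumes "0 \<le> c" "AE t in lebesgue_on {0..1}. norm (f t) \<le> c"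
  shows "ess_norm f \<le> c"
  unfolding ess_norm_def using assms by (intro cInf_lower) (auto intro: bdd_belowI[of _ 0])

lemma ess_norm_nonneg:
  assumes "ess_bounded_on {0..1} f"
  shows "0 \<le> ess_norm f"
proof -
  obtain c where "AE t in lebesgue_on {0..1}. norm (f t) \<le> c"
    using assms unfolding ess_bounded_on_def by blast
  then have "max c 0 \<in> {c. 0 \<le> c \<and> (AE t in lebesgue_on {0..1}. norm (f t) \<le> c)}"
    by (auto elim!: AE_mp)
  then have "{c. 0 \<le> c \<and> (AE t in lebesgue_on {0..1}. norm (f t) \<le> c)} \<noteq> {}"
    by blast
  then show ?thesis unfolding ess_norm_def by (intro cInf_greatest) auto
qed

instantiation Linf :: (euclidean_space) real_normed_vector
begin

lift_definition norm_Linf :: "'a Linf \<Rightarrow> real" is ess_norm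
proof -
  fix f g :: "real \<Rightarrow> 'a"
  assume "Linf_rel f g"
  then have fg: "AE t in lebesgue_on {0..1}. f t = g t" by (simp add: Linf_rel_def)
  have "(AE t in lebesgue_on {0..1}. norm (f t) \<le> c) \<longleftrightarrow> (AE t in lebesgue_on {0..1}. norm (g t) \<le> c)" for c
    using fg by (intro eventually_cong) (auto elim!: AE_mp)
  then show "ess_norm f = ess_norm g" by (simp add: ess_norm_def)
qed

definition dist_Linf :: "'a Linf \<Rightarrow> 'a Linf \<Rightarrow> real" where
  "dist_Linf f g = norm (f - g)"

definition sgn_Linf :: "'a Linf \<Rightarrow> 'a Linf" where
  "sgn_Linf f = f /\<^sub>R norm f"

definition uniformity_Linf :: "('a Linf \<times> 'a Linf) filter" where
  "uniformity_Linf = (INF e\<in>{0<..}. principal {(f, g). dist f g < e})"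

definition open_Linf :: "'a Linf set \<Rightarrow> bool" where
  "open_Linf U = (\<forall>f\<in>U. \<forall>\<^sub>F (f', g) in uniformity. f' = f \<longrightarrow> g \<in> U)"

instance
proof
  fix f g :: "'a Linf" and r :: real and U :: "'a Linf set"
  show "dist f g = norm (f - g)" by (rule dist_Linf_def)
  show "sgn f = f /\<^sub>R norm f" by (rule sgn_Linf_def)
  show "uniformity = (INF e\<in>{0<..}. principal {(f, g). dist f (g :: 'a Linf) < e})"
    by (rule uniformity_Linf_def)
  show "open U \<longleftrightarrow> (\<forall>f\<in>U. \<forall>\<^sub>F (f', g) in uniformity. f' = f \<longrightarrow> g \<in> U)"
    by (rule open_Linf_def)
  show "norm f = 0 \<longleftrightarrow> f = 0"
  proof transfer
    fix f :: "real \<Rightarrow> 'a" assume "Linf_rel f f"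
    then have f: "ess_bounded_on {0..1} f" by (simp add: Linf_rel_def)
    show "ess_norm f = 0 \<longleftrightarrow> Linf_rel f (\<lambda>t. 0)"
    proof
      assume "ess_norm f = 0"
      with ess_norm_AE[OF f] show "Linf_rel f (\<lambda>t. 0)"
        using f by (simp add: Linf_rel_def ess_bounded_on_0)
    next
      assume "Linf_rel f (\<lambda>t. 0)"
      then have "ess_norm f \<le> 0" by (intro ess_norm_le) (auto simp: Linf_rel_def)
      with ess_norm_nonneg[OF f] show "ess_norm f = 0" by simp
    qed
  qed
  show "norm (f + g) \<le> norm f + norm g"
  proof transfer
    fix f g :: "real \<Rightarrow> 'a" assume "Linf_rel f f" "Linf_rel g g"
    then have f: "ess_bounded_on {0..1} f" and g: "ess_bounded_on {0..1} g"
      by (simp_all add: Linf_rel_def)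
    show "ess_norm (\<lambda>t. f t + g t) \<le> ess_norm f + ess_norm g"
    proof (rule ess_norm_le)
      show "0 \<le> ess_norm f + ess_norm g" using ess_norm_nonneg[OF f] ess_norm_nonneg[OF g] by simp
      show "AE t in lebesgue_on {0..1}. norm (f t + g t) \<le> ess_norm f + ess_norm g"
        using ess_norm_AE[OF f] ess_norm_AE[OF g] by eventually_elim (rule norm_triangle_mono)
    qed
  qed
  have scale_le: "norm (r *\<^sub>R f) \<le> \<bar>r\<bar> * norm f" for r :: real and f :: "'a Linf"
  proof transfer
    fix r :: real and f :: "real \<Rightarrow> 'a" assume "Linf_rel f f"
    then have f: "ess_bounded_on {0..1} f" by (simp add: Linf_rel_def)
    show "ess_norm (\<lambda>t. r *\<^sub>R f t) \<le> \<bar>r\<bar> * ess_norm f"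
    proof (rule ess_norm_le)
      show "0 \<le> \<bar>r\<bar> * ess_norm f" using ess_norm_nonneg[OF f] by simp
      show "AE t in lebesgue_on {0..1}. norm (r *\<^sub>R f t) \<le> \<bar>r\<bar> * ess_norm f"
        using ess_norm_AE[OF f] by eventually_elim (simp add: mult_left_mono)
    qed
  qed
  show "norm (r *\<^sub>R f) = \<bar>r\<bar> * norm f"
  proof (cases "r = 0")
    case True
    have "0 \<le> norm (r *\<^sub>R f)"
      by transfer (simp add: Linf_rel_def ess_norm_nonneg ess_bounded_on_scaleR)
    then show ?thesis using scale_le[of r f] True by simp
  next
    case False
    have "norm f \<le> \<bar>inverse r\<bar> * norm (r *\<^sub>R f)"
      using scale_le[of "inverse r" "r *\<^sub>R f"] False by simp
    then have "\<bar>r\<bar> * norm f \<le> norm (r *\<^sub>R f)"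
      using False by (simp add: field_simps)
    then show ?thesis using scale_le[of r f] by simp
  qed
qed

end

text \<open>The group \<open>Gk\<close> is the linear subspace of pairs with skew-symmetric second component.
  It is closed in the ambient Euclidean space, so the closure of a subset of \<open>Gk\<close> is the same
  in \<open>Gk\<close> and in the ambient space.\<close>

type_synonym 'n point = "(real^'n) \<times> (real^'n^'n)"

definition Gk :: "'n::finite point set" where
  "Gk = {(x, Y). transpose Y = - Y}"

definition wedge :: "real^'n \<Rightarrow> real^'n \<Rightarrow> real^'n^'n" where
  "wedge v w = (\<chi> i j. v $ i * w $ j - w $ i * v $ j)"

text \<open>The coordinate vector \<open>\<partial>/\<partial>Y\<^bsub>lm\<^esub>\<close>, \<open>l < m\<close>, is the matrix \<open>wedge e\<^sub>l e\<^sub>m\<close>, so the sum over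
  \<open>l < m\<close> of \<open>(e\<^sub>i \<and> x)\<^bsub>lm\<^esub> \<partial>/\<partial>Y\<^bsub>lm\<^esub>\<close> is the matrix \<open>e\<^sub>i \<and> x\<close> itself.\<close>

definition X :: "'n::finite \<Rightarrow> 'n point \<Rightarrow> 'n point" where
  "X i p = (axis i 1, - ((1/2) *\<^sub>R wedge (axis i 1) (fst p)))"

lemma sum_X: "(\<Sum>i\<in>UNIV. u $ i *\<^sub>R X i (x, Y)) = (u, (1/2) *\<^sub>R wedge x u)"
proof -
  have "(\<Sum>k\<in>UNIV. u $ k *\<^sub>R axis k 1) = u"
    by (simp add: vec_eq_iff axis_def if_distrib cong: if_cong)
  moreover have "(\<Sum>k\<in>UNIV. u $ k * (axis k 1 $ i * x $ j - axis k 1 $ j * x $ i))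
      = u $ i * x $ j - u $ j * x $ i" for i j
  proof -
    have *: "(\<Sum>k\<in>UNIV. u $ k * (axis k 1 $ i * c)) = u $ i * c" for i c
      by (subst sum.remove[of _ i]) (auto simp: axis_def intro!: sum.neutral)
    show ?thesis by (simp add: right_diff_distrib sum_subtractf *)
  qed
  then have "(\<Sum>k\<in>UNIV. u $ k *\<^sub>R - ((1/2) *\<^sub>R wedge (axis k 1) x)) = (1/2) *\<^sub>R wedge x u"
    by (simp add: vec_eq_iff wedge_def sum_negf flip: sum_divide_distrib) (simp add: field_simps)
  ultimately show ?thesis
    by (simp add: X_def prod_eq_iff fst_sum snd_sum)
qed

definition horizontal :: "real \<Rightarrow> (real \<Rightarrow> 'n::finite point) \<Rightarrow> (real \<Rightarrow> real^'n) \<Rightarrow> bool" where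
  "horizontal T \<gamma> u \<longleftrightarrow>
     (\<forall>t\<in>{0..T}. \<gamma> t \<in> Gk) \<and> (\<exists>C. C-lipschitz_on {0..T} \<gamma>) \<and> ess_bounded_on {0..T} u \<and>
     (AE t in lebesgue_on {0..T}.
        (\<gamma> has_vector_derivative (\<Sum>i\<in>UNIV. u t $ i *\<^sub>R X i (\<gamma> t))) (at t within {0..T}))"

definition arc_length :: "real \<Rightarrow> real \<Rightarrow> (real \<Rightarrow> real^'n::finite) \<Rightarrow> real" where
  "arc_length a b u = integral {a..b} (\<lambda>t. norm (u t))"

definition cc_dist :: "'n::finite point \<Rightarrow> 'n point \<Rightarrow> real" where
  "cc_dist p q = Inf {arc_length 0 T u | T \<gamma> u. 0 < T \<and> horizontal T \<gamma> u \<and> \<gamma> 0 = p \<and> \<gamma> T = q}"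

text \<open>Local minimality is in time: every time has a relative neighbourhood in \<open>[0,T]\<close> such that
  all sub-arcs inside it realize the distance. Non-triviality is \<open>c > 0\<close>; the control of a
  horizontal curve is unique up to null sets.\<close>

definition geodesic :: "real \<Rightarrow> (real \<Rightarrow> 'n::finite point) \<Rightarrow> bool" where
  "geodesic T \<gamma> \<longleftrightarrow> 0 < T \<and>
     (\<exists>u. horizontal T \<gamma> u \<and>
          (\<exists>c>0. AE t in lebesgue_on {0..T}. norm (u t) = c) \<and>
          (\<forall>t\<in>{0..T}. \<exists>\<epsilon>>0. \<forall>a\<in>{0..T}. \<forall>b\<in>{0..T}.
              t - \<epsilon> < a \<and> a \<le> b \<and> b < t + \<epsilon> \<longrightarrow> arc_length a b u = cc_dist (\<gamma> a) (\<gamma> b)))"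

definition minimizing_geodesic :: "real \<Rightarrow> (real \<Rightarrow> 'n::finite point) \<Rightarrow> bool" where
  "minimizing_geodesic T \<gamma> \<longleftrightarrow> geodesic T \<gamma> \<and>
     (\<exists>u. horizontal T \<gamma> u \<and> arc_length 0 T u = cc_dist (\<gamma> 0) (\<gamma> T))"

definition geodesic_on :: "real set \<Rightarrow> (real \<Rightarrow> 'n::finite point) \<Rightarrow> bool" where
  "geodesic_on I \<gamma> \<longleftrightarrow>
     (\<exists>T>0. I = {0..T} \<and> geodesic T \<gamma>) \<or> (I = {0..} \<and> (\<forall>T>0. geodesic T \<gamma>))"

definition maximal_geodesic :: "real set \<Rightarrow> (real \<Rightarrow> 'n::finite point) \<Rightarrow> bool" where
  "maximal_geodesic I \<gamma> \<longleftrightarrow> geodesic_on I \<gamma> \<and>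
     \<not> (\<exists>J \<gamma>'. I \<subset> J \<and> geodesic_on J \<gamma>' \<and> (\<forall>t\<in>I. \<gamma>' t = \<gamma> t))"

definition maximal_cut_time :: "real set \<Rightarrow> (real \<Rightarrow> 'n::finite point) \<Rightarrow> ereal" where
  "maximal_cut_time I \<gamma> = Sup {ereal t | t. 0 < t \<and> t \<in> I \<and> minimizing_geodesic t \<gamma>}"

text \<open>The maximal extension of a geodesic is unique on its interval, but as a HOL function it is
  arbitrary elsewhere; hence the description ranges over the cut time.\<close>

definition cut_time :: "real \<Rightarrow> (real \<Rightarrow> 'n::finite point) \<Rightarrow> ereal" where
  "cut_time T \<gamma> = (THE c. \<exists>J \<gamma>'. maximal_geodesic J \<gamma>' \<and> {0..T} \<subseteq> J \<and>
     (\<forall>t\<in>{0..T}. \<gamma>' t = \<gamma> t) \<and> c = maximal_cut_time J \<gamma>')"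

definition Cut0 :: "'n::finite point set" where
  "Cut0 = {\<gamma> (real_of_ereal (maximal_cut_time I \<gamma>)) | I \<gamma>.
     maximal_geodesic I \<gamma> \<and> \<gamma> 0 = 0 \<and> maximal_cut_time I \<gamma> < \<infinity>}"

definition End :: "(real^'n::finite) Linf \<Rightarrow> 'n point" where
  "End u = (THE p. \<exists>\<gamma>. horizontal 1 \<gamma> (rep_Linf u) \<and> \<gamma> 0 = 0 \<and> \<gamma> 1 = p)"

text \<open>\<open>End\<close> takes values in the linear space \<open>Gk\<close>, which is its own tangent space; surjectivity
  of the differential is meant onto \<open>Gk\<close>.\<close>

definition critical :: "(real^'n::finite) Linf \<Rightarrow> bool" where
  "critical u \<longleftrightarrow> range (frechet_derivative End (at u)) \<noteq> Gk"

definition Abn0 :: "'n::finite point set" where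
  "Abn0 = {End u | u. critical u}"

text \<open>\<open>\<lambda>s. T *\<^sub>R u (T * s)\<close> is the control of the affine reparametrization on \<open>[0,1]\<close> of a
  horizontal curve on \<open>[0,T]\<close> with control \<open>u\<close>.\<close>

definition abnormal_geodesic :: "real \<Rightarrow> (real \<Rightarrow> 'n::finite point) \<Rightarrow> bool" where
  "abnormal_geodesic T \<gamma> \<longleftrightarrow> geodesic T \<gamma> \<and>
     (\<exists>u. horizontal T \<gamma> u \<and> critical (abs_Linf (\<lambda>s. T *\<^sub>R u (T * s))))"

definition Ck :: "'n::finite point set" where
  "Ck = {(x, Y) \<in> Gk. Y \<noteq> 0 \<and>
     (\<exists>M :: real^'n^'n. orthogonal_matrix M \<and> M \<noteq> mat 1 \<and> M *v x = x \<and>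
        M ** Y ** transpose M = Y \<and> (\<forall>v. Y *v v = 0 \<longrightarrow> M *v v = v))}"

end

theory Submission
  imports Defs
begin

text \<open>
  A horizontal curve from the origin with control \<open>u\<close> is \<open>x = \<integral>u\<close>, \<open>Y = \<integral> x \<and> u / 2\<close>, so the end-point
  map is quadratic. Integrating by parts, a covector \<open>(\<alpha>, A)\<close> annihilates its differential at \<open>u\<close>
  iff \<open>\<alpha> = 0\<close> and \<open>A u = 0\<close> a.e.; hence \<open>u\<close> is critical iff it is orthogonal to two orthonormal vectors
  \<open>a\<close>, \<open>b\<close>, and by concatenating segments orthogonal to \<open>a\<close> and \<open>b\<close> the abnormal set consists of all
  \<open>(x, Y)\<close> with \<open>a\<close>, \<open>b\<close> orthogonal to \<open>x\<close> and in the kernel of \<open>Y\<close>.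

  A point of \<open>Ck\<close> has two orthonormal vectors orthogonal to the whole orbit \<open>Y\<^sup>j x\<close>, which is a closed
  condition. Conversely let \<open>W\<close> be the orthogonal complement of this orbit: either \<open>Y\<close> vanishes on \<open>W\<close>
  and the point is abnormal, or the reflection in the invariant subspace \<open>Y W\<close> shows that it is in
  \<open>Ck\<close>. Abnormal points are limits of the points \<open>(x, Y + \<epsilon> a \<and> b)\<close> of \<open>Ck\<close>, and \<open>(0, Y)\<close> with a kernel
  of minimal dimension is in \<open>Ck\<close> but not abnormal.

  For \<open>k \<ge> 4\<close> a circle through the origin in a coordinate plane has a critical control. Short arcs of
  it minimize by a calibration, and it stops minimizing since the length of a curve enclosing a given
  area only needs to grow like the square root of that area. Hence its cut time is finite and its cut
  point is abnormal.
\<close>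

section \<open>Lipschitz curves and their derivatives\<close>

text \<open>Velocities exist only almost everywhere, while criticality, uniqueness of the curve with
  a given control and comparison of lengths are statements about integrals. Two facts carry the
  traffic between them: a Lipschitz function is the integral of its a.e. derivative, and an
  integrable function is the a.e. derivative of its primitive. Together they identify horizontal
  curves with the explicit formula \<open>hlift\<close>. Vectors come in pairs because a nonzero
  skew matrix has rank at least 2: a vector outside its kernel brings along its image, which is
  orthogonal to it. The cut time is a definite description over all maximal extensions. It is
  resolved by the fact that every curve agreeing with the circle up to time 20 has stopped
  minimizing by then, so that its cut time is read off the shared arc.\<close>

lemma AE_lebesgue_on_iff_negligible:
  assumes "S \<in> sets lebesgue"
  shows "(AE t in lebesgue_on S. P t) \<longleftrightarrow> negligible {t \<in> S. \<not> P t}"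
proof -
  have "(AE t in lebesgue_on S. P t) \<longleftrightarrow> (AE t in lebesgue. t \<in> S \<longrightarrow> P t)"
    using assms by (intro AE_restrict_space_iff) auto
  also have "\<dots> \<longleftrightarrow> negligible {t \<in> S. \<not> P t}"
  proof
    assume "AE t in lebesgue. t \<in> S \<longrightarrow> P t"
    then obtain N where "N \<in> null_sets lebesgue" "{t \<in> space lebesgue. \<not> (t \<in> S \<longrightarrow> P t)} \<subseteq> N"
      unfolding eventually_ae_filter by blast
    then show "negligible {t \<in> S. \<not> P t}"
      by (auto simp: negligible_iff_null_sets[symmetric] intro: negligible_subset)
  next
    assume "negligible {t \<in> S. \<not> P t}"
    then show "AE t in lebesgue. t \<in> S \<longrightarrow> P t"
      by (intro AE_I'[where N = "{t \<in> S. \<not> P t}"]) (auto simp: negligible_iff_null_sets)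
  qed
  finally show ?thesis .
qed

lemma negligible_affine_image:
  fixes N :: "real set"
  assumes "negligible N"
  shows "negligible ((\<lambda>t. c + m * t) ` N)"
proof -
  have "(\<lambda>t. c + m * t) differentiable_on N"
    by (auto simp: differentiable_on_def intro!: derivative_intros)
  then show ?thesis
    using assms by (intro negligible_differentiable_image_negligible) auto
qed

lemma has_vector_derivative_sequentially:
  assumes "(F has_vector_derivative D) (at x within S)"
    and "h \<longlonglongrightarrow> (0::real)" "\<And>k. h k \<noteq> 0" "\<forall>\<^sub>F k in sequentially. x + h k \<in> S"
  shows "(\<lambda>k. (1 / h k) *\<^sub>R (F (x + h k) - F x)) \<longlonglongrightarrow> D"
proof (rule LIMSEQ_I)
  fix e :: real assume "0 < e"
  then have "0 < e / 2" by simp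
  with assms(1) obtain d where "0 < d" and d: "\<And>y. y \<in> S \<Longrightarrow> norm (y - x) < d \<Longrightarrow>
      norm (F y - F x - (y - x) *\<^sub>R D) \<le> e / 2 * norm (y - x)"
    unfolding has_vector_derivative_def has_derivative_within_alt by blast
  from assms(2) \<open>0 < d\<close> have "\<forall>\<^sub>F k in sequentially. norm (h k) < d"
    by (simp add: tendsto_iff dist_norm)
  with assms(4) have "\<forall>\<^sub>F k in sequentially. norm ((1 / h k) *\<^sub>R (F (x + h k) - F x) - D) < e"
  proof eventually_elim
    case (elim k)
    have "norm (F (x + h k) - F x - h k *\<^sub>R D) \<le> e / 2 * norm (h k)"
      using d[of "x + h k"] elim by simp
    moreover have "(1 / h k) *\<^sub>R (F (x + h k) - F x) - D = (1 / h k) *\<^sub>R (F (x + h k) - F x - h k *\<^sub>R D)"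
      using assms(3)[of k] by (simp add: algebra_simps)
    ultimately have "norm ((1 / h k) *\<^sub>R (F (x + h k) - F x) - D) \<le> e / 2"
      using assms(3)[of k] by (simp add: divide_simps mult.commute)
    then show ?case using \<open>0 < e\<close> by simp
  qed
  then show "\<exists>N. \<forall>k\<ge>N. norm ((1 / h k) *\<^sub>R (F (x + h k) - F x) - D) < e"
    by (simp add: eventually_sequentially)
qed

text \<open>Forward difference quotients with steps \<open>h k\<close> are bounded by the Lipschitz
  constant and converge to \<open>g\<close> off a null set, so dominated convergence applies to
  their integrals. These integrals telescope into averages of the clamped function \<open>F\<close>
  over short intervals at \<open>b\<close> and at \<open>a\<close>, which tend to \<open>f b\<close>
  and \<open>f a\<close>.\<close>

theorem has_integral_derivative_lipschitz:
  fixes f :: "real \<Rightarrow> 'a::euclidean_space"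
  assumes "a \<le> b" and lip: "C-lipschitz_on {a..b} f"
    and ae: "AE t in lebesgue_on {a..b}. (f has_vector_derivative g t) (at t within {a..b})"
  shows "(g has_integral f b - f a) {a..b}"
proof -
  \<comment> \<open>The endpoint \<open>b\<close> joins the exceptional set because a forward
    quotient at \<open>b\<close> only sees the constant continuation of \<open>f\<close>.\<close>
  define N where "N = insert b {t \<in> {a..b}. \<not> (f has_vector_derivative g t) (at t within {a..b})}"
  have negl: "negligible N"
    using ae by (simp add: N_def AE_lebesgue_on_iff_negligible)
  \<comment> \<open>Clamping the argument to \<open>{a..b}\<close> extends \<open>f\<close> to the
    line with the same Lipschitz constant, so quotients reaching past \<open>b\<close> make
    sense.\<close>
  define F where "F t = f (min b (max a t))" for t
  have C: "0 \<le> C" using lip lipschitz_on_nonneg by blast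
  have FL: "norm (F s - F t) \<le> C * \<bar>s - t\<bar>" for s t
  proof -
    have "norm (F s - F t) \<le> C * \<bar>min b (max a s) - min b (max a t)\<bar>"
      using lipschitz_onD[OF lip, of "min b (max a s)" "min b (max a t)"] \<open>a \<le> b\<close>
      by (auto simp: F_def dist_norm)
    also have "\<dots> \<le> C * \<bar>s - t\<bar>" by (intro mult_left_mono C) auto
    finally show ?thesis .
  qed
  have "C-lipschitz_on UNIV F"
    using FL C by (auto simp: lipschitz_on_def dist_norm)
  then have cont: "continuous_on S F" for S
    by (meson lipschitz_on_continuous_on continuous_on_subset subset_UNIV)
  then have int: "F integrable_on {c..d}" for c d
    by (rule integrable_continuous_real)
  define h :: "nat \<Rightarrow> real" where "h k = 1 / real (Suc k)" for k
  have h0: "h \<longlonglongrightarrow> 0" unfolding h_def using LIMSEQ_Suc[OF lim_1_over_n] by simp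
  have hpos: "0 < h k" "h k \<le> 1" for k by (simp_all add: h_def)
  define \<Phi> where "\<Phi> s = integral {a..s} F" for s
  define D where "D k t = (1 / h k) *\<^sub>R (F (t + h k) - F t)" for k t
  define D' where "D' k t = (if t \<in> N then 0 else D k t)" for k t
  define g' where "g' t = (if t \<in> N then 0 else g t)" for t
  have intshift: "((\<lambda>t. F (t + c)) has_integral \<Phi> (b + c) - \<Phi> (a + c)) {a..b}" if "0 \<le> c" for c
  proof -
    have "integral {a..a + c} F + integral {a + c..b + c} F = integral {a..b + c} F"
      using \<open>a \<le> b\<close> that int by (intro Henstock_Kurzweil_Integration.integral_combine) auto
    then have "integral {a + c..b + c} F = \<Phi> (b + c) - \<Phi> (a + c)"
      by (simp add: \<Phi>_def eq_diff_eq add.commute)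
    then have "(F has_integral \<Phi> (b + c) - \<Phi> (a + c)) {a + c..b + c}"
      using int integrable_integral by metis
    from has_integral_shift_real_ivl[OF this, of c] show ?thesis by simp
  qed
  have intD: "(D k has_integral (1 / h k) *\<^sub>R (\<Phi> (b + h k) - \<Phi> b) - (1 / h k) *\<^sub>R (\<Phi> (a + h k) - \<Phi> a)) {a..b}" for k
  proof -
    have "(D k has_integral (1 / h k) *\<^sub>R ((\<Phi> (b + h k) - \<Phi> (a + h k)) - (\<Phi> (b + 0) - \<Phi> (a + 0)))) {a..b}"
      unfolding D_def using intshift[of "h k"] intshift[of 0] hpos[of k]
      by (intro has_integral_cmul has_integral_diff) auto
    then show ?thesis by (simp add: algebra_simps)
  qed
  have intD': "(D' k has_integral (1 / h k) *\<^sub>R (\<Phi> (b + h k) - \<Phi> b) - (1 / h k) *\<^sub>R (\<Phi> (a + h k) - \<Phi> a)) {a..b}" for k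
    by (rule has_integral_spike[OF negl _ intD]) (simp add: D'_def)
  have conv: "(\<lambda>k. D' k t) \<longlonglongrightarrow> g' t" if "t \<in> {a..b}" for t
  proof (cases "t \<in> N")
    case False
    then have t: "(f has_vector_derivative g t) (at t within {a..b})" "a \<le> t" "t < b"
      using that by (auto simp: N_def order.strict_iff_order)
    have ev: "\<forall>\<^sub>F k in sequentially. t + h k \<in> {a..b}"
    proof -
      have "\<forall>\<^sub>F k in sequentially. h k < b - t"
        using h0 t(3) by (intro order_tendstoD) auto
      then show ?thesis
      proof eventually_elim
        case (elim k)
        then show ?case using t hpos(1)[of k] by auto
      qed
    qed
    have "(\<lambda>k. (1 / h k) *\<^sub>R (f (t + h k) - f t)) \<longlonglongrightarrow> g t"
      using h0 hpos(1) ev by (intro has_vector_derivative_sequentially[OF t(1)]) (auto simp: less_imp_neq[symmetric])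
    moreover have "\<forall>\<^sub>F k in sequentially. (1 / h k) *\<^sub>R (f (t + h k) - f t) = D k t"
      using ev by eventually_elim (use t in \<open>auto simp: D_def F_def min_def max_def\<close>)
    ultimately have "(\<lambda>k. D k t) \<longlonglongrightarrow> g t" by (rule Lim_transform_eventually)
    then show ?thesis using False by (simp add: D'_def g'_def)
  qed (simp add: D'_def g'_def)
  have bnd: "norm (D' k t) \<le> C" for k t
  proof -
    have "norm (D k t) \<le> (1 / h k) * (C * \<bar>h k\<bar>)"
      using FL[of "t + h k" t] hpos[of k] by (simp add: D_def divide_le_eq)
    also have "\<dots> = C" using hpos[of k] by simp
    finally show ?thesis using C by (simp add: D'_def)
  qed
  have lim: "(\<lambda>k. integral {a..b} (D' k)) \<longlonglongrightarrow> integral {a..b} g'" and g'int: "g' integrable_on {a..b}"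
    using dominated_convergence[of D' "{a..b}" "\<lambda>_. C" g'] intD' bnd conv
    by (blast intro: integrable_const_ivl)+
  have \<Phi>lim: "(\<lambda>k. (1 / h k) *\<^sub>R (\<Phi> (c + h k) - \<Phi> c)) \<longlonglongrightarrow> F c" if "c \<in> {a..b}" for c
  proof (rule has_vector_derivative_sequentially)
    show "(\<Phi> has_vector_derivative F c) (at c within {a..b + 1})"
      unfolding \<Phi>_def using that by (intro integral_has_vector_derivative cont) auto
    show "\<forall>\<^sub>F k in sequentially. c + h k \<in> {a..b + 1}"
      using that hpos by (intro always_eventually allI) (smt (verit) atLeastAtMost_iff)
  qed (use h0 hpos in \<open>auto simp: less_imp_neq[symmetric]\<close>)
  have "(\<lambda>k. integral {a..b} (D' k)) \<longlonglongrightarrow> F b - F a"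
    using tendsto_diff[OF \<Phi>lim[of b] \<Phi>lim[of a]] \<open>a \<le> b\<close> integral_unique[OF intD'] by simp
  then have "integral {a..b} g' = F b - F a"
    using lim LIMSEQ_unique by blast
  then have "(g' has_integral f b - f a) {a..b}"
    using g'int \<open>a \<le> b\<close> by (simp add: has_integral_iff F_def)
  then show ?thesis
    by (rule has_integral_spike[OF negl, rotated]) (simp add: g'_def)
qed

text \<open>Convergence of the averages over \<open>{x..x + h}\<close> controls increments to the
  right of a point. The reflected function \<open>\<lambda>t. f (- t)\<close> supplies the
  increments to the left, with a reflected exceptional set.\<close>

theorem has_vector_derivative_integral_AE:
  fixes u :: "real \<Rightarrow> 'a::euclidean_space"
  assumes u: "u integrable_on {a..b}"
  shows "AE t in lebesgue_on {a..b}. ((\<lambda>s. integral {a..s} u) has_vector_derivative u t) (at t within {a..b})"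
proof -
  define f where "f t = (if t \<in> {a..b} then u t else 0)" for t
  have fUNIV: "f integrable_on UNIV" unfolding f_def using u by (simp only: integrable_restrict_UNIV)
  have int: "f integrable_on {c..d}" for c d
    using integrable_on_subcbox[OF fUNIV, of c d] by simp
  have int': "(\<lambda>t. f (- t)) integrable_on {c..d}" for c d
    using Henstock_Kurzweil_Integration.integrable_reflect_real[where f = f and a = "- d" and b = "- c"] int[of "- d" "- c"] by simp
  obtain N where N: "negligible N" "\<And>x e. \<lbrakk>x \<notin> N; 0 < e\<rbrakk> \<Longrightarrow> \<exists>d>0. \<forall>h. 0 < h \<and> h < d \<longrightarrow>
      norm (integral {x..x + h} f /\<^sub>R h - f x) < e"
    using integrable_ccontinuous_explicit[of f] int by (auto simp: cbox_interval)
  obtain N' where N': "negligible N'" "\<And>x e. \<lbrakk>x \<notin> N'; 0 < e\<rbrakk> \<Longrightarrow> \<exists>d>0. \<forall>h. 0 < h \<and> h < d \<longrightarrow>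
      norm (integral {x..x + h} (\<lambda>t. f (- t)) /\<^sub>R h - f (- x)) < e"
    using integrable_ccontinuous_explicit[of "\<lambda>t. f (- t)"] int' by (auto simp: cbox_interval)
  have "((\<lambda>s. integral {a..s} u) has_vector_derivative u t) (at t within {a..b})"
    if t: "t \<in> {a..b}" "t \<notin> N" "- t \<notin> N'" for t
    unfolding has_vector_derivative_def has_derivative_within_alt
  proof (intro conjI allI impI)
    show "bounded_linear (\<lambda>x. x *\<^sub>R u t)" by (rule bounded_linear_scaleR_left)
    fix e :: real assume "0 < e"
    obtain d where d: "0 < d" "\<And>h. \<lbrakk>0 < h; h < d\<rbrakk> \<Longrightarrow> norm (integral {t..t + h} f /\<^sub>R h - f t) < e"
      using N(2)[OF t(2) \<open>0 < e\<close>] by blast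
    obtain d' where d': "0 < d'" "\<And>h. \<lbrakk>0 < h; h < d'\<rbrakk> \<Longrightarrow>
        norm (integral {- t..- t + h} (\<lambda>t. f (- t)) /\<^sub>R h - f t) < e"
      using N'(2)[OF t(3) \<open>0 < e\<close>] by force
    have ft: "f t = u t" using t by (simp add: f_def)
    have "norm (integral {a..y} u - integral {a..t} u - (y - t) *\<^sub>R u t) \<le> e * norm (y - t)"
      if y: "y \<in> {a..b}" "norm (y - t) < min d d'" for y
    proof -
      have uf: "integral {c..d} u = integral {c..d} f" if "a \<le> c" "d \<le> b" for c d
        using that by (intro integral_cong) (auto simp: f_def)
      have usub: "u integrable_on {a..d}" if "d \<le> b" for d
        using integrable_subinterval_real[OF u, of a d] that by auto
      consider "y = t" | "t < y" | "y < t" by linarith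
      then show ?thesis
      proof cases
        case 2
        define h where "h = y - t"
        have hne: "h \<noteq> 0" using 2 by (simp add: h_def)
        have "integral {a..t} u + integral {t..y} u = integral {a..y} u"
          using 2 y t by (intro Henstock_Kurzweil_Integration.integral_combine usub) auto
        then have "integral {a..y} u - integral {a..t} u = integral {t..y} f"
          using uf[of t y] y t by (simp add: diff_eq_eq add.commute)
        moreover have "norm (integral {t..y} f /\<^sub>R h - f t) < e"
          using d(2)[of h] 2 y by (simp add: h_def)
        moreover have "integral {t..y} f - h *\<^sub>R f t = h *\<^sub>R (integral {t..y} f /\<^sub>R h - f t)"
          using hne by (simp add: scaleR_right_diff_distrib)
        ultimately show ?thesis using 2 by (simp add: ft h_def mult.commute less_imp_le)
      next
        case 3
        define h where "h = t - y"
        have hne: "h \<noteq> 0" using 3 by (simp add: h_def)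
        have "integral {a..y} u + integral {y..t} u = integral {a..t} u"
          using 3 y t by (intro Henstock_Kurzweil_Integration.integral_combine usub) auto
        then have "integral {a..t} u - integral {a..y} u = integral {y..t} f"
          using uf[of y t] y t by (simp add: diff_eq_eq add.commute)
        moreover have "integral {- t..- t + h} (\<lambda>t. f (- t)) = integral {y..t} f"
          using Henstock_Kurzweil_Integration.integral_reflect_real[where f = f and a = y and b = t] by (simp add: h_def)
        moreover have "norm (integral {- t..- t + h} (\<lambda>t. f (- t)) /\<^sub>R h - f t) < e"
          using d'(2)[of h] 3 y by (simp add: h_def)
        moreover have "integral {y..t} f - h *\<^sub>R f t = h *\<^sub>R (integral {y..t} f /\<^sub>R h - f t)"
          using hne by (simp add: scaleR_right_diff_distrib)
        moreover have "integral {a..y} u - integral {a..t} u - (y - t) *\<^sub>R u t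
            = - ((integral {a..t} u - integral {a..y} u) - h *\<^sub>R u t)"
          by (simp add: h_def algebra_simps)
        ultimately show ?thesis using 3 by (simp only: norm_minus_cancel ft norm_scaleR)
            (simp add: h_def mult.commute less_imp_le)
      qed simp
    qed
    then show "\<exists>d>0. \<forall>y\<in>{a..b}. norm (y - t) < d \<longrightarrow>
        norm (integral {a..y} u - integral {a..t} u - (y - t) *\<^sub>R u t) \<le> e * norm (y - t)"
      using d(1) d'(1) by (intro exI[of _ "min d d'"]) auto
  qed
  moreover have "negligible (N \<union> uminus ` N')"
    using N(1) negligible_affine_image[OF N'(1), of 0 "- 1"]
    by (intro negligible_Un) (auto simp: image_def)
  ultimately show ?thesis
    by (subst AE_lebesgue_on_iff_negligible) (simp, erule negligible_subset, force simp: image_iff)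
qed

section \<open>Essentially bounded functions\<close>

lemma AE_lebesgue_on_Icc_iff:
  "(AE t in lebesgue_on {a..b::real}. P t) \<longleftrightarrow> negligible {t \<in> {a..b}. \<not> P t}"
  by (rule AE_lebesgue_on_iff_negligible) simp

lemma ess_bounded_on_bound:
  assumes "ess_bounded_on {a..b} u"
  obtains c where "0 \<le> c" "negligible {t \<in> {a..b}. \<not> norm (u t) \<le> c}"
proof -
  obtain c where c: "AE t in lebesgue_on {a..b}. norm (u t) \<le> c"
    using assms unfolding ess_bounded_on_def by blast
  have "negligible {t \<in> {a..b}. \<not> norm (u t) \<le> c}"
    using c by (simp add: AE_lebesgue_on_iff_negligible)
  then have "negligible {t \<in> {a..b}. \<not> norm (u t) \<le> \<bar>c\<bar>}"
    by (rule negligible_subset) auto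
  then show ?thesis using that[of "\<bar>c\<bar>"] by simp
qed

lemma ess_bounded_on_absolutely_integrable:
  assumes "ess_bounded_on {a..b} u"
  shows "u absolutely_integrable_on {a..b}"
proof -
  obtain c where c: "0 \<le> c" "negligible {t \<in> {a..b}. \<not> norm (u t) \<le> c}"
    using ess_bounded_on_bound[OF assms] by blast
  define v where "v t = (if norm (u t) \<le> c then u t else 0)" for t
  have [measurable]: "u \<in> borel_measurable (lebesgue_on {a..b})"
    using assms by (simp add: ess_bounded_on_def)
  have "v \<in> borel_measurable (lebesgue_on {a..b})" unfolding v_def by measurable
  then have "v absolutely_integrable_on {a..b}"
    using c(1) by (intro measurable_bounded_by_integrable_imp_absolutely_integrable[where g = "\<lambda>_. c"])
      (auto simp: v_def)
  then show ?thesis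
    by (rule absolutely_integrable_spike[OF _ c(2)]) (auto simp: v_def)
qed

lemma ess_bounded_on_integrable:
  "ess_bounded_on {a..b} u \<Longrightarrow> u integrable_on {a..b}"
  using ess_bounded_on_absolutely_integrable set_lebesgue_integral_eq_integral(1) by blast

lemma continuous_imp_ess_bounded_on:
  fixes f :: "real \<Rightarrow> 'a::euclidean_space"
  assumes "continuous_on {a..b} f"
  shows "ess_bounded_on {a..b} f"
proof -
  have "bounded (f ` {a..b})"
    using assms by (intro compact_imp_bounded compact_continuous_image) auto
  then obtain c where "\<forall>t\<in>{a..b}. norm (f t) \<le> c" by (auto simp: bounded_iff)
  then have "AE t in lebesgue_on {a..b}. norm (f t) \<le> c"
    by (intro AE_I2) (simp add: space_restrict_space)
  then show ?thesis
    unfolding ess_bounded_on_def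
    using continuous_imp_measurable_on_sets_lebesgue[OF assms] by auto
qed

lemma ess_bounded_on_bilinear:
  fixes f :: "real \<Rightarrow> 'a::euclidean_space" and g :: "real \<Rightarrow> 'b::euclidean_space"
    and h :: "'a \<Rightarrow> 'b \<Rightarrow> 'c::euclidean_space"
  assumes h: "bounded_bilinear h" and f: "ess_bounded_on {a..b} f" and g: "ess_bounded_on {a..b} g"
  shows "ess_bounded_on {a..b} (\<lambda>t. h (f t) (g t))"
proof -
  interpret bounded_bilinear h by fact
  obtain K where K: "0 \<le> K" "\<And>x y. norm (h x y) \<le> norm x * norm y * K"
    using nonneg_bounded by blast
  obtain c d where c: "AE t in lebesgue_on {a..b}. norm (f t) \<le> c"
    and d: "AE t in lebesgue_on {a..b}. norm (g t) \<le> d"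
    using f g unfolding ess_bounded_on_def by blast
  from c d have "AE t in lebesgue_on {a..b}. norm (h (f t) (g t)) \<le> c * d * K"
  proof eventually_elim
    case (elim t)
    have "norm (f t) * norm (g t) * K \<le> c * d * K"
      using elim K(1) order_trans[OF norm_ge_zero elim(1)] order_trans[OF norm_ge_zero elim(2)]
      by (intro mult_mono) auto
    then show ?case using K(2)[of "f t" "g t"] by linarith
  qed
  moreover have "continuous_on UNIV (\<lambda>x. h (fst x) (snd x))"
    by (rule continuous_on[OF continuous_on_fst[OF continuous_on_id] continuous_on_snd[OF continuous_on_id]])
  then have "(\<lambda>t. h (f t) (g t)) \<in> borel_measurable (lebesgue_on {a..b})"
    using f g unfolding ess_bounded_on_def
    by (intro borel_measurable_continuous_Pair[where H = h]) blast+
  ultimately show ?thesis unfolding ess_bounded_on_def by blast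
qed

lemma norm_integral_le_AE:
  fixes u :: "real \<Rightarrow> 'a::euclidean_space"
  assumes "a \<le> b" and u: "u integrable_on {a..b}" and c: "0 \<le> c" "negligible {t \<in> {a..b}. \<not> norm (u t) \<le> c}"
  shows "norm (integral {a..b} u) \<le> c * (b - a)"
proof -
  define v where "v t = (if norm (u t) \<le> c then u t else 0)" for t
  have "integral {a..b} u = integral {a..b} v"
    by (rule integral_spike[OF c(2)]) (auto simp: v_def)
  moreover have "v integrable_on {a..b}"
    by (rule integrable_spike[OF u c(2)]) (auto simp: v_def)
  then have "norm (integral {a..b} v) \<le> c * (b - a)"
    using integrable_bound[of c v a b] c(1) \<open>a \<le> b\<close> by (auto simp: v_def cbox_interval)
  ultimately show ?thesis by simp
qed

lemma lipschitz_on_integral: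
  fixes u :: "real \<Rightarrow> 'a::euclidean_space"
  assumes "ess_bounded_on {a..b} u"
  shows "\<exists>C. C-lipschitz_on {a..b} (\<lambda>t. integral {a..t} u)"
proof -
  obtain c where c: "0 \<le> c" "negligible {t \<in> {a..b}. \<not> norm (u t) \<le> c}"
    using ess_bounded_on_bound[OF assms] by blast
  note int = ess_bounded_on_integrable[OF assms]
  have *: "norm (integral {a..t} u - integral {a..s} u) \<le> c * (t - s)"
    if "a \<le> s" "s \<le> t" "t \<le> b" for s t
  proof -
    have "integral {a..s} u + integral {s..t} u = integral {a..t} u"
      using that integrable_subinterval_real[OF int, of a t]
      by (intro Henstock_Kurzweil_Integration.integral_combine) auto
    moreover have "negligible {r \<in> {s..t}. \<not> norm (u r) \<le> c}"
      by (rule negligible_subset[OF c(2)]) (use that in auto)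
    then have "norm (integral {s..t} u) \<le> c * (t - s)"
      using that integrable_subinterval_real[OF int, of s t] c(1) by (intro norm_integral_le_AE) auto
    ultimately show ?thesis by (simp add: diff_eq_eq[symmetric] eq_diff_eq[symmetric] add.commute flip: add_diff_eq)
  qed
  have "c-lipschitz_on {a..b} (\<lambda>t. integral {a..t} u)"
  proof (rule lipschitz_onI)
    fix s t assume st: "s \<in> {a..b}" "t \<in> {a..b}"
    then show "dist (integral {a..s} u) (integral {a..t} u) \<le> c * dist s t"
      using *[of s t] *[of t s] by (cases "s \<le> t") (auto simp: dist_norm norm_minus_commute)
  qed (fact c(1))
  then show ?thesis by blast
qed

section \<open>Horizontal curves\<close>

lemma bounded_bilinear_wedge: "bounded_bilinear (wedge :: real^'n::finite \<Rightarrow> _)"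
  unfolding bilinear_conv_bounded_bilinear[symmetric] bilinear_def
  by (auto simp: linear_iff wedge_def vec_eq_iff algebra_simps)

interpretation wedge: bounded_bilinear "wedge :: real^'n::finite \<Rightarrow> real^'n \<Rightarrow> real^'n^'n"
  by (rule bounded_bilinear_wedge)

lemma transpose_wedge: "transpose (wedge x y) = - wedge x y"
  by (simp add: transpose_def wedge_def vec_eq_iff)

lemma wedge_self [simp]: "wedge x x = 0"
  by (simp add: wedge_def vec_eq_iff)

lemma wedge_swap: "wedge x y = - wedge y x"
  by (simp add: wedge_def vec_eq_iff)

lemma bounded_linear_transpose: "bounded_linear (transpose :: real^'n::finite^'n \<Rightarrow> _)"
  unfolding linear_conv_bounded_linear[symmetric]
  by (auto simp: linear_iff transpose_def vec_eq_iff)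

text \<open>Since the derivative of Y depends on x and u alone, the horizontal equations are solved
  by two successive integrations, x first and then Y. This is their solution from \<open>p\<close>
  with control \<open>u\<close>.\<close>

definition hlift :: "'n::finite point \<Rightarrow> (real \<Rightarrow> real^'n) \<Rightarrow> real \<Rightarrow> 'n point" where
  "hlift p u t = (fst p + integral {0..t} u,
     snd p + (1/2) *\<^sub>R integral {0..t} (\<lambda>s. wedge (fst p + integral {0..s} u) (u s)))"

lemma ess_bounded_on_wedge_integral:
  assumes "ess_bounded_on {0..T} u"
  shows "ess_bounded_on {0..T} (\<lambda>s. wedge (x + integral {0..s} u) (u s))"
proof -
  obtain C where "C-lipschitz_on {0..T} (\<lambda>t. integral {0..t} u)"
    using lipschitz_on_integral[OF assms] by blast
  then have "continuous_on {0..T} (\<lambda>t. x + integral {0..t} u)"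
    by (intro continuous_intros lipschitz_on_continuous_on)
  then show ?thesis
    by (rule ess_bounded_on_bilinear[OF bounded_bilinear_wedge continuous_imp_ess_bounded_on assms])
qed

lemma transpose_integral_wedge:
  fixes x u :: "real \<Rightarrow> real^'n::finite"
  assumes "(\<lambda>s. wedge (x s) (u s)) integrable_on S"
  shows "transpose (integral S (\<lambda>s. wedge (x s) (u s))) = - integral S (\<lambda>s. wedge (x s) (u s))"
  using integral_linear[OF assms bounded_linear_transpose] integral_neg[of S "\<lambda>s. wedge (x s) (u s)"]
  by (simp add: o_def transpose_wedge)

lemma linear_transpose_simps:
  fixes A B :: "real^'n^'n"
  shows "transpose (A + B) = transpose A + transpose B" "transpose (c *\<^sub>R A) = c *\<^sub>R transpose A"
    "transpose (A - B) = transpose A - transpose B" "transpose (- A) = - transpose A"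
  by (simp_all add: transpose_def vec_eq_iff)

theorem horizontal_hlift:
  assumes u: "ess_bounded_on {0..T} u" and p: "p \<in> Gk"
  shows "horizontal T (hlift p u) u"
proof -
  let ?w = "\<lambda>s. wedge (fst p + integral {0..s} u) (u s)"
  have w: "ess_bounded_on {0..T} ?w" by (rule ess_bounded_on_wedge_integral[OF u])
  have "hlift p u t \<in> Gk" if "t \<in> {0..T}" for t
  proof -
    have "?w integrable_on {0..t}"
      using integrable_subinterval_real[OF ess_bounded_on_integrable[OF w]] that by auto
    from transpose_integral_wedge[OF this] show ?thesis
      using p by (simp add: Gk_def hlift_def linear_transpose_simps split_beta)
  qed
  moreover have "\<exists>C. C-lipschitz_on {0..T} (hlift p u)"
  proof -
    obtain C D where C: "C-lipschitz_on {0..T} (\<lambda>t. integral {0..t} u)"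
      and D: "D-lipschitz_on {0..T} (\<lambda>t. integral {0..t} ?w)"
      using lipschitz_on_integral[OF u] lipschitz_on_integral[OF w] by blast
    have "(sqrt ((0 + C)\<^sup>2 + (0 + \<bar>1/2\<bar> * D)\<^sup>2))-lipschitz_on {0..T} (hlift p u)"
      unfolding hlift_def by (intro lipschitz_on_Pair lipschitz_on_add lipschitz_on_constant lipschitz_on_cmult_real C D lipschitz_on_cmult)
    then show ?thesis by blast
  qed
  moreover have "AE t in lebesgue_on {0..T}.
      (hlift p u has_vector_derivative (\<Sum>i\<in>UNIV. u t $ i *\<^sub>R X i (hlift p u t))) (at t within {0..T})"
    using has_vector_derivative_integral_AE[OF ess_bounded_on_integrable[OF u]]
      has_vector_derivative_integral_AE[OF ess_bounded_on_integrable[OF w]]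
  proof eventually_elim
    case (elim t)
    have "(hlift p u has_vector_derivative (0 + u t, 0 + (1/2) *\<^sub>R ?w t)) (at t within {0..T})"
      unfolding hlift_def
      by (intro has_vector_derivative_Pair has_vector_derivative_add has_vector_derivative_const
          bounded_linear.has_vector_derivative[OF bounded_linear_scaleR_right] elim)
    then show ?case by (simp add: hlift_def sum_X)
  qed
  ultimately show ?thesis using u unfolding horizontal_def by blast
qed

lemma horizontal_iff:
  "horizontal T \<gamma> u \<longleftrightarrow> (\<forall>t\<in>{0..T}. \<gamma> t \<in> Gk) \<and> (\<exists>C. C-lipschitz_on {0..T} \<gamma>) \<and> ess_bounded_on {0..T} u \<and>
     negligible {t \<in> {0..T}. \<not> (\<gamma> has_vector_derivative (u t, (1/2) *\<^sub>R wedge (fst (\<gamma> t)) (u t))) (at t within {0..T})}"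
proof -
  have "(\<Sum>i\<in>UNIV. u t $ i *\<^sub>R X i (\<gamma> t)) = (u t, (1/2) *\<^sub>R wedge (fst (\<gamma> t)) (u t))" for t
    using sum_X[of "u t" "fst (\<gamma> t)" "snd (\<gamma> t)"] by simp
  then show ?thesis by (simp add: horizontal_def AE_lebesgue_on_Icc_iff)
qed

lemma horizontal_AE_derivative:
  assumes "horizontal T \<gamma> u"
  shows "AE t in lebesgue_on {0..T}. ((\<lambda>t. fst (\<gamma> t)) has_vector_derivative u t) (at t within {0..T}) \<and>
     ((\<lambda>t. snd (\<gamma> t)) has_vector_derivative (1/2) *\<^sub>R wedge (fst (\<gamma> t)) (u t)) (at t within {0..T})"
proof -
  have "AE t in lebesgue_on {0..T}.
      (\<gamma> has_vector_derivative (u t, (1/2) *\<^sub>R wedge (fst (\<gamma> t)) (u t))) (at t within {0..T})"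
    using assms by (simp add: horizontal_iff AE_lebesgue_on_Icc_iff)
  then show ?thesis
  proof eventually_elim
    case (elim t)
    show ?case
      using bounded_linear.has_vector_derivative[OF bounded_linear_fst elim]
        bounded_linear.has_vector_derivative[OF bounded_linear_snd elim] by simp
  qed
qed

text \<open>The fundamental theorem for Lipschitz functions is applied to x first, because the
  integrand for Y contains x. Together with \<open>horizontal_hlift\<close> this gives existence and
  uniqueness of the curve with a given start and control.\<close>

theorem horizontal_imp_hlift:
  assumes h: "horizontal T \<gamma> u" and t: "t \<in> {0..T}"
  shows "\<gamma> t = hlift (\<gamma> 0) u t"
proof -
  obtain C where C: "C-lipschitz_on {0..T} \<gamma>" using h unfolding horizontal_def by blast
  have C': "C-lipschitz_on {0..s} (\<lambda>t. fst (\<gamma> t))" "C-lipschitz_on {0..s} (\<lambda>t. snd (\<gamma> t))" if "s \<in> {0..T}" for s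
  proof -
    have "C-lipschitz_on {0..s} \<gamma>" using that by (intro lipschitz_on_subset[OF C]) auto
    then show "C-lipschitz_on {0..s} (\<lambda>t. fst (\<gamma> t))" "C-lipschitz_on {0..s} (\<lambda>t. snd (\<gamma> t))"
      unfolding lipschitz_on_def by (meson dist_fst_le dist_snd_le order_trans)+
  qed
  \<comment> \<open>A derivative relative to \<open>{0..T}\<close> is also one relative to the
    smaller interval, so the exceptional set can only shrink.\<close>
  have AE': "AE t in lebesgue_on {0..s}. ((\<lambda>t. fst (\<gamma> t)) has_vector_derivative u t) (at t within {0..s}) \<and>
     ((\<lambda>t. snd (\<gamma> t)) has_vector_derivative (1/2) *\<^sub>R wedge (fst (\<gamma> t)) (u t)) (at t within {0..s})"
    if "s \<in> {0..T}" for s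
  proof -
    let ?P = "\<lambda>s t. ((\<lambda>t. fst (\<gamma> t)) has_vector_derivative u t) (at t within {0..s}) \<and>
     ((\<lambda>t. snd (\<gamma> t)) has_vector_derivative (1/2) *\<^sub>R wedge (fst (\<gamma> t)) (u t)) (at t within {0..s})"
    have "{t \<in> {0..s}. \<not> ?P s t} \<subseteq> {t \<in> {0..T}. \<not> ?P T t}"
      using that by (auto intro: has_vector_derivative_within_subset[of _ _ _ "{0..T}"])
    then show ?thesis
      using horizontal_AE_derivative[OF h] unfolding AE_lebesgue_on_Icc_iff
      by (meson negligible_subset)
  qed
  have x: "fst (\<gamma> s) = fst (\<gamma> 0) + integral {0..s} u" if "s \<in> {0..T}" for s
  proof -
    have "(u has_integral fst (\<gamma> s) - fst (\<gamma> 0)) {0..s}"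
      using that C'(1)[OF that] eventually_mono[OF AE'[OF that]]
      by (intro has_integral_derivative_lipschitz[where f = "\<lambda>t. fst (\<gamma> t)"]) auto
    then show ?thesis by (simp add: integral_unique)
  qed
  have "((\<lambda>s. (1/2) *\<^sub>R wedge (fst (\<gamma> s)) (u s)) has_integral snd (\<gamma> t) - snd (\<gamma> 0)) {0..t}"
    using t C'(2)[OF t] eventually_mono[OF AE'[OF t]]
    by (intro has_integral_derivative_lipschitz[where f = "\<lambda>t. snd (\<gamma> t)"]) auto
  then have "((\<lambda>s. (1/2) *\<^sub>R wedge (fst (\<gamma> 0) + integral {0..s} u) (u s)) has_integral snd (\<gamma> t) - snd (\<gamma> 0)) {0..t}"
    by (rule has_integral_eq[rotated]) (use t in \<open>auto simp flip: x\<close>)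
  from integral_unique[OF this]
  have "(1/2) *\<^sub>R integral {0..t} (\<lambda>s. wedge (fst (\<gamma> 0) + integral {0..s} u) (u s)) = snd (\<gamma> t) - snd (\<gamma> 0)"
    by (simp only: integral_cmul)
  then show ?thesis using x[OF t] by (simp add: hlift_def prod_eq_iff)
qed


section \<open>Time changes, concatenation and left translation of horizontal curves\<close>

lemma ess_bounded_onI:
  assumes "u integrable_on {a..b}" "negligible {t \<in> {a..b}. \<not> norm (u t) \<le> c}"
  shows "ess_bounded_on {a..b} u"
  unfolding ess_bounded_on_def AE_lebesgue_on_Icc_iff
  using integrable_imp_measurable[OF assms(1)] assms(2) by blast

lemma ess_bounded_on_affine:
  fixes u :: "real \<Rightarrow> 'a::euclidean_space"
  assumes u: "ess_bounded_on {0..T} u" and m: "0 < m" and a: "0 \<le> a" "a + m * S \<le> T"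
  shows "ess_bounded_on {0..S} (\<lambda>t. u (a + m * t))"
proof -
  obtain c where c: "negligible {t \<in> {0..T}. \<not> norm (u t) \<le> c}"
    using ess_bounded_on_bound[OF u] by blast
  have "negligible {t \<in> {0..S}. \<not> norm (u (a + m * t)) \<le> c}"
  proof (rule negligible_subset[OF negligible_affine_image[OF c, of "- a / m" "1 / m"]], clarify)
    fix t assume t: "t \<in> {0..S}" "\<not> norm (u (a + m * t)) \<le> c"
    then have "m * t \<le> m * S" "0 \<le> m * t" using m by auto
    then have "a + m * t \<in> {0..T}" using a by auto
    moreover have "t = - a / m + 1 / m * (a + m * t)" using m by (simp add: field_simps)
    ultimately show "t \<in> (\<lambda>t. - a / m + 1 / m * t) ` {t \<in> {0..T}. \<not> norm (u t) \<le> c}"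
      using t by blast
  qed
  moreover have "(\<lambda>t. u (a + m * t)) integrable_on {0..S}"
  proof (cases "0 \<le> S")
    case True
    then have "0 \<le> m * S" using m by simp
    then have "u integrable_on cbox a (a + m * S)"
      using integrable_subinterval_real[OF ess_bounded_on_integrable[OF u]] a by auto
    from integrable_affinity[OF this, of m a] m
    have "(\<lambda>t. u (m *\<^sub>R t + a)) integrable_on ((\<lambda>t. (1 / m) *\<^sub>R t + - ((1 / m) *\<^sub>R a)) ` cbox a (a + m * S))"
      by simp
    moreover have "(\<lambda>t. (1 / m) *\<^sub>R t + - ((1 / m) *\<^sub>R a)) ` cbox a (a + m * S) = {0..S}"
    proof (intro equalityI subsetI)
      fix t assume "t \<in> {0..S}"
      then show "t \<in> (\<lambda>t. (1 / m) *\<^sub>R t + - ((1 / m) *\<^sub>R a)) ` cbox a (a + m * S)"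
        using m by (intro image_eqI[of _ _ "a + m * t"]) (auto simp: field_simps)
    qed (use m in \<open>auto simp: field_simps\<close>)
    ultimately show ?thesis by (simp add: add.commute)
  qed auto
  ultimately show ?thesis by (rule ess_bounded_onI[rotated])
qed

text \<open>The equations are homogeneous of degree one in the velocity, hence the factor
  \<open>m\<close> on the control. The choice m = 1 cuts out a subarc; a = 0 and m = T normalize a
  curve to \<open>[0,1]\<close>.\<close>

lemma horizontal_affine:
  assumes h: "horizontal T \<gamma> u" and m: "0 < m" and a: "0 \<le> a" "a + m * S \<le> T"
  shows "horizontal S (\<lambda>t. \<gamma> (a + m * t)) (\<lambda>t. m *\<^sub>R u (a + m * t))"
proof -
  have in_T: "a + m * t \<in> {0..T}" if "t \<in> {0..S}" for t
  proof -
    have "m * t \<le> m * S" "0 \<le> m * t" using m that by auto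
    then show ?thesis using a by auto
  qed
  have "\<exists>C. C-lipschitz_on {0..S} (\<lambda>t. \<gamma> (a + m * t))"
  proof -
    obtain C where C: "C-lipschitz_on {0..T} \<gamma>" using h unfolding horizontal_def by blast
    have "m-lipschitz_on {0..S} (\<lambda>t. a + m * t)"
      using m by (auto simp: lipschitz_on_def dist_real_def abs_mult simp flip: right_diff_distrib)
    moreover have "C-lipschitz_on ((\<lambda>t. a + m * t) ` {0..S}) \<gamma>"
      using in_T by (intro lipschitz_on_subset[OF C]) auto
    ultimately show ?thesis using lipschitz_on_compose by (fastforce simp: o_def)
  qed
  moreover have "ess_bounded_on {0..S} (\<lambda>t. m *\<^sub>R u (a + m * t))"
    using h m a by (intro ess_bounded_on_scaleR ess_bounded_on_affine[of T u]) (auto simp: horizontal_def)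
  moreover have "negligible {t \<in> {0..S}. \<not> ((\<lambda>t. \<gamma> (a + m * t)) has_vector_derivative
      (m *\<^sub>R u (a + m * t), (1/2) *\<^sub>R wedge (fst (\<gamma> (a + m * t))) (m *\<^sub>R u (a + m * t)))) (at t within {0..S})}"
    (is "negligible ?B")
  proof -
    let ?A = "{t \<in> {0..T}. \<not> (\<gamma> has_vector_derivative (u t, (1/2) *\<^sub>R wedge (fst (\<gamma> t)) (u t))) (at t within {0..T})}"
    have "?B \<subseteq> (\<lambda>t. - a / m + 1 / m * t) ` ?A"
    proof
      fix t assume t: "t \<in> ?B"
      have "a + m * t \<in> ?A"
      proof (rule ccontr)
        assume "a + m * t \<notin> ?A"
        then have "(\<gamma> has_vector_derivative (u (a + m * t), (1/2) *\<^sub>R wedge (fst (\<gamma> (a + m * t))) (u (a + m * t))))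
            (at (a + m * t) within {0..T})"
          using in_T t by blast
        then have "(\<gamma> has_vector_derivative (u (a + m * t), (1/2) *\<^sub>R wedge (fst (\<gamma> (a + m * t))) (u (a + m * t))))
            (at (a + m * t) within (\<lambda>t. a + m * t) ` {0..S})"
          by (rule has_vector_derivative_within_subset) (use in_T in auto)
        moreover have "((\<lambda>t. a + m * t) has_vector_derivative m) (at t within {0..S})"
          by (auto intro!: derivative_eq_intros simp: has_vector_derivative_def)
        ultimately have "((\<gamma> \<circ> (\<lambda>t. a + m * t)) has_vector_derivative
            m *\<^sub>R (u (a + m * t), (1/2) *\<^sub>R wedge (fst (\<gamma> (a + m * t))) (u (a + m * t)))) (at t within {0..S})"
          by (intro vector_diff_chain_within)
        then have "((\<lambda>t. \<gamma> (a + m * t)) has_vector_derivative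
            (m *\<^sub>R u (a + m * t), (1/2) *\<^sub>R wedge (fst (\<gamma> (a + m * t))) (m *\<^sub>R u (a + m * t)))) (at t within {0..S})"
          unfolding comp_def scaleR_Pair wedge.scaleR_right scaleR_scaleR mult.commute[of m] .
        then show False using t by blast
      qed
      moreover have "t = - a / m + 1 / m * (a + m * t)" using m by (simp add: field_simps)
      ultimately show "t \<in> (\<lambda>t. - a / m + 1 / m * t) ` ?A" by blast
    qed
    moreover have "negligible ?A" using h by (simp add: horizontal_iff)
    ultimately show ?thesis using negligible_subset[OF negligible_affine_image] by blast
  qed
  moreover have "\<forall>t\<in>{0..S}. \<gamma> (a + m * t) \<in> Gk"
    using h in_T by (auto simp: horizontal_def)
  ultimately show ?thesis unfolding horizontal_iff by blast
qed

lemma horizontal_subinterval: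
  assumes h: "horizontal T \<gamma> u" and "0 \<le> a" "b \<le> T"
  shows "horizontal (b - a) (\<lambda>t. \<gamma> (a + t)) (\<lambda>t. u (a + t))"
  using horizontal_affine[OF h, of 1 a "b - a"] assms by simp

lemma horizontal_concat:
  assumes g: "horizontal S \<gamma> u" and d: "horizontal T \<delta> v" and ST: "0 \<le> S" "0 \<le> T" and eq: "\<gamma> S = \<delta> 0"
  shows "horizontal (S + T) (\<lambda>t. if t \<le> S then \<gamma> t else \<delta> (t - S)) (\<lambda>t. if t \<le> S then u t else v (t - S))"
    (is "horizontal _ ?\<eta> ?w")
proof -
  have "\<exists>C. C-lipschitz_on {0..S + T} ?\<eta>"
  proof -
    obtain C D where C: "C-lipschitz_on {0..S} \<gamma>" and D: "D-lipschitz_on {0..T} \<delta>"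
      using g d unfolding horizontal_def by blast
    have "D-lipschitz_on {S..S + T} (\<lambda>t. \<delta> (t - S))"
      using lipschitz_on_nonneg[OF D] lipschitz_onD[OF D, of "x - S" "y - S" for x y]
      by (intro lipschitz_onI) (fastforce simp: dist_real_def)+
    with C have "(max C D)-lipschitz_on {0..S + T} ?\<eta>"
      by (rule lipschitz_on_concat_max) (simp add: eq)
    then show ?thesis by blast
  qed
  moreover have "ess_bounded_on {0..S + T} ?w"
  proof -
    have u: "ess_bounded_on {0..S} u" and v: "ess_bounded_on {0..T} v"
      using g d by (auto simp: horizontal_def)
    obtain c where c: "negligible {t \<in> {0..S}. \<not> norm (u t) \<le> c}"
      using ess_bounded_on_bound[OF u] by blast
    obtain c' where c': "negligible {t \<in> {0..T}. \<not> norm (v t) \<le> c'}"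
      using ess_bounded_on_bound[OF v] by blast
    have "negligible ({t \<in> {0..S}. \<not> norm (u t) \<le> c} \<union> (\<lambda>t. S + 1 * t) ` {t \<in> {0..T}. \<not> norm (v t) \<le> c'})"
      by (intro negligible_Un c negligible_affine_image c')
    then have "negligible {t \<in> {0..S + T}. \<not> norm (?w t) \<le> max c c'}"
    proof (rule negligible_subset, clarify)
      fix t assume t: "t \<in> {0..S + T}" "\<not> norm (?w t) \<le> max c c'"
        "t \<notin> (\<lambda>t. S + 1 * t) ` {t \<in> {0..T}. \<not> norm (v t) \<le> c'}"
      show "t \<in> {0..S} \<and> \<not> norm (u t) \<le> c"
      proof (cases "t \<le> S")
        case False
        then have "t - S \<in> {t \<in> {0..T}. \<not> norm (v t) \<le> c'}" using t by auto
        then have "S + 1 * (t - S) \<in> (\<lambda>t. S + 1 * t) ` {t \<in> {0..T}. \<not> norm (v t) \<le> c'}" by (rule imageI)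
        then show ?thesis using t(3) by simp
      qed (use t in auto)
    qed
    moreover have "?w integrable_on {0..S + T}"
    proof (rule Henstock_Kurzweil_Integration.integrable_combine[of 0 S])
      show "?w integrable_on {0..S}"
        by (rule integrable_eq[OF ess_bounded_on_integrable[OF u]]) auto
      have "(\<lambda>t. v (t - S)) integrable_on {S..S + T}"
        using integrable_shift_real_ivl[OF ess_bounded_on_integrable[OF v], of "- S"] by (simp add: add.commute)
      then show "?w integrable_on {S..S + T}"
        by (rule integrable_spike[where S = "{S}"]) auto
    qed (use ST in auto)
    ultimately show ?thesis by (rule ess_bounded_onI[rotated])
  qed
  moreover have "negligible {t \<in> {0..S + T}. \<not> (?\<eta> has_vector_derivative
      (?w t, (1/2) *\<^sub>R wedge (fst (?\<eta> t)) (?w t))) (at t within {0..S + T})}" (is "negligible ?B")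
  proof -
    let ?A = "{t \<in> {0..S}. \<not> (\<gamma> has_vector_derivative (u t, (1/2) *\<^sub>R wedge (fst (\<gamma> t)) (u t))) (at t within {0..S})}"
    let ?A' = "{t \<in> {0..T}. \<not> (\<delta> has_vector_derivative (v t, (1/2) *\<^sub>R wedge (fst (\<delta> t)) (v t))) (at t within {0..T})}"
    \<comment> \<open>The junction \<open>S\<close> is added to the exceptional set, as the two arcs
      may have different one-sided velocities there.\<close>
    have "negligible (insert S (?A \<union> (\<lambda>t. S + 1 * t) ` ?A'))"
      unfolding negligible_insert using g d by (intro negligible_Un negligible_affine_image) (simp_all add: horizontal_iff)
    moreover have "?B \<subseteq> insert S (?A \<union> (\<lambda>t. S + 1 * t) ` ?A')"
    proof
      fix t assume t: "t \<in> ?B"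
      show "t \<in> insert S (?A \<union> (\<lambda>t. S + 1 * t) ` ?A')"
      proof (rule ccontr)
        assume n: "t \<notin> insert S (?A \<union> (\<lambda>t. S + 1 * t) ` ?A')"
        have "(?\<eta> has_vector_derivative (?w t, (1/2) *\<^sub>R wedge (fst (?\<eta> t)) (?w t))) (at t within {0..S + T})"
        proof (cases "t < S")
          case True
          then have "(\<gamma> has_vector_derivative (u t, (1/2) *\<^sub>R wedge (fst (\<gamma> t)) (u t))) (at t within {0..S})"
            using n t by auto
          moreover have "at t within {0..S} = at t within {0..S + T}"
            using True ST by (intro at_within_nhd[where S = "{..<S}"]) auto
          ultimately have "(\<gamma> has_vector_derivative (u t, (1/2) *\<^sub>R wedge (fst (\<gamma> t)) (u t))) (at t within {0..S + T})"
            by simp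
          then have "(?\<eta> has_vector_derivative (u t, (1/2) *\<^sub>R wedge (fst (\<gamma> t)) (u t))) (at t within {0..S + T})"
            by (rule has_vector_derivative_transform_within[where d = "S - t"])
              (use True t in \<open>auto simp: dist_real_def\<close>)
          then show ?thesis using True by simp
        next
          case False
          then have tS: "S < t" using n by auto
          have "t - S \<notin> ?A'"
          proof
            assume "t - S \<in> ?A'"
            then have "S + 1 * (t - S) \<in> (\<lambda>t. S + 1 * t) ` ?A'" by (rule imageI)
            then show False using n by simp
          qed
          then have "(\<delta> has_vector_derivative (v (t - S), (1/2) *\<^sub>R wedge (fst (\<delta> (t - S))) (v (t - S)))) (at (t - S) within {0..T})"
            using tS t by auto
          moreover have "(\<lambda>t. t - S) ` {S..S + T} = {0..T}"
            by (simp add: image_diff_atLeastAtMost)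
          moreover have "((\<lambda>t. t - S) has_vector_derivative 1) (at t within {S..S + T})"
            by (auto intro!: derivative_eq_intros)
          ultimately have "((\<delta> \<circ> (\<lambda>t. t - S)) has_vector_derivative
              1 *\<^sub>R (v (t - S), (1/2) *\<^sub>R wedge (fst (\<delta> (t - S))) (v (t - S)))) (at t within {S..S + T})"
            by (intro vector_diff_chain_within) auto
          moreover have "at t within {S..S + T} = at t within {0..S + T}"
            using tS ST by (intro at_within_nhd[where S = "{S<..}"]) auto
          ultimately have "((\<lambda>t. \<delta> (t - S)) has_vector_derivative
              (v (t - S), (1/2) *\<^sub>R wedge (fst (\<delta> (t - S))) (v (t - S)))) (at t within {0..S + T})"
            by (simp add: o_def)
          then have "(?\<eta> has_vector_derivative
              (v (t - S), (1/2) *\<^sub>R wedge (fst (\<delta> (t - S))) (v (t - S)))) (at t within {0..S + T})"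
            by (rule has_vector_derivative_transform_within[where d = "t - S"])
              (use tS t in \<open>auto simp: dist_real_def\<close>)
          then show ?thesis using tS by simp
        qed
        then show False using t by blast
      qed
    qed
    ultimately show ?thesis by (rule negligible_subset)
  qed
  moreover have "\<forall>t\<in>{0..S + T}. ?\<eta> t \<in> Gk"
    using g d ST by (auto simp: horizontal_def)
  ultimately show ?thesis unfolding horizontal_iff by blast
qed

text \<open>The group law for which the fields \<open>X i\<close> are left invariant.\<close>

definition gmul :: "'n::finite point \<Rightarrow> 'n point \<Rightarrow> 'n point" where
  "gmul p q = (fst p + fst q, snd p + snd q + (1/2) *\<^sub>R wedge (fst p) (fst q))"

lemma gmul_in_Gk: "p \<in> Gk \<Longrightarrow> q \<in> Gk \<Longrightarrow> gmul p q \<in> Gk"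
  by (auto simp: Gk_def gmul_def linear_transpose_simps transpose_wedge)

lemma horizontal_gmul:
  assumes h: "horizontal T \<gamma> u" and p: "p \<in> Gk"
  shows "horizontal T (\<lambda>t. gmul p (\<gamma> t)) u"
proof -
  \<comment> \<open>Left translation by \<open>p\<close> is affine with linear part
    \<open>A\<close>, so both the Lipschitz bound and the derivative pass through it.\<close>
  define A where "A q = (fst q, snd q + (1/2) *\<^sub>R wedge (fst p) (fst q))" for q :: "'a point"
  have gmul: "gmul p q = p + A q" for q by (simp add: gmul_def A_def prod_eq_iff)
  have A: "bounded_linear A"
    unfolding A_def by (intro bounded_linear_Pair bounded_linear_add bounded_linear_fst bounded_linear_snd
        bounded_linear_compose[OF bounded_linear_scaleR_right]
        bounded_linear_compose[OF wedge.bounded_linear_right])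
  obtain C where "C-lipschitz_on {0..T} \<gamma>"
    using h unfolding horizontal_def by blast
  moreover obtain D where "D-lipschitz_on (\<gamma> ` {0..T}) A"
    by (rule bounded_linear.lipschitz_boundE[OF A])
  ultimately have "(0 + D * C)-lipschitz_on {0..T} (\<lambda>t. p + A (\<gamma> t))"
    by (intro lipschitz_on_add lipschitz_on_constant lipschitz_on_compose2[where g = A])
  then have "\<exists>C. C-lipschitz_on {0..T} (\<lambda>t. gmul p (\<gamma> t))" unfolding gmul by blast
  moreover have "negligible {t \<in> {0..T}. \<not> ((\<lambda>t. gmul p (\<gamma> t)) has_vector_derivative
      (u t, (1/2) *\<^sub>R wedge (fst (gmul p (\<gamma> t))) (u t))) (at t within {0..T})}" (is "negligible ?B")
  proof -
    have "negligible {t \<in> {0..T}. \<not> (\<gamma> has_vector_derivative (u t, (1/2) *\<^sub>R wedge (fst (\<gamma> t)) (u t))) (at t within {0..T})}"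
      using h by (simp add: horizontal_iff)
    then show ?thesis
    proof (rule negligible_subset, clarify)
      fix t assume t: "t \<in> {0..T}"
        and n: "\<not> ((\<lambda>t. gmul p (\<gamma> t)) has_vector_derivative
          (u t, (1/2) *\<^sub>R wedge (fst (gmul p (\<gamma> t))) (u t))) (at t within {0..T})"
        and d: "(\<gamma> has_vector_derivative (u t, (1/2) *\<^sub>R wedge (fst (\<gamma> t)) (u t))) (at t within {0..T})"
      have "((\<lambda>t. p + A (\<gamma> t)) has_vector_derivative 0 + A (u t, (1/2) *\<^sub>R wedge (fst (\<gamma> t)) (u t))) (at t within {0..T})"
        by (intro has_vector_derivative_add has_vector_derivative_const bounded_linear.has_vector_derivative[OF A] d)
      then show False
        using n by (simp add: gmul) (simp add: A_def wedge.add_left scaleR_add_right add.commute)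
    qed
  qed
  moreover have "\<forall>t\<in>{0..T}. gmul p (\<gamma> t) \<in> Gk"
    using h p by (auto simp: horizontal_def intro: gmul_in_Gk)
  ultimately show ?thesis using h unfolding horizontal_iff by blast
qed

section \<open>The differential of the end-point map\<close>

lemma Linf_rel_rep: "Linf_rel (rep_Linf u) (rep_Linf u)"
  using Quotient3_rep_reflp[OF Quotient3_Linf] .

lemma ess_bounded_on_rep_Linf: "ess_bounded_on {0..1} (rep_Linf u)"
  using Linf_rel_rep[of u] by (simp add: Linf_rel_def)

text \<open>\<open>rep_Linf\<close> is an arbitrary choice within the class, so a control given by a
  formula is recovered from its class only almost everywhere.\<close>

lemma rep_abs_Linf:
  assumes "ess_bounded_on {0..1} f"
  shows "AE t in lebesgue_on {0..1}. rep_Linf (abs_Linf f) t = f t"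
proof -
  have "Linf_rel f f" using assms by (simp add: Linf_rel_def)
  then have "Linf_rel (rep_Linf (abs_Linf f)) f"
    by (metis Quotient3_Linf Quotient3_rep_abs)
  then show ?thesis by (simp add: Linf_rel_def)
qed

lemma rep_Linf_add: "AE t in lebesgue_on {0..1}. rep_Linf (u + v) t = rep_Linf u t + rep_Linf v t"
proof -
  have "u + v = abs_Linf (\<lambda>t. rep_Linf u t + rep_Linf v t)"
    using plus_Linf.abs_eq[OF Linf_rel_rep[of u] Linf_rel_rep[of v]]
    by (simp add: Quotient3_abs_rep[OF Quotient3_Linf])
  then show ?thesis
    using rep_abs_Linf[OF ess_bounded_on_add[OF ess_bounded_on_rep_Linf[of u] ess_bounded_on_rep_Linf[of v]]]
    by simp
qed

lemma rep_Linf_scaleR: "AE t in lebesgue_on {0..1}. rep_Linf (r *\<^sub>R u) t = r *\<^sub>R rep_Linf u t"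
proof -
  have "r *\<^sub>R u = abs_Linf (\<lambda>t. r *\<^sub>R rep_Linf u t)"
    using scaleR_Linf.abs_eq[OF Linf_rel_rep[of u], of r]
    by (simp add: Quotient3_abs_rep[OF Quotient3_Linf])
  then show ?thesis
    using rep_abs_Linf[OF ess_bounded_on_scaleR[OF ess_bounded_on_rep_Linf[of u]]] by simp
qed

lemma norm_rep_Linf_le: "AE t in lebesgue_on {0..1}. norm (rep_Linf u t) \<le> norm u"
proof -
  have "norm u = ess_norm (rep_Linf u)" by (simp add: norm_Linf_def)
  then show ?thesis using ess_norm_AE[OF ess_bounded_on_rep_Linf[of u]] by simp
qed

lemma AE_subset_Icc:
  assumes "AE t in lebesgue_on {a..b::real}. P t" "{c..d} \<subseteq> {a..b}"
  shows "AE t in lebesgue_on {c..d}. P t"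
  using assms unfolding AE_lebesgue_on_Icc_iff by (auto elim: negligible_subset)

lemma integral_cong_AE_Icc:
  fixes f g :: "real \<Rightarrow> 'a::real_normed_vector"
  assumes "AE t in lebesgue_on {a..b::real}. f t = g t"
  shows "integral {a..b} f = integral {a..b} g"
  using assms unfolding AE_lebesgue_on_Icc_iff by (rule integral_spike) auto

text \<open>\<open>hlift\<close> depends on the control through integrals alone, so it is constant
  on classes.\<close>

lemma hlift_cong_AE:
  assumes ae: "AE t in lebesgue_on {0..T}. u t = v t" and "t \<in> {0..T}"
  shows "hlift p u t = hlift p v t"
proof -
  have i: "integral {0..s} u = integral {0..s} v" if "s \<in> {0..T}" for s
    by (rule integral_cong_AE_Icc[OF AE_subset_Icc[OF ae]]) (use that in auto)
  have "AE s in lebesgue_on {0..t}. s \<in> {0..t}"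
    by (intro AE_I2) (simp add: space_restrict_space)
  with AE_subset_Icc[OF ae, of 0 t] assms(2)
  have "AE s in lebesgue_on {0..t}. wedge (fst p + integral {0..s} u) (u s) = wedge (fst p + integral {0..s} v) (v s)"
    by (auto elim!: eventually_elim2 simp: i)
  from integral_cong_AE_Icc[OF this] show ?thesis
    using i[OF assms(2)] by (simp add: hlift_def)
qed

lemma zero_in_Gk: "0 \<in> Gk"
  by (simp add: Gk_def zero_prod_def transpose_def vec_eq_iff)

lemma hlift_0 [simp]: "hlift p u 0 = p"
  by (simp add: hlift_def)

text \<open>Existence and uniqueness of the horizontal curve with a given control discharge the
  definite description in \<open>End\<close>.\<close>

lemma End_eq_hlift: "End u = hlift 0 (rep_Linf u) 1"
  unfolding End_def
proof (rule the_equality)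
  show "\<exists>\<gamma>. horizontal 1 \<gamma> (rep_Linf u) \<and> \<gamma> 0 = 0 \<and> \<gamma> 1 = hlift 0 (rep_Linf u) 1"
    using horizontal_hlift[OF ess_bounded_on_rep_Linf zero_in_Gk] by (intro exI[of _ "hlift 0 (rep_Linf u)"]) auto
next
  fix p assume "\<exists>\<gamma>. horizontal 1 \<gamma> (rep_Linf u) \<and> \<gamma> 0 = 0 \<and> \<gamma> 1 = p"
  then show "p = hlift 0 (rep_Linf u) 1"
    using horizontal_imp_hlift[of 1 _ "rep_Linf u" 1] by fastforce
qed

lemma End_abs_Linf:
  assumes "ess_bounded_on {0..1} f"
  shows "End (abs_Linf f) = hlift 0 f 1"
  unfolding End_eq_hlift by (rule hlift_cong_AE[OF rep_abs_Linf[OF assms]]) simp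

section \<open>The end-point map as a quadratic polynomial\<close>

definition primitive :: "(real^'n::finite) Linf \<Rightarrow> real \<Rightarrow> real^'n" where
  "primitive u t = integral {0..t} (rep_Linf u)"

text \<open>On the diagonal this is twice the Y-component of \<open>End\<close>. The form is not
  symmetric, so the differential contains both \<open>area u v\<close> and
  \<open>area v u\<close>.\<close>

definition area :: "(real^'n::finite) Linf \<Rightarrow> (real^'n) Linf \<Rightarrow> real^'n^'n" where
  "area u v = integral {0..1} (\<lambda>t. wedge (primitive u t) (rep_Linf v t))"

lemma integrable_rep_Linf: "t \<le> 1 \<Longrightarrow> rep_Linf u integrable_on {0..t}"
  using integrable_subinterval_real[OF ess_bounded_on_integrable[OF ess_bounded_on_rep_Linf], of 0 t] by simp

lemma primitive_add: "t \<le> 1 \<Longrightarrow> primitive (u + v) t = primitive u t + primitive v t"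
  unfolding primitive_def
  by (subst integral_cong_AE_Icc[OF AE_subset_Icc[OF rep_Linf_add]])
    (auto intro!: integral_add integrable_rep_Linf)

lemma primitive_scaleR: "t \<le> 1 \<Longrightarrow> primitive (r *\<^sub>R u) t = r *\<^sub>R primitive u t"
  unfolding primitive_def
  by (subst integral_cong_AE_Icc[OF AE_subset_Icc[OF rep_Linf_scaleR]]) auto

lemma norm_primitive_le:
  assumes "t \<in> {0..1}"
  shows "norm (primitive u t) \<le> norm u"
proof -
  have "norm (primitive u t) \<le> norm u * (t - 0)"
    unfolding primitive_def
    by (rule norm_integral_le_AE)
      (use assms AE_subset_Icc[OF norm_rep_Linf_le[of u], of 0 t] integrable_rep_Linf[of t u]
        in \<open>auto simp: AE_lebesgue_on_Icc_iff\<close>)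
  also have "\<dots> \<le> norm u * 1" using assms by (intro mult_left_mono) auto
  finally show ?thesis by simp
qed

lemma primitive_0 [simp]: "primitive u 0 = 0"
  by (simp add: primitive_def)

lemma lipschitz_primitive: "\<exists>C. C-lipschitz_on {0..1} (primitive u)"
  unfolding primitive_def by (rule lipschitz_on_integral[OF ess_bounded_on_rep_Linf])

lemma continuous_on_primitive: "continuous_on {0..1} (primitive u)"
  using lipschitz_primitive lipschitz_on_continuous_on by blast

lemma area_integrand_ess_bounded:
  "ess_bounded_on {0..1} (\<lambda>t. wedge (primitive u t) (rep_Linf v t))"
  by (rule ess_bounded_on_bilinear[OF bounded_bilinear_wedge
        continuous_imp_ess_bounded_on[OF continuous_on_primitive] ess_bounded_on_rep_Linf])

lemmas area_integrand_integrable = ess_bounded_on_integrable[OF area_integrand_ess_bounded]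

lemma AE_in_Icc: "AE t in lebesgue_on {a..b::real}. t \<in> {a..b}"
  by (intro AE_I2) (simp add: space_restrict_space)

text \<open>On the unit interval a primitive is bounded by the norm of its control, so the form is
  continuous for the norm of \<open>Linf\<close>. This turns the formal differential of the
  quadratic map into a Frechet derivative.\<close>

lemma bounded_bilinear_area: "bounded_bilinear area"
proof
  fix u u' v v' :: "(real^'n) Linf" and r :: real
  have "AE t in lebesgue_on {0..1}. wedge (primitive (u + u') t) (rep_Linf v t)
      = wedge (primitive u t) (rep_Linf v t) + wedge (primitive u' t) (rep_Linf v t)"
    using AE_in_Icc by eventually_elim (simp add: primitive_add wedge.add_left)
  from integral_cong_AE_Icc[OF this] show "area (u + u') v = area u v + area u' v"
    unfolding area_def by (simp add: integral_add area_integrand_integrable)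
  have "AE t in lebesgue_on {0..1}. wedge (primitive u t) (rep_Linf (v + v') t)
      = wedge (primitive u t) (rep_Linf v t) + wedge (primitive u t) (rep_Linf v' t)"
    using rep_Linf_add[of v v'] by eventually_elim (simp add: wedge.add_right)
  from integral_cong_AE_Icc[OF this] show "area u (v + v') = area u v + area u v'"
    unfolding area_def by (simp add: integral_add area_integrand_integrable)
  have "AE t in lebesgue_on {0..1}. wedge (primitive (r *\<^sub>R u) t) (rep_Linf v t)
      = r *\<^sub>R wedge (primitive u t) (rep_Linf v t)"
    using AE_in_Icc by eventually_elim (simp add: primitive_scaleR wedge.scaleR_left)
  from integral_cong_AE_Icc[OF this] show "area (r *\<^sub>R u) v = r *\<^sub>R area u v"
    unfolding area_def by simp
  have "AE t in lebesgue_on {0..1}. wedge (primitive u t) (rep_Linf (r *\<^sub>R v) t)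
      = r *\<^sub>R wedge (primitive u t) (rep_Linf v t)"
    using rep_Linf_scaleR[of r v] by eventually_elim (simp add: wedge.scaleR_right)
  from integral_cong_AE_Icc[OF this] show "area u (r *\<^sub>R v) = r *\<^sub>R area u v"
    unfolding area_def by simp
  obtain K where K: "0 \<le> K" "\<And>x y :: real^'n. norm (wedge x y) \<le> norm x * norm y * K"
    using wedge.nonneg_bounded by blast
  have "norm (area u v) \<le> norm u * norm v * K" for u v :: "(real^'n) Linf"
  proof -
    have "AE t in lebesgue_on {0..1}. norm (wedge (primitive u t) (rep_Linf v t)) \<le> norm u * norm v * K"
      using AE_in_Icc norm_rep_Linf_le[of v]
    proof eventually_elim
      case (elim t)
      have "norm (primitive u t) * norm (rep_Linf v t) * K \<le> norm u * norm v * K"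
        using elim K(1) norm_primitive_le[of t u] by (intro mult_mono) auto
      then show ?case using K(2) order_trans by blast
    qed
    then have "norm (area u v) \<le> norm u * norm v * K * (1 - 0)"
      unfolding area_def using K(1)
      by (intro norm_integral_le_AE area_integrand_integrable) (auto simp: AE_lebesgue_on_Icc_iff)
    then show ?thesis by simp
  qed
  then show "\<exists>K. \<forall>u v :: (real^'n) Linf. norm (area u v) \<le> norm u * norm v * K" by blast
qed

interpretation area: bounded_bilinear area
  by (rule bounded_bilinear_area)

lemma bounded_linear_primitive: "bounded_linear (\<lambda>u. primitive u 1)"
  by (rule bounded_linear_intro[where K = 1])
    (auto simp: primitive_add primitive_scaleR norm_primitive_le)

lemma End_eq_area: "End u = (primitive u 1, (1/2) *\<^sub>R area u u)"
  by (simp add: End_eq_hlift hlift_def primitive_def area_def)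

lemma End_has_derivative:
  "(End has_derivative (\<lambda>v. (primitive v 1, (1/2) *\<^sub>R (area u v + area v u)))) (at u)"
proof -
  have "((\<lambda>u. area u u) has_derivative (\<lambda>v. area u v + area v u)) (at u)"
    by (rule area.FDERIV[OF has_derivative_ident has_derivative_ident])
  then have "((\<lambda>u. (primitive u 1, (1/2) *\<^sub>R area u u)) has_derivative
      (\<lambda>v. (primitive v 1, (1/2) *\<^sub>R (area u v + area v u)))) (at u)"
    by (intro has_derivative_Pair has_derivative_scaleR_right bounded_linear_imp_has_derivative bounded_linear_primitive)
  then show ?thesis by (simp add: End_eq_area[abs_def])
qed

lemma frechet_derivative_End:
  "frechet_derivative End (at u) = (\<lambda>v. (primitive v 1, (1/2) *\<^sub>R (area u v + area v u)))"
  by (rule frechet_derivative_at[OF End_has_derivative, symmetric])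

section \<open>Critical controls\<close>

lemma bounded_bilinear_matrix_vector_mult:
  "bounded_bilinear ((*v) :: real^'n::finite^'m::finite \<Rightarrow> _)"
  unfolding bilinear_conv_bounded_bilinear[symmetric] bilinear_def
  by (auto simp: linear_iff matrix_vector_mult_def vec_eq_iff algebra_simps sum.distrib sum_distrib_left)

interpretation matrix_vector: bounded_bilinear "(*v) :: real^'n::finite^'m::finite \<Rightarrow> _"
  by (rule bounded_bilinear_matrix_vector_mult)

lemma inner_skew:
  fixes A :: "real^'n^'n"
  assumes "transpose A = - A"
  shows "x \<bullet> (A *v y) = - ((A *v x) \<bullet> y)"
proof -
  have "x \<bullet> (A *v y) = (transpose A *v x) \<bullet> y"
    by (simp add: dot_lmul_matrix)
  then show ?thesis by (simp add: assms inner_simps matrix_vector.minus_left)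
qed

lemma inner_skew_self:
  fixes A :: "real^'n^'n"
  assumes "transpose A = - A"
  shows "x \<bullet> (A *v x) = 0"
  using inner_skew[OF assms, of x x] by (simp add: inner_commute)

text \<open>The matrix inner product meets each pair of opposite entries twice, and both
  \<open>A\<close> and the wedge change sign under transposition; hence the factor 2.\<close>

lemma inner_wedge_skew:
  fixes A :: "real^'n^'n"
  assumes "transpose A = - A"
  shows "A \<bullet> wedge p q = 2 * (p \<bullet> (A *v q))"
proof -
  have A: "A $ i $ j = - A $ j $ i" for i j
  proof -
    have "transpose A $ j $ i = A $ i $ j" by (simp add: transpose_def)
    moreover have "transpose A $ j $ i = - A $ j $ i" unfolding assms by simp
    ultimately show ?thesis by (rule subst)
  qed
  have "A \<bullet> wedge p q = (\<Sum>i\<in>UNIV. \<Sum>j\<in>UNIV. A $ i $ j * (p $ i * q $ j)) - (\<Sum>i\<in>UNIV. \<Sum>j\<in>UNIV. A $ i $ j * (q $ i * p $ j))"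
    by (simp add: inner_vec_def wedge_def right_diff_distrib sum_subtractf)
  also have "(\<Sum>i\<in>UNIV. \<Sum>j\<in>UNIV. A $ i $ j * (q $ i * p $ j)) = (\<Sum>j\<in>UNIV. \<Sum>i\<in>UNIV. A $ i $ j * (q $ i * p $ j))"
    by (rule sum.swap)
  also have "\<dots> = - (\<Sum>i\<in>UNIV. \<Sum>j\<in>UNIV. A $ i $ j * (p $ i * q $ j))"
  proof -
    have "A $ i $ j * (q $ i * p $ j) = - (A $ j $ i * (p $ j * q $ i))" for i j
      using A[of i j] by simp
    then show ?thesis unfolding sum_negf[symmetric] by (intro sum.cong refl)
  qed
  also have "(\<Sum>i\<in>UNIV. \<Sum>j\<in>UNIV. A $ i $ j * (p $ i * q $ j)) = p \<bullet> (A *v q)"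
    by (simp add: inner_vec_def matrix_vector_mult_def sum_distrib_left mult_ac)
  finally show ?thesis by simp
qed

lemma wedge_mult_vec: "wedge a b *v q = (b \<bullet> q) *\<^sub>R a - (a \<bullet> q) *\<^sub>R b"
  by (simp add: vec_eq_iff matrix_vector_mult_def wedge_def inner_vec_def algebra_simps sum_subtractf sum_distrib_left)

lemma inner_wedge_wedge: "wedge a b \<bullet> wedge p q = 2 * ((a \<bullet> p) * (b \<bullet> q) - (b \<bullet> p) * (a \<bullet> q))"
  by (simp add: inner_wedge_skew transpose_wedge wedge_mult_vec inner_simps inner_commute mult_ac)

text \<open>The range of a skew matrix is orthogonal to its kernel, so two orthogonal nonzero
  vectors of the range are enough. For c = A z nonzero, A c is orthogonal to c, and it is nonzero
  because z . A c = - |c|^2.\<close>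

lemma skew_kernel_orthonormal_pair:
  fixes A :: "real^'n^'n"
  assumes A: "transpose A = - A" "A \<noteq> 0"
  obtains a b where "norm a = 1" "norm b = 1" "a \<bullet> b = 0" "\<And>v. A *v v = 0 \<Longrightarrow> a \<bullet> v = 0 \<and> b \<bullet> v = 0"
proof -
  obtain z where z: "A *v z \<noteq> 0"
    using A(2) by (metis matrix_eq matrix_vector_mult_0)
  define c where "c = A *v z"
  have "c \<noteq> 0" using z by (simp add: c_def)
  have "z \<bullet> (A *v c) = - (c \<bullet> c)" using inner_skew[OF A(1)] by (simp add: c_def)
  then have "A *v c \<noteq> 0" using \<open>c \<noteq> 0\<close> by auto
  define a b where "a = c /\<^sub>R norm c" and "b = (A *v c) /\<^sub>R norm (A *v c)"
  have "(A *v x) \<bullet> v = 0" if "A *v v = 0" for x v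
    using inner_skew[OF A(1), of x v] that by simp
  then have "a \<bullet> v = 0 \<and> b \<bullet> v = 0" if "A *v v = 0" for v
    using that by (simp add: a_def b_def c_def)
  moreover have "a \<bullet> b = 0" using inner_skew_self[OF A(1), of c] by (simp add: a_def b_def)
  moreover have "norm a = 1" "norm b = 1"
    using \<open>c \<noteq> 0\<close> \<open>A *v c \<noteq> 0\<close> by (simp_all add: a_def b_def)
  ultimately show ?thesis using that by blast
qed

lemma inner_integral:
  fixes f :: "real \<Rightarrow> 'a::euclidean_space"
  assumes "f integrable_on S"
  shows "a \<bullet> integral S f = integral S (\<lambda>t. a \<bullet> f t)"
  using integral_linear[OF assms bounded_linear_inner_right[of a]] by (simp add: o_def)

lemma inner_area:
  assumes "transpose A = - A"
  shows "A \<bullet> area u v = 2 * integral {0..1} (\<lambda>t. primitive u t \<bullet> (A *v rep_Linf v t))"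
  unfolding area_def by (subst inner_integral[OF area_integrand_integrable]) (simp add: inner_wedge_skew[OF assms])

lemma primitive_orthogonal:
  assumes ae: "AE t in lebesgue_on {0..1}. a \<bullet> rep_Linf u t = 0" and t: "t \<in> {0..1}"
  shows "a \<bullet> primitive u t = 0"
proof -
  have "AE s in lebesgue_on {0..t}. a \<bullet> rep_Linf u s = 0"
    using AE_subset_Icc[OF ae, of 0 t] t by simp
  from integral_cong_AE_Icc[OF this] show ?thesis
    using t by (simp add: primitive_def inner_integral integrable_rep_Linf)
qed

text \<open>The covector \<open>wedge a b\<close> annihilates the differential, since the velocity
  and its primitive are both orthogonal to \<open>a\<close> and \<open>b\<close>. Its pairing with
  itself is positive, so \<open>(0, wedge a b)\<close> is a direction of \<open>Gk\<close> which the
  differential misses.\<close>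

lemma AE_orthogonal_imp_critical:
  assumes n: "norm a = 1" "norm b = 1" "a \<bullet> b = 0"
    and ae: "AE t in lebesgue_on {0..1}. a \<bullet> rep_Linf u t = 0 \<and> b \<bullet> rep_Linf u t = 0"
  shows "critical u"
  unfolding critical_def
proof
  assume surj: "range (frechet_derivative End (at u)) = Gk"
  have "(0, wedge a b) \<in> Gk" by (simp add: Gk_def transpose_wedge)
  then obtain v where "wedge a b = (1/2) *\<^sub>R (area u v + area v u)"
    unfolding surj[symmetric] frechet_derivative_End by auto
  then have "wedge a b \<bullet> wedge a b = (1/2) * (wedge a b \<bullet> area u v + wedge a b \<bullet> area v u)"
    by (metis inner_add_right inner_scaleR_right)
  moreover have "wedge a b \<bullet> area u v = 0"
  proof -
    have p: "a \<bullet> primitive u t = 0 \<and> b \<bullet> primitive u t = 0" if "t \<in> {0..1}" for t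
      using ae that by (auto intro!: primitive_orthogonal elim: eventually_mono)
    have "AE t in lebesgue_on {0..1}. primitive u t \<bullet> (wedge a b *v rep_Linf v t) = 0"
      using AE_in_Icc by eventually_elim (simp add: wedge_mult_vec inner_simps p inner_commute[of "primitive u _"])
    from integral_cong_AE_Icc[OF this] show ?thesis by (simp add: inner_area transpose_wedge)
  qed
  moreover have "wedge a b \<bullet> area v u = 0"
  proof -
    have "AE t in lebesgue_on {0..1}. primitive v t \<bullet> (wedge a b *v rep_Linf u t) = 0"
      using ae by eventually_elim (simp add: wedge_mult_vec)
    from integral_cong_AE_Icc[OF this] show ?thesis by (simp add: inner_area transpose_wedge)
  qed
  moreover have "wedge a b \<bullet> wedge a b = 2"
    using n by (simp add: inner_wedge_wedge inner_commute norm_eq_1)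
  ultimately show False by simp
qed

lemma subspace_Gk: "subspace Gk"
  by (auto simp: subspace_def Gk_def linear_transpose_simps zero_prod_def) (simp add: transpose_def vec_eq_iff)

lemma lipschitz_on_bilinear:
  fixes f :: "real \<Rightarrow> 'a::euclidean_space" and g :: "real \<Rightarrow> 'b::euclidean_space"
    and h :: "'a \<Rightarrow> 'b \<Rightarrow> 'c::real_normed_vector"
  assumes h: "bounded_bilinear h" and f: "C-lipschitz_on {a..b} f" and g: "D-lipschitz_on {a..b} g"
  shows "\<exists>L. L-lipschitz_on {a..b} (\<lambda>t. h (f t) (g t))"
proof -
  interpret bounded_bilinear h by fact
  obtain K where K: "0 \<le> K" "\<And>x y. norm (h x y) \<le> norm x * norm y * K"
    using nonneg_bounded by blast
  have "bounded (f ` {a..b})" "bounded (g ` {a..b})"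
    using f g by (auto intro!: compact_imp_bounded compact_continuous_image elim: lipschitz_on_continuous_on)
  then obtain F G where F: "\<And>t. t \<in> {a..b} \<Longrightarrow> norm (f t) \<le> F" and G: "\<And>t. t \<in> {a..b} \<Longrightarrow> norm (g t) \<le> G"
    unfolding bounded_iff by blast
  have CD: "0 \<le> C" "0 \<le> D" using f g lipschitz_on_nonneg by blast+
  have "(\<bar>C * G * K\<bar> + \<bar>F * D * K\<bar>)-lipschitz_on {a..b} (\<lambda>t. h (f t) (g t))"
  proof (rule lipschitz_onI)
    fix s t assume st: "s \<in> {a..b}" "t \<in> {a..b}"
    have "norm (h (f s - f t) (g s)) \<le> norm (f s - f t) * norm (g s) * K" by (rule K)
    also have "\<dots> \<le> (C * dist s t) * G * K"
      using lipschitz_onD[OF f st] G[OF st(1)] K(1) CD order_trans[OF norm_ge_zero G[OF st(1)]]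
      by (intro mult_mono mult_nonneg_nonneg) (auto simp: dist_norm)
    also have "\<dots> \<le> \<bar>C * G * K\<bar> * dist s t"
      using mult_right_mono[OF abs_ge_self[of "C * G * K"], of "dist s t"] by (simp add: mult_ac)
    finally have 1: "norm (h (f s - f t) (g s)) \<le> \<bar>C * G * K\<bar> * dist s t" .
    have "norm (h (f t) (g s - g t)) \<le> norm (f t) * norm (g s - g t) * K" by (rule K)
    also have "\<dots> \<le> F * (D * dist s t) * K"
      using lipschitz_onD[OF g st] F[OF st(2)] K(1) CD order_trans[OF norm_ge_zero F[OF st(2)]]
      by (intro mult_mono mult_nonneg_nonneg) (auto simp: dist_norm)
    also have "\<dots> \<le> \<bar>F * D * K\<bar> * dist s t"
      using mult_right_mono[OF abs_ge_self[of "F * D * K"], of "dist s t"] by (simp add: mult_ac)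
    finally have 2: "norm (h (f t) (g s - g t)) \<le> \<bar>F * D * K\<bar> * dist s t" .
    have "h (f s) (g s) - h (f t) (g t) = h (f s - f t) (g s) + h (f t) (g s - g t)"
      by (simp add: diff_left diff_right)
    then have "dist (h (f s) (g s)) (h (f t) (g t)) \<le> norm (h (f s - f t) (g s)) + norm (h (f t) (g s - g t))"
      by (simp add: dist_norm norm_triangle_ineq)
    then show "dist (h (f s) (g s)) (h (f t) (g t)) \<le> (\<bar>C * G * K\<bar> + \<bar>F * D * K\<bar>) * dist s t"
      using 1 2 by (simp add: distrib_right)
  qed simp
  then show ?thesis by blast
qed

lemma primitive_has_derivative_AE:
  "AE t in lebesgue_on {0..1}. (primitive u has_vector_derivative rep_Linf u t) (at t within {0..1})"
  unfolding primitive_def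
  by (rule has_vector_derivative_integral_AE[OF ess_bounded_on_integrable[OF ess_bounded_on_rep_Linf]])

text \<open>Integration by parts turns the vanishing of the annihilator of the differential
  into a first-order condition tested against an arbitrary control.\<close>

lemma annihilator_test:
  assumes A: "transpose A = - A"
  shows "(1/2) * (A \<bullet> (area u v + area v u))
    = integral {0..1} (\<lambda>t. rep_Linf v t \<bullet> (A *v primitive u 1 - 2 *\<^sub>R (A *v primitive u t)))"
proof -
  let ?u = "rep_Linf u" and ?v = "rep_Linf v" and ?x = "primitive u" and ?y = "primitive v"
  have eA: "ess_bounded_on {0..1} (\<lambda>t. A *v f t)" if "ess_bounded_on {0..1} f" for f
    by (rule ess_bounded_on_bilinear[OF bounded_bilinear_matrix_vector_mult
          continuous_imp_ess_bounded_on[OF continuous_on_const] that])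
  have ii: "(\<lambda>t. f t \<bullet> g t) integrable_on {0..1}"
    if "ess_bounded_on {0..1} f" "ess_bounded_on {0..1} g" for f g :: "real \<Rightarrow> real^'n"
    by (rule ess_bounded_on_integrable[OF ess_bounded_on_bilinear[OF bounded_bilinear_inner that]])
  note eb = ess_bounded_on_rep_Linf continuous_imp_ess_bounded_on[OF continuous_on_primitive]
  \<comment> \<open>The derivative of y . A x is integrated; the boundary term at time 0 vanishes
    since primitives start at 0.\<close>
  have ip: "((\<lambda>t. ?v t \<bullet> (A *v ?x t) + ?y t \<bullet> (A *v ?u t)) has_integral ?y 1 \<bullet> (A *v ?x 1) - ?y 0 \<bullet> (A *v ?x 0)) {0..1}"
  proof -
    obtain C D where CD: "C-lipschitz_on {0..1} ?x" "D-lipschitz_on {0..1} ?y"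
      using lipschitz_primitive by blast
    have "bounded_bilinear (\<lambda>y x. y \<bullet> (A *v x))"
      by (rule bounded_bilinear.comp[OF bounded_bilinear_inner bounded_linear_ident matrix_vector.bounded_linear_right])
    from lipschitz_on_bilinear[OF this CD(2,1)]
    obtain L where L: "L-lipschitz_on {0..1} (\<lambda>t. ?y t \<bullet> (A *v ?x t))" by blast
    have "AE t in lebesgue_on {0..1}. ((\<lambda>t. ?y t \<bullet> (A *v ?x t)) has_vector_derivative
        (?v t \<bullet> (A *v ?x t) + ?y t \<bullet> (A *v ?u t))) (at t within {0..1})"
      using primitive_has_derivative_AE[of u] primitive_has_derivative_AE[of v]
    proof eventually_elim
      case (elim t)
      have "((\<lambda>t. A *v ?x t) has_vector_derivative A *v ?u t) (at t within {0..1})"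
        by (rule bounded_linear.has_vector_derivative[OF matrix_vector.bounded_linear_right elim(1)])
      from bounded_bilinear.has_vector_derivative[OF bounded_bilinear_inner elim(2) this]
      show ?case by (simp add: add.commute)
    qed
    then show ?thesis by (rule has_integral_derivative_lipschitz[OF _ L, rotated]) simp
  qed
  have "integral {0..1} (\<lambda>t. ?y t \<bullet> (A *v ?u t)) = ?y 1 \<bullet> (A *v ?x 1) - integral {0..1} (\<lambda>t. ?v t \<bullet> (A *v ?x t))"
    using integral_unique[OF ip] integral_add[of "\<lambda>t. ?v t \<bullet> (A *v ?x t)" "{0..1}" "\<lambda>t. ?y t \<bullet> (A *v ?u t)"]
    by (simp add: ii eA eb)
  moreover have "integral {0..1} (\<lambda>t. ?x t \<bullet> (A *v ?v t)) = - integral {0..1} (\<lambda>t. ?v t \<bullet> (A *v ?x t))"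
    by (simp add: inner_skew[OF A, of "?x _"] inner_commute)
  moreover have "integral {0..1} (\<lambda>t. ?v t \<bullet> (A *v ?x 1 - 2 *\<^sub>R (A *v ?x t)))
      = ?y 1 \<bullet> (A *v ?x 1) - 2 * integral {0..1} (\<lambda>t. ?v t \<bullet> (A *v ?x t))"
  proof -
    have "integral {0..1} (\<lambda>t. ?v t \<bullet> (A *v ?x 1)) = ?y 1 \<bullet> (A *v ?x 1)"
      using inner_integral[of ?v "{0..1}" "A *v ?x 1"] integrable_rep_Linf[of 1 v]
      by (simp add: primitive_def inner_commute)
    moreover have "integral {0..1} (\<lambda>t. ?v t \<bullet> (A *v ?x 1) - 2 * (?v t \<bullet> (A *v ?x t)))
        = integral {0..1} (\<lambda>t. ?v t \<bullet> (A *v ?x 1)) - integral {0..1} (\<lambda>t. 2 * (?v t \<bullet> (A *v ?x t)))"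
      by (intro integral_diff integrable_on_mult_right ii eA eb continuous_imp_ess_bounded_on continuous_on_const)
    ultimately show ?thesis by (simp add: inner_simps)
  qed
  ultimately show ?thesis by (simp add: inner_add_right inner_area[OF A])
qed

text \<open>A proper subspace of \<open>Gk\<close> has a nonzero normal vector inside
  \<open>Gk\<close>. Its matrix component is then skew, as \<open>annihilator_test\<close> and
  \<open>skew_kernel_orthonormal_pair\<close> demand.\<close>

theorem critical_imp_orthogonal:
  fixes u :: "(real^'n::finite) Linf"
  assumes "critical u"
  obtains a b where "norm a = 1" "norm b = 1" "a \<bullet> b = 0"
    "AE t in lebesgue_on {0..1}. a \<bullet> rep_Linf u t = 0 \<and> b \<bullet> rep_Linf u t = 0"
proof -
  define R where "R = range (frechet_derivative End (at u))"
  have lin: "linear (frechet_derivative End (at u))"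
    using End_has_derivative[of u] has_derivative_linear by (simp add: frechet_derivative_End)
  have "subspace R" unfolding R_def by (rule linear_subspace_image[OF lin subspace_UNIV])
  moreover have "R \<subseteq> Gk"
  proof -
    have "transpose (area u v) = - area u v" for u v :: "(real^'n) Linf"
      unfolding area_def by (rule transpose_integral_wedge[OF area_integrand_integrable])
    then show ?thesis by (auto simp: R_def frechet_derivative_End Gk_def linear_transpose_simps
          scaleR_right_diff_distrib scaleR_add_right)
  qed
  moreover have "R \<noteq> Gk" using assms by (simp add: critical_def R_def)
  ultimately have "span R \<subset> span Gk"
    by (simp add: span_eq_iff[THEN iffD2] subspace_Gk psubset_eq)
  from orthogonal_to_subspace_exists_gen[OF this] obtain w where
    w: "w \<noteq> 0" "w \<in> Gk" "\<And>y. y \<in> R \<Longrightarrow> orthogonal w y"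
    using subspace_Gk by (metis span_base span_eq_iff)
  obtain \<alpha> A where wA: "w = (\<alpha>, A)" by (cases w)
  have A: "transpose A = - A" using w(2) by (simp add: wA Gk_def)
  define \<beta> where "\<beta> = \<alpha> + A *v primitive u 1"
  have test: "integral {0..1} (\<lambda>t. rep_Linf v t \<bullet> (\<beta> - 2 *\<^sub>R (A *v primitive u t))) = 0" for v
  proof -
    have "frechet_derivative End (at u) v \<in> R" by (simp add: R_def)
    from w(3)[OF this] have "\<alpha> \<bullet> primitive v 1 + (1/2) * (A \<bullet> (area u v + area v u)) = 0"
      by (simp add: orthogonal_def wA frechet_derivative_End)
    then have *: "\<alpha> \<bullet> primitive v 1
        + integral {0..1} (\<lambda>t. rep_Linf v t \<bullet> (A *v primitive u 1 - 2 *\<^sub>R (A *v primitive u t))) = 0"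
      by (simp only: annihilator_test[OF A])
    have "\<alpha> \<bullet> primitive v 1 = integral {0..1} (\<lambda>t. rep_Linf v t \<bullet> \<alpha>)"
      using inner_integral[of "rep_Linf v" "{0..1}" \<alpha>] integrable_rep_Linf[of 1 v]
      by (simp add: primitive_def inner_commute)
    moreover have "integral {0..1} (\<lambda>t. rep_Linf v t \<bullet> \<alpha> + rep_Linf v t \<bullet> (A *v primitive u 1 - 2 *\<^sub>R (A *v primitive u t)))
        = integral {0..1} (\<lambda>t. rep_Linf v t \<bullet> \<alpha>)
          + integral {0..1} (\<lambda>t. rep_Linf v t \<bullet> (A *v primitive u 1 - 2 *\<^sub>R (A *v primitive u t)))"
      by (intro integral_add ess_bounded_on_integrable ess_bounded_on_bilinear[OF bounded_bilinear_inner]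
          ess_bounded_on_rep_Linf continuous_imp_ess_bounded_on continuous_on_const continuous_on_diff
          continuous_on_scaleR matrix_vector.continuous_on continuous_on_primitive)
    ultimately have "integral {0..1} (\<lambda>t. rep_Linf v t \<bullet> \<alpha> + rep_Linf v t \<bullet> (A *v primitive u 1 - 2 *\<^sub>R (A *v primitive u t))) = 0"
      using * by simp
    then show ?thesis by (simp add: \<beta>_def inner_simps add_diff_eq)
  qed
  \<comment> \<open>Every control integrates to zero against this function. Being continuous, it is
    itself a control, and using it as its own test makes the integral of |f|^2 vanish.\<close>
  define f where "f t = \<beta> - 2 *\<^sub>R (A *v primitive u t)" for t
  have fc: "continuous_on {0..1} f"
    unfolding f_def by (intro continuous_on_const continuous_on_diff
          continuous_on_scaleR matrix_vector.continuous_on continuous_on_primitive)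
  have "AE t in lebesgue_on {0..1}. rep_Linf (abs_Linf f) t \<bullet> f t = f t \<bullet> f t"
    using rep_abs_Linf[OF continuous_imp_ess_bounded_on[OF fc]] by eventually_elim simp
  from integral_cong_AE_Icc[OF this] test[of "abs_Linf f"]
  have "integral {0..1} (\<lambda>t. f t \<bullet> f t) = 0" by (simp add: f_def)
  moreover have "continuous_on {0..1} (\<lambda>t. f t \<bullet> f t)" by (intro continuous_on_inner fc)
  ultimately have "\<forall>t\<in>{0..1}. f t \<bullet> f t = 0"
    by (subst (asm) integral_eq_0_iff) auto
  then have f0: "f t = 0" if "t \<in> {0..1}" for t using that by simp
  \<comment> \<open>At time 0 the primitive vanishes, which isolates \<beta>. Then A kills the whole
    curve, in particular its endpoint, so \<alpha> = 0 and the nonzero covector must have A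
    nonzero.\<close>
  have "\<beta> = 0" using f0[of 0] by (simp add: f_def)
  then have Ax: "A *v primitive u t = 0" if "t \<in> {0..1}" for t
    using f0[OF that] by (simp add: f_def)
  then have "\<alpha> = 0" using \<open>\<beta> = 0\<close> by (simp add: \<beta>_def)
  then have "A \<noteq> 0" using w(1) by (simp add: wA zero_prod_def)
  from skew_kernel_orthonormal_pair[OF A this] obtain a b where
    ab: "norm a = 1" "norm b = 1" "a \<bullet> b = 0" "\<And>v. A *v v = 0 \<Longrightarrow> a \<bullet> v = 0 \<and> b \<bullet> v = 0" by blast
  have "AE t in lebesgue_on {0..1}. a \<bullet> rep_Linf u t = 0 \<and> b \<bullet> rep_Linf u t = 0"
    using primitive_has_derivative_AE[of u] AE_in_Icc
  proof eventually_elim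
    case (elim t)
    have "((\<lambda>t. A *v primitive u t) has_vector_derivative A *v rep_Linf u t) (at t within {0..1})"
      by (rule bounded_linear.has_vector_derivative[OF matrix_vector.bounded_linear_right elim(1)])
    moreover have "((\<lambda>t. A *v primitive u t) has_vector_derivative 0) (at t within {0..1})"
      by (rule has_vector_derivative_transform[OF elim(2) _ has_vector_derivative_const[of 0]]) (simp add: Ax)
    ultimately have "A *v rep_Linf u t = 0"
      by (intro vector_derivative_unique_within[of t "{0..1}"])
        (use elim(2) in \<open>auto intro: vector_derivative_unique_within simp: trivial_limit_within islimpt_Icc\<close>)
    then show ?case by (rule ab(4))
  qed
  with ab show ?thesis using that by blast
qed

section \<open>Reachable points and the abnormal set\<close>

text \<open>The set \<open>V\<close> confines the controls at every time and serves to produce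
  abnormal curves; the length \<open>l\<close> serves to beat the circle.\<close>

definition reachable :: "(real^'n::finite) set \<Rightarrow> 'n point \<Rightarrow> real \<Rightarrow> bool" where
  "reachable V p l \<longleftrightarrow> (\<exists>T \<gamma> u. 0 < T \<and> horizontal T \<gamma> u \<and> \<gamma> 0 = 0 \<and> \<gamma> T = p \<and>
     (\<forall>t. u t \<in> V) \<and> arc_length 0 T u = l)"

lemma norm_integrable:
  assumes "ess_bounded_on {a..b} u"
  shows "(\<lambda>t. norm (u t)) integrable_on {a..b}"
  using ess_bounded_on_absolutely_integrable[OF assms] by (simp add: absolutely_integrable_on_def)

lemma arc_length_concat:
  assumes u: "ess_bounded_on {0..S} u" and v: "ess_bounded_on {0..T} v" and "0 \<le> S" "0 \<le> T"
  shows "arc_length 0 (S + T) (\<lambda>t. if t \<le> S then u t else v (t - S)) = arc_length 0 S u + arc_length 0 T v"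
proof -
  have "((\<lambda>t. norm (u t)) has_integral arc_length 0 S u) {0..S}"
    unfolding arc_length_def using norm_integrable[OF u] by (rule integrable_integral)
  then have 1: "((\<lambda>t. norm (if t \<le> S then u t else v (t - S))) has_integral arc_length 0 S u) {0..S}"
    by (rule has_integral_eq[rotated]) simp
  have "((\<lambda>t. norm (v t)) has_integral arc_length 0 T v) {0..T}"
    unfolding arc_length_def using norm_integrable[OF v] by (rule integrable_integral)
  from has_integral_shift_real_ivl[OF this, of "- S"]
  have "((\<lambda>t. norm (v (t - S))) has_integral arc_length 0 T v) {S..S + T}"
    by (simp add: add.commute)
  then have 2: "((\<lambda>t. norm (if t \<le> S then u t else v (t - S))) has_integral arc_length 0 T v) {S..S + T}"
    by (rule has_integral_spike[where S = "{S}", rotated 2]) auto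
  from has_integral_combine[OF _ _ 1 2] assms(3,4) show ?thesis
    unfolding arc_length_def by (intro integral_unique) simp
qed

lemma ess_bounded_on_const: "ess_bounded_on {a..b} (\<lambda>_. c)"
  by (rule continuous_imp_ess_bounded_on[OF continuous_on_const])

lemma arc_length_const [simp]: "0 \<le> T \<Longrightarrow> arc_length 0 T (\<lambda>_. v) = T * norm v"
  by (simp add: arc_length_def)

lemma hlift_const:
  assumes "0 \<le> t"
  shows "hlift 0 (\<lambda>_. v) t = (t *\<^sub>R v, 0)"
proof -
  have "integral {0..t} (\<lambda>s. wedge (integral {0..s} (\<lambda>_. v)) v) = integral {0..t} (\<lambda>s. 0)"
    by (rule integral_cong_AE_Icc) (use AE_in_Icc in eventually_elim, simp add: wedge.scaleR_left)
  then show ?thesis using assms by (simp add: hlift_def)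
qed

lemma gmul_zero_right [simp]: "gmul p 0 = p"
  by (simp add: gmul_def wedge.zero_right)

lemma reachable_0:
  assumes "0 \<in> V"
  shows "reachable V 0 0"
  unfolding reachable_def
proof (intro exI conjI)
  show "horizontal 1 (hlift 0 (\<lambda>_. 0)) (\<lambda>_. 0)"
    by (rule horizontal_hlift[OF ess_bounded_on_const zero_in_Gk])
qed (use assms hlift_const[of 1 0] in \<open>auto simp: zero_prod_def\<close>)

lemma reachable_segment:
  assumes r: "reachable V p l" and v: "v \<in> V"
  shows "reachable V (gmul p (v, 0)) (l + norm v)"
proof -
  obtain T \<gamma> u where T: "0 < T" and h: "horizontal T \<gamma> u" and g: "\<gamma> 0 = 0" "\<gamma> T = p"
    and u: "\<forall>t. u t \<in> V" "arc_length 0 T u = l"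
    using r unfolding reachable_def by blast
  have "p \<in> Gk" using h g T by (auto simp: horizontal_def)
  let ?\<delta> = "\<lambda>t. gmul p (hlift 0 (\<lambda>_. v) t)"
  have d: "horizontal 1 ?\<delta> (\<lambda>_. v)"
    by (intro horizontal_gmul horizontal_hlift ess_bounded_on_const zero_in_Gk \<open>p \<in> Gk\<close>)
  have "horizontal (T + 1) (\<lambda>t. if t \<le> T then \<gamma> t else ?\<delta> (t - T)) (\<lambda>t. if t \<le> T then u t else v)"
    using horizontal_concat[OF h d] T g by simp
  moreover have "arc_length 0 (T + 1) (\<lambda>t. if t \<le> T then u t else v) = l + norm v"
    using arc_length_concat[of T u 1 "\<lambda>_. v"] h T u by (simp add: horizontal_def ess_bounded_on_const)
  ultimately show ?thesis
    unfolding reachable_def using T g u v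
    by (intro exI[of _ "T + 1"] exI[of _ "\<lambda>t. if t \<le> T then \<gamma> t else ?\<delta> (t - T)"]
        exI[of _ "\<lambda>t. if t \<le> T then u t else v"]) (auto simp: hlift_const)
qed

text \<open>The commutator of the segments \<open>v\<close> and \<open>w\<close> is the central element \<open>v \<and> w\<close>.\<close>

lemma reachable_wedge:
  assumes r: "reachable V p l" and V: "v \<in> V" "w \<in> V" "- v \<in> V" "- w \<in> V"
  shows "reachable V (fst p, snd p + wedge v w) (l + 2 * norm v + 2 * norm w)"
proof -
  have "gmul (gmul (gmul (gmul p (v, 0)) (w, 0)) (- v, 0)) (- w, 0) = (fst p, snd p + wedge v w)"
    by (auto simp: gmul_def vec_eq_iff wedge_def field_simps)
  moreover have "reachable V (gmul (gmul (gmul (gmul p (v, 0)) (w, 0)) (- v, 0)) (- w, 0))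
      (l + norm v + norm w + norm (- v) + norm (- w))"
    by (intro reachable_segment r V)
  ultimately show ?thesis by (simp add: algebra_simps)
qed

lemma reachable_sum_wedge:
  assumes V: "subspace V" and "finite F" and vw: "\<And>i. i \<in> F \<Longrightarrow> v i \<in> V \<and> w i \<in> V"
    and r: "\<exists>l. reachable V p l"
  shows "\<exists>l. reachable V (fst p, snd p + (\<Sum>i\<in>F. wedge (v i) (w i))) l"
  using \<open>finite F\<close> vw
proof (induction F)
  case empty
  then show ?case using r by simp
next
  case (insert i F)
  then obtain l where "reachable V (fst p, snd p + (\<Sum>i\<in>F. wedge (v i) (w i))) l" by auto
  moreover have "v i \<in> V" "w i \<in> V" using insert by auto
  ultimately have "reachable V (fst p, snd p + (\<Sum>i\<in>F. wedge (v i) (w i)) + wedge (v i) (w i))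
      (l + 2 * norm (v i) + 2 * norm (w i))"
    using reachable_wedge[of V "(fst p, snd p + (\<Sum>i\<in>F. wedge (v i) (w i)))" l "v i" "w i"] V
    by (simp add: subspace_neg)
  then show ?case using insert by (auto simp: add_ac)
qed

text \<open>The sum runs over ordered pairs, so each unordered pair is met twice; the factor 1/2
  compensates.\<close>

lemma skew_eq_sum_wedge:
  fixes Y :: "real^'n::finite^'n"
  assumes "transpose Y = - Y"
  shows "Y = (\<Sum>(i, j)\<in>UNIV. wedge (((1/2) * Y $ i $ j) *\<^sub>R axis i 1) (axis j 1))"
proof -
  have "(\<Sum>(i, j)\<in>UNIV. wedge (((1/2) * Y $ i $ j) *\<^sub>R axis i 1) (axis j 1)) $ k $ l = Y $ k $ l" for k l
  proof -
    have "Y $ k $ l = transpose Y $ l $ k" by (simp add: transpose_def)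
    then have skew: "Y $ l $ k = - Y $ k $ l" unfolding assms by simp
    have delta: "(\<Sum>i\<in>UNIV. \<Sum>j\<in>UNIV. if i = k then if j = l then g i j else 0 else 0) = g k l"
      for g :: "'n \<Rightarrow> 'n \<Rightarrow> real" and k l
    proof -
      have "(\<Sum>j\<in>UNIV. if i = k then if j = l then g i j else 0 else 0) = (if i = k then g i l else 0)" for i
        by (cases "i = k") simp_all
      then show ?thesis by simp
    qed
    have "(\<Sum>(i, j)\<in>UNIV. wedge (((1/2) * Y $ i $ j) *\<^sub>R axis i 1) (axis j 1)) $ k $ l
        = (\<Sum>i\<in>UNIV. \<Sum>j\<in>UNIV. (wedge (((1/2) * Y $ i $ j) *\<^sub>R axis i 1) (axis j 1)) $ k $ l)"
      by (simp add: sum_component case_prod_unfold sum.cartesian_product UNIV_Times_UNIV[symmetric] del: UNIV_Times_UNIV)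
    also have "\<dots> = (\<Sum>i\<in>UNIV. \<Sum>j\<in>UNIV. (if i = k then if j = l then (1/2) * Y $ i $ j else 0 else 0)
        - (if i = l then if j = k then (1/2) * Y $ i $ j else 0 else 0))"
      by (intro sum.cong refl) (auto simp: wedge_def axis_def)
    also have "\<dots> = (1/2) * Y $ k $ l - (1/2) * Y $ l $ k"
      by (simp add: sum_subtractf delta)
    finally show ?thesis by (simp add: skew)
  qed
  then show ?thesis by (simp add: vec_eq_iff)
qed

definition Abn_set :: "'n::finite point set" where
  "Abn_set = {(x, Y) \<in> Gk. \<exists>a b. norm a = 1 \<and> norm b = 1 \<and> a \<bullet> b = 0 \<and>
     a \<bullet> x = 0 \<and> b \<bullet> x = 0 \<and> Y *v a = 0 \<and> Y *v b = 0}"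

text \<open>Let Q be the orthogonal projection that removes the components along \<open>a\<close>
  and \<open>b\<close>. As Y is skew and kills both vectors, Q Y Q = Y. Applying Q to the coordinate
  wedges that add up to Y thus keeps their sum and moves all segments into the allowed subspace,
  where commutators build Y on top of the straight segment to \<open>x\<close>.\<close>

lemma reachable_orthogonal:
  fixes a b x :: "real^'n::finite"
  assumes ab: "norm a = 1" "norm b = 1" "a \<bullet> b = 0" and x: "a \<bullet> x = 0" "b \<bullet> x = 0"
    and Y: "transpose Y = - Y" "Y *v a = 0" "Y *v b = 0"
  shows "\<exists>l. reachable {v. a \<bullet> v = 0 \<and> b \<bullet> v = 0} (x, Y) l"
proof -
  let ?V = "{v. a \<bullet> v = 0 \<and> b \<bullet> v = 0}"
  have V: "subspace ?V" by (auto simp: subspace_def inner_simps)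
  define Q where "Q v = v - (a \<bullet> v) *\<^sub>R a - (b \<bullet> v) *\<^sub>R b" for v :: "real^'n"
  have lin: "linear Q" by (rule linearI) (auto simp: Q_def inner_simps algebra_simps)
  have QV: "Q v \<in> ?V" for v
    using ab by (simp add: Q_def inner_simps norm_eq_1 inner_commute)
  have adj: "Q v \<bullet> w = v \<bullet> Q w" for v w by (simp add: Q_def inner_simps inner_commute)
  let ?v = "\<lambda>(i, j). Q (((1/2) * Y $ i $ j) *\<^sub>R axis i 1)" and ?w = "\<lambda>(i::'n, j). Q (axis j 1)"
  have "(\<Sum>ij\<in>UNIV. wedge (?v ij) (?w ij)) = Y"
  proof (subst matrix_eq, rule allI)
    fix z
    have wQ: "wedge (Q v) (Q w) *v z = Q (wedge v w *v Q z)" for v w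
      by (simp add: wedge_mult_vec adj linear_diff[OF lin] linear_scale[OF lin])
    have mult_sum: "(\<Sum>i\<in>S. f i) *v y = (\<Sum>i\<in>S. f i *v y)" for f :: "'n \<times> 'n \<Rightarrow> real^'n^'n" and S y
      by (rule matrix_vector.sum_left)
    have "(\<Sum>ij\<in>UNIV. wedge (?v ij) (?w ij)) *v z
        = (\<Sum>(i, j)\<in>UNIV. Q (wedge (((1/2) * Y $ i $ j) *\<^sub>R axis i 1) (axis j 1) *v Q z))"
      unfolding mult_sum by (intro sum.cong refl) (auto simp only: wQ case_prod_conv split: prod.split)
    also have "\<dots> = Q (Y *v Q z)"
      using arg_cong[OF skew_eq_sum_wedge[OF Y(1)], of "\<lambda>A. A *v Q z"]
      by (simp add: mult_sum linear_sum[OF lin] case_prod_unfold)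
    also have "Y *v Q z = Y *v z"
      using Y(2,3) by (simp add: Q_def matrix_vector.diff_right matrix_vector.scaleR_right)
    also have "Q (Y *v z) = Y *v z"
      using inner_skew[OF Y(1), of a z] inner_skew[OF Y(1), of b z] Y(2,3) by (simp add: Q_def)
    finally show "(\<Sum>ij\<in>UNIV. wedge (?v ij) (?w ij)) *v z = Y *v z" .
  qed
  moreover have "\<exists>l. reachable ?V (x, 0) l"
  proof -
    have "reachable ?V (gmul 0 (x, 0)) (0 + norm x)"
      by (intro reachable_segment reachable_0) (use x in auto)
    then show ?thesis by (auto simp: gmul_def wedge.zero_left)
  qed
  moreover have "?v ij \<in> ?V \<and> ?w ij \<in> ?V" for ij
    using QV by (auto split: prod.split)
  ultimately show ?thesis
    using reachable_sum_wedge[OF V, of UNIV ?v ?w "(x, 0)"] by simp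
qed

lemma critical_abs_Linf:
  assumes "norm a = 1" "norm b = 1" "a \<bullet> b = 0" and f: "ess_bounded_on {0..1} f"
    and "\<And>t. t \<in> {0..1} \<Longrightarrow> a \<bullet> f t = 0 \<and> b \<bullet> f t = 0"
  shows "critical (abs_Linf f)"
proof (rule AE_orthogonal_imp_critical[OF assms(1-3)])
  show "AE t in lebesgue_on {0..1}. a \<bullet> rep_Linf (abs_Linf f) t = 0 \<and> b \<bullet> rep_Linf (abs_Linf f) t = 0"
    using rep_abs_Linf[OF f] AE_in_Icc by eventually_elim (use assms(5) in auto)
qed

theorem Abn0_eq: "(Abn0 :: 'n::finite point set) = Abn_set"
proof (intro equalityI subsetI)
  fix p :: "'n point" assume "p \<in> Abn0"
  then obtain u where u: "critical u" "p = End u" unfolding Abn0_def by blast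
  obtain a b where ab: "norm a = 1" "norm b = 1" "a \<bullet> b = 0"
    and ae: "AE t in lebesgue_on {0..1}. a \<bullet> rep_Linf u t = 0 \<and> b \<bullet> rep_Linf u t = 0"
    using critical_imp_orthogonal[OF u(1)] by blast
  \<comment> \<open>If \<open>c\<close> is orthogonal to the velocity a.e., it is orthogonal to the
    curve at every time. Almost every matrix \<open>wedge x u\<close> along the curve then kills
    \<open>c\<close>, and so does their integral.\<close>
  have Yc: "area u u *v c = 0" "c \<bullet> primitive u 1 = 0"
    if c: "AE t in lebesgue_on {0..1}. c \<bullet> rep_Linf u t = 0" for c
  proof -
    have "AE t in lebesgue_on {0..1}. wedge (primitive u t) (rep_Linf u t) *v c = 0"
      using c AE_in_Icc by eventually_elim
        (simp add: wedge_mult_vec inner_commute[of _ c] primitive_orthogonal[OF c])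
    from integral_cong_AE_Icc[OF this]
    show "area u u *v c = 0"
      using integral_linear[OF area_integrand_integrable[of u u] matrix_vector.bounded_linear_left[of c]]
      by (simp add: area_def o_def)
    show "c \<bullet> primitive u 1 = 0" by (rule primitive_orthogonal[OF c]) simp
  qed
  have "p \<in> Gk"
    using horizontal_hlift[OF ess_bounded_on_rep_Linf zero_in_Gk, of u] u
    by (auto simp: End_eq_hlift horizontal_def)
  moreover have "AE t in lebesgue_on {0..1}. a \<bullet> rep_Linf u t = 0" "AE t in lebesgue_on {0..1}. b \<bullet> rep_Linf u t = 0"
    using ae by (auto elim: eventually_mono)
  ultimately have "p \<in> Gk" and "a \<bullet> primitive u 1 = 0" "b \<bullet> primitive u 1 = 0"
    "((1/2) *\<^sub>R area u u) *v a = 0" "((1/2) *\<^sub>R area u u) *v b = 0"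
    using Yc by (simp_all add: matrix_vector.scaleR_left)
  then show "p \<in> Abn_set"
    unfolding Abn_set_def u(2) End_eq_area using ab by blast
next
  fix p :: "'n point" assume p: "p \<in> Abn_set"
  obtain x Y where xY: "p = (x, Y)" by (cases p)
  obtain a b where ab: "norm a = 1" "norm b = 1" "a \<bullet> b = 0" "a \<bullet> x = 0" "b \<bullet> x = 0"
    "transpose Y = - Y" "Y *v a = 0" "Y *v b = 0"
    using p unfolding Abn_set_def Gk_def xY by blast
  obtain T \<gamma> u where T: "0 < T" and h: "horizontal T \<gamma> u" and g: "\<gamma> 0 = 0" "\<gamma> T = p"
    and u: "\<And>t. a \<bullet> u t = 0 \<and> b \<bullet> u t = 0"
    using reachable_orthogonal[OF ab] unfolding reachable_def xY by blast
  \<comment> \<open>The affine change of time to \<open>[0,1]\<close> keeps the endpoint and the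
    orthogonality of the control.\<close>
  let ?f = "\<lambda>t. T *\<^sub>R u (0 + T * t)"
  have h1: "horizontal 1 (\<lambda>t. \<gamma> (0 + T * t)) ?f"
    by (rule horizontal_affine[OF h T]) auto
  then have f: "ess_bounded_on {0..1} ?f" by (simp add: horizontal_def)
  have "End (abs_Linf ?f) = p"
    using horizontal_imp_hlift[OF h1, of 1] g End_abs_Linf[OF f] by simp
  moreover have "critical (abs_Linf ?f)"
    by (rule critical_abs_Linf[OF ab(1-3) f]) (simp add: u)
  ultimately show "p \<in> Abn0" unfolding Abn0_def by blast
qed

section \<open>The closure of \<open>Ck\<close>\<close>

lemma Abn_setI:
  assumes "transpose Y = - Y" "norm a = 1" "norm b = 1" "a \<bullet> b = 0" "a \<bullet> x = 0" "b \<bullet> x = 0"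
    "Y *v a = 0" "Y *v b = 0"
  shows "(x, Y) \<in> Abn_set"
  unfolding Abn_set_def Gk_def using assms by blast

lemma orthonormal_reflection:
  fixes U :: "(real^'n::finite) set"
  assumes U: "subspace U"
  obtains f where "linear f" "\<And>u. u \<in> U \<Longrightarrow> f u = - u" "\<And>v. (\<And>u. u \<in> U \<Longrightarrow> u \<bullet> v = 0) \<Longrightarrow> f v = v"
proof -
  obtain B where B: "B \<subseteq> U" "pairwise orthogonal B" "\<And>x. x \<in> B \<Longrightarrow> norm x = 1"
    "independent B" "span B = U"
    using orthonormal_basis_subspace[OF U] by metis
  have "finite B" using B(4) independent_imp_finite by blast
  define f where "f v = v - 2 *\<^sub>R (\<Sum>b\<in>B. (b \<bullet> v) *\<^sub>R b)" for v
  show ?thesis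
  proof
    show "linear f"
      by (rule linearI) (simp_all add: f_def inner_simps sum.distrib algebra_simps scaleR_sum_right)
    show "f u = - u" if "u \<in> U" for u
    proof -
      have "(\<Sum>b\<in>B. (b \<bullet> u) *\<^sub>R b) = u"
        using orthonormal_basis_expand[OF B(2,3) _ \<open>finite B\<close>, of u] that B(5) by (simp add: inner_commute)
      then show ?thesis by (simp add: f_def scaleR_2)
    qed
    show "f v = v" if "\<And>u. u \<in> U \<Longrightarrow> u \<bullet> v = 0" for v
    proof -
      have "(\<Sum>b\<in>B. (b \<bullet> v) *\<^sub>R b) = 0" using that B(1) by (intro sum.neutral) auto
      then show ?thesis by (simp add: f_def)
    qed
  qed
qed

text \<open>The reflection is -1 on \<open>U\<close> and +1 on its orthogonal complement. Skewness
  makes the complement invariant under Y as well, so the reflection commutes with Y. It fixes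
  \<open>x\<close> and the kernel, which lie in the complement, and \<open>u0\<close> shows that it
  is not the identity.\<close>

lemma in_Ck_if_invariant_subspace:
  fixes Y :: "real^'n::finite^'n"
  assumes Y: "transpose Y = - Y" "Y \<noteq> 0" and U: "subspace U" "u0 \<in> U" "u0 \<noteq> 0"
    and inv: "\<And>u. u \<in> U \<Longrightarrow> Y *v u \<in> U" and x: "\<And>u. u \<in> U \<Longrightarrow> u \<bullet> x = 0"
    and ker: "\<And>u v. u \<in> U \<Longrightarrow> Y *v v = 0 \<Longrightarrow> u \<bullet> v = 0"
  shows "(x, Y) \<in> Ck"
proof -
  obtain f where f: "linear f" "\<And>u. u \<in> U \<Longrightarrow> f u = - u"
    "\<And>v. (\<And>u. u \<in> U \<Longrightarrow> u \<bullet> v = 0) \<Longrightarrow> f v = v"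
    using orthonormal_reflection[OF U(1)] by metis
  define M where "M = matrix f"
  have M: "M *v v = f v" for v using f(1) by (simp add: M_def matrix_works)
  have decomp: "\<exists>y z. v = y + z \<and> y \<in> U \<and> (\<forall>u\<in>U. u \<bullet> z = 0)" for v
  proof -
    obtain y z where "y \<in> span U" "\<And>w. w \<in> span U \<Longrightarrow> orthogonal z w" "v = y + z"
      using orthogonal_subspace_decomp_exists[of U v] by blast
    then show ?thesis using U(1)
      by (intro exI[of _ y] exI[of _ z]) (auto simp: orthogonal_def inner_commute span_eq_iff[THEN iffD2])
  qed
  have fd: "f (y + z) = z - y" if "y \<in> U" "\<forall>u\<in>U. u \<bullet> z = 0" for y z
    using that f by (simp add: linear_add)
  have "norm (f v) = norm v" for v
  proof -
    obtain y z where v: "v = y + z" "y \<in> U" "\<forall>u\<in>U. u \<bullet> z = 0" using decomp by blast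
    then have "y \<bullet> z = 0" by blast
    then have "(z - y) \<bullet> (z - y) = (y + z) \<bullet> (y + z)"
      by (simp add: inner_simps inner_commute)
    then show ?thesis using fd[OF v(2,3)] v(1) by (simp add: norm_eq_sqrt_inner)
  qed
  then have "orthogonal_transformation f"
    using f(1) by (simp add: orthogonal_transformation)
  then have MO: "orthogonal_matrix M"
    by (simp add: M_def orthogonal_transformation_matrix)
  have "M \<noteq> mat 1"
  proof
    assume "M = mat 1"
    then have "f u0 = u0" using M[of u0] by simp
    then have "u0 + u0 = 0" using f(2)[OF U(2)] by (metis add.right_inverse)
    then show False using U(3) by (simp flip: scaleR_2)
  qed
  moreover have "M *v x = x" using M f(3) x by simp
  moreover have "M ** Y = Y ** M"
  proof (subst matrix_eq, rule allI)
    fix v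
    obtain y z where v: "v = y + z" "y \<in> U" "\<forall>u\<in>U. u \<bullet> z = 0" using decomp by blast
    have "u \<bullet> (Y *v z) = 0" if "u \<in> U" for u
      using inner_skew[OF Y(1), of u z] inv[OF that] v(3) by simp
    then have "f (Y *v y + Y *v z) = Y *v z - Y *v y" using fd inv v by blast
    then have "M *v (Y *v v) = Y *v z - Y *v y"
      by (simp only: M v(1) matrix_vector.add_right[of Y])
    moreover have "Y *v (M *v v) = Y *v z - Y *v y"
      by (simp only: M v(1) fd[OF v(2,3)] matrix_vector.diff_right)
    ultimately show "(M ** Y) *v v = (Y ** M) *v v" by (simp add: matrix_vector_mul_assoc)
  qed
  then have "M ** Y ** transpose M = Y ** (M ** transpose M)" by (simp add: matrix_mul_assoc)
  then have "M ** Y ** transpose M = Y" using MO by (simp add: orthogonal_matrix_def)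
  moreover have "\<forall>v. Y *v v = 0 \<longrightarrow> M *v v = v" using M f(3) ker by simp
  ultimately show ?thesis using Y MO by (auto simp: Ck_def Gk_def)
qed

section \<open>The orbit condition as a closed relaxation of \<open>Ck\<close>\<close>

definition krylov :: "real^'n::finite^'n \<Rightarrow> real^'n \<Rightarrow> nat \<Rightarrow> real^'n" where
  "krylov Y x j = (((*v) Y) ^^ j) x"

lemma krylov_simps [simp]: "krylov Y x 0 = x" "krylov Y x (Suc j) = Y *v krylov Y x j"
  by (simp_all add: krylov_def)

text \<open>The conditions Y nonzero and M different from the identity in \<open>Ck\<close> may be
  lost in a limit; unit vectors survive it. Listing all powers makes the orthogonal complement of
  the orbit invariant under Y at once.\<close>

definition krylov_set :: "'n::finite point set" where
  "krylov_set = {(x, Y) \<in> Gk. \<exists>a b. norm a = 1 \<and> norm b = 1 \<and> a \<bullet> b = 0 \<and>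
     (\<forall>j. a \<bullet> krylov Y x j = 0 \<and> b \<bullet> krylov Y x j = 0)}"

text \<open>The fixed space of M contains the orbit and is proper, so it has a unit normal
  \<open>a\<close>. The condition on the kernel rules out Y a = 0, since \<open>a\<close> would then
  be fixed. By skewness Y a is again normal to the fixed space, and it is orthogonal to
  \<open>a\<close>.\<close>

lemma Ck_subset_krylov_set: "Ck \<subseteq> (krylov_set :: 'n::finite point set)"
proof
  fix p :: "'n point" assume p: "p \<in> Ck"
  obtain x Y where xY: "p = (x, Y)" by (cases p)
  obtain M where Y: "transpose Y = - Y" and M: "orthogonal_matrix M" "M \<noteq> mat 1" "M *v x = x"
    "M ** Y ** transpose M = Y" "\<And>v. Y *v v = 0 \<Longrightarrow> M *v v = v"
    using p by (auto simp: xY Ck_def Gk_def)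
  define F where "F = {v. M *v v = v}"
  have F: "subspace F" by (auto simp: subspace_def F_def matrix_vector.add_right matrix_vector.scaleR_right)
  have "M ** Y ** transpose M ** M = Y ** M" using M(4) by simp
  then have "M ** Y = Y ** M"
    using M(1) by (simp add: orthogonal_matrix_def flip: matrix_mul_assoc)
  then have "M *v (Y *v v) = Y *v (M *v v)" for v by (simp add: matrix_vector_mul_assoc)
  then have YF: "Y *v v \<in> F" if "v \<in> F" for v using that by (simp add: F_def)
  have kF: "krylov Y x j \<in> F" for j
    by (induction j) (use M(3) YF in \<open>auto simp: F_def\<close>)
  have "F \<noteq> UNIV"
  proof
    assume "F = UNIV"
    then have "\<forall>v. M *v v = mat 1 *v v" by (auto simp: F_def)
    then show False using M(2) matrix_eq by blast
  qed
  then have "span F \<subset> span UNIV" using F by (simp add: span_eq_iff[THEN iffD2] psubset_eq)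
  from orthogonal_to_subspace_exists_gen[OF this] obtain a0 where
    a0': "a0 \<noteq> 0" "\<And>v. v \<in> span F \<Longrightarrow> orthogonal a0 v"
    by metis
  then have a0: "a0 \<noteq> 0" "\<And>v. v \<in> F \<Longrightarrow> a0 \<bullet> v = 0"
    by (simp_all add: orthogonal_def span_base)
  define a where "a = a0 /\<^sub>R norm a0"
  have a: "norm a = 1" "\<And>v. v \<in> F \<Longrightarrow> a \<bullet> v = 0" using a0 by (simp_all add: a_def)
  have "Y *v a \<noteq> 0"
  proof
    assume "Y *v a = 0"
    then have "a \<in> F" using M(5) by (simp add: F_def)
    then show False using a by (metis inner_eq_zero_iff norm_zero zero_neq_one)
  qed
  define b where "b = (Y *v a) /\<^sub>R norm (Y *v a)"
  have b: "norm b = 1" using \<open>Y *v a \<noteq> 0\<close> by (simp add: b_def)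
  have "(Y *v a) \<bullet> v = 0" if "v \<in> F" for v
    using inner_skew[OF Y, of a v] a(2)[OF YF[OF that]] by simp
  then have "b \<bullet> v = 0" if "v \<in> F" for v using that by (simp add: b_def)
  moreover have "a \<bullet> b = 0" using inner_skew_self[OF Y, of a] by (simp add: b_def)
  ultimately show "p \<in> krylov_set"
    unfolding krylov_set_def Gk_def xY using a b kF Y by blast
qed

lemma krylov_set_diff_Ck_subset: "krylov_set - Ck \<subseteq> (Abn_set :: 'n::finite point set)"
proof
  fix p :: "'n point" assume p: "p \<in> krylov_set - Ck"
  obtain x Y where xY: "p = (x, Y)" by (cases p)
  obtain a b where Y: "transpose Y = - Y" and ab: "norm a = 1" "norm b = 1" "a \<bullet> b = 0"
    "\<And>j. a \<bullet> krylov Y x j = 0" "\<And>j. b \<bullet> krylov Y x j = 0"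
    using p by (auto simp: xY krylov_set_def Gk_def)
  define W where "W = {w. \<forall>j. w \<bullet> krylov Y x j = 0}"
  have W: "subspace W" by (auto simp: subspace_def W_def inner_simps)
  have YW: "Y *v w \<in> W" if "w \<in> W" for w
  proof -
    have "(Y *v w) \<bullet> krylov Y x j = - (w \<bullet> krylov Y x (Suc j))" for j
      using inner_skew[OF Y, of w "krylov Y x j"] by simp
    then show ?thesis using that by (simp add: W_def del: krylov_simps)
  qed
  have YW0: "Y *v w = 0" if w: "w \<in> W" for w
  proof (rule ccontr)
    assume n: "Y *v w \<noteq> 0"
    then have "Y \<noteq> 0" by auto
    \<comment> \<open>The reflection takes place in Y W rather than in W: images under Y are
      orthogonal to the kernel of Y, which \<open>Ck\<close> requires to be fixed.\<close>
    have "(x, Y) \<in> Ck"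
    proof (rule in_Ck_if_invariant_subspace[OF Y \<open>Y \<noteq> 0\<close>, where U = "(*v) Y ` W"])
      show "subspace ((*v) Y ` W)"
        by (rule linear_subspace_image[OF matrix_vector_mul_linear W])
      show "Y *v w \<in> (*v) Y ` W" using w by blast
      show "Y *v w \<noteq> 0" by fact
      show "Y *v u \<in> (*v) Y ` W" if "u \<in> (*v) Y ` W" for u using that YW by blast
      show "u \<bullet> x = 0" if "u \<in> (*v) Y ` W" for u
      proof -
        have "u \<in> W" using that YW by blast
        then have "u \<bullet> krylov Y x 0 = 0" unfolding W_def by blast
        then show ?thesis by simp
      qed
      show "u \<bullet> v = 0" if "u \<in> (*v) Y ` W" "Y *v v = 0" for u v
        using that inner_skew[OF Y, of _ v] by auto
    qed
    then show False using p xY by blast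
  qed
  have "a \<in> W" "b \<in> W" using ab by (simp_all add: W_def)
  then have "Y *v a = 0" "Y *v b = 0" using YW0 by blast+
  moreover have "a \<bullet> x = 0" "b \<bullet> x = 0" using ab(4)[of 0] ab(5)[of 0] by simp_all
  ultimately show "p \<in> Abn_set"
    unfolding xY using ab(1-3) Y by (intro Abn_setI)
qed

lemma continuous_on_krylov: "continuous_on UNIV (\<lambda>p :: 'n::finite point. krylov (snd p) (fst p) j)"
  by (induction j) (auto intro!: continuous_intros matrix_vector.continuous_on)

text \<open>The witnesses are pairs of unit vectors, so a subsequence of them converges. Each
  orthogonality relation is continuous jointly in the point and the pair, and the unit norms keep
  the limiting pair nontrivial.\<close>

lemma closed_krylov_set: "closed (krylov_set :: 'n::finite point set)"
  unfolding closed_sequential_limits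
proof (intro allI impI, elim conjE)
  fix p :: "nat \<Rightarrow> 'n point" and l assume p: "\<forall>n. p n \<in> krylov_set" and l: "p \<longlonglongrightarrow> l"
  define K where "K p c \<longleftrightarrow> fst c \<bullet> snd c = 0 \<and> (\<forall>j. fst c \<bullet> krylov (snd p) (fst p) j = 0 \<and>
     snd c \<bullet> krylov (snd p) (fst p) j = 0)" for p :: "'n point" and c
  have set_eq: "q \<in> krylov_set \<longleftrightarrow> transpose (snd q) = - snd q \<and> (\<exists>c \<in> sphere 0 1 \<times> sphere 0 1. K q c)" for q
  proof -
    obtain x Y where q: "q = (x, Y)" by (cases q)
    have "(\<exists>c \<in> sphere 0 1 \<times> sphere 0 1. K q c) \<longleftrightarrow> (\<exists>a b. norm a = 1 \<and> norm b = 1 \<and> a \<bullet> b = 0 \<and>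
        (\<forall>j. a \<bullet> krylov Y x j = 0 \<and> b \<bullet> krylov Y x j = 0))" (is "?L \<longleftrightarrow> ?R")
    proof
      assume ?L
      then obtain a b where "a \<in> sphere 0 1" "b \<in> sphere 0 1" "K q (a, b)" by blast
      then show ?R unfolding K_def q mem_sphere_0 fst_conv snd_conv by blast
    next
      assume ?R
      then obtain a b where "norm a = 1" "norm b = 1" "K q (a, b)" unfolding K_def q fst_conv snd_conv by blast
      then show ?L by (intro bexI[of _ "(a, b)"]) simp_all
    qed
    then show ?thesis unfolding q krylov_set_def Gk_def by simp
  qed
  have "\<forall>n. \<exists>c. c \<in> sphere 0 1 \<times> sphere 0 1 \<and> K (p n) c" using p unfolding set_eq by blast
  then obtain c where c: "\<And>n. c n \<in> sphere 0 1 \<times> sphere 0 1" "\<And>n. K (p n) (c n)" by metis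
  have "seq_compact (sphere 0 1 \<times> sphere 0 1 :: ((real^'n) \<times> (real^'n)) set)"
    by (intro compact_imp_seq_compact compact_Times compact_sphere)
  then obtain c0 r where r: "c0 \<in> sphere 0 1 \<times> sphere 0 1" "strict_mono r" "(c \<circ> r) \<longlonglongrightarrow> c0"
    using c(1) unfolding seq_compact_def by blast
  have lr: "(\<lambda>n. p (r n)) \<longlonglongrightarrow> l" using LIMSEQ_subseq_LIMSEQ[OF l r(2)] by (simp add: o_def)
  have cr: "(\<lambda>n. c (r n)) \<longlonglongrightarrow> c0" using r(3) by (simp add: o_def)
  have kr: "(\<lambda>n. krylov (snd (p (r n))) (fst (p (r n))) j) \<longlonglongrightarrow> krylov (snd l) (fst l) j" for j
    using continuous_on_tendsto_compose[OF continuous_on_krylov lr] by simp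
  have lim0: "z = 0" if "(\<lambda>n. f n) \<longlonglongrightarrow> z" "\<And>n. f n = 0" for f :: "nat \<Rightarrow> real" and z
    using that by (simp add: LIMSEQ_const_iff)
  have "K l c0"
    unfolding K_def
  proof (intro conjI allI)
    show "fst c0 \<bullet> snd c0 = 0"
      by (rule lim0[OF tendsto_inner[OF tendsto_fst[OF cr] tendsto_snd[OF cr]]]) (use c(2) in \<open>simp add: K_def\<close>)
    show "fst c0 \<bullet> krylov (snd l) (fst l) j = 0" for j
      by (rule lim0[OF tendsto_inner[OF tendsto_fst[OF cr] kr]]) (use c(2) in \<open>simp add: K_def\<close>)
    show "snd c0 \<bullet> krylov (snd l) (fst l) j = 0" for j
      by (rule lim0[OF tendsto_inner[OF tendsto_snd[OF cr] kr]]) (use c(2) in \<open>simp add: K_def\<close>)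
  qed
  moreover have "transpose (snd l) = - snd l"
  proof -
    have "(\<lambda>n. transpose (snd (p n))) \<longlonglongrightarrow> transpose (snd l)"
      by (intro bounded_linear.tendsto[OF bounded_linear_transpose] tendsto_snd l)
    moreover have "(\<lambda>n. transpose (snd (p n))) \<longlonglongrightarrow> - snd l"
      using tendsto_minus[OF tendsto_snd[OF l]] p by (simp add: set_eq)
    ultimately show ?thesis by (rule LIMSEQ_unique)
  qed
  ultimately show "l \<in> krylov_set" unfolding set_eq using r(1) by blast
qed

lemma closure_Ck_diff_subset: "closure Ck - Ck \<subseteq> (Abn_set :: 'n::finite point set)"
  using closure_minimal[OF Ck_subset_krylov_set closed_krylov_set] krylov_set_diff_Ck_subset by blast

text \<open>The added term makes the plane of \<open>a\<close> and \<open>b\<close> invariant,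
  acting there as a multiple of a quarter turn, and leaves only kernel vectors orthogonal to that
  plane; the reflection in the plane does the rest. Besides approximating abnormal points, the case
  Y = 0 gives explicit points of \<open>Ck\<close>.\<close>

lemma perturbation_in_Ck:
  fixes Y :: "real^'n::finite^'n"
  assumes ab: "norm a = 1" "norm b = 1" "a \<bullet> b = 0" and x: "a \<bullet> x = 0" "b \<bullet> x = 0"
    and Y: "transpose Y = - Y" "Y *v a = 0" "Y *v b = 0" and e: "e \<noteq> 0"
  shows "(x, Y + e *\<^sub>R wedge a b) \<in> Ck"
proof -
  let ?Z = "Y + e *\<^sub>R wedge a b"
  have Z: "?Z *v v = Y *v v + e *\<^sub>R ((b \<bullet> v) *\<^sub>R a - (a \<bullet> v) *\<^sub>R b)" for v
    by (simp add: matrix_vector.add_left matrix_vector.scaleR_left wedge_mult_vec)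
  have n: "a \<bullet> a = 1" "b \<bullet> b = 1" "b \<bullet> a = 0" using ab by (simp_all add: norm_eq_1 inner_commute)
  have aY: "a \<bullet> (Y *v v) = 0" "b \<bullet> (Y *v v) = 0" for v
    using inner_skew[OF Y(1), of _ v] Y(2,3) by simp_all
  have Zb: "?Z *v b = e *\<^sub>R a" by (simp add: Z Y n ab)
  show ?thesis
  proof (rule in_Ck_if_invariant_subspace[where U = "span {a, b}"])
    show "transpose ?Z = - ?Z" using Y(1) by (simp add: linear_transpose_simps transpose_wedge)
    show "?Z \<noteq> 0"
    proof
      assume "?Z = 0"
      then have "e *\<^sub>R a = 0" using Zb by simp
      then show False using e ab by auto
    qed
    show "subspace (span {a, b})" by (rule subspace_span)
    show "a \<in> span {a, b}" by (simp add: span_base)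
    show "a \<noteq> 0" using ab by auto
    show "?Z *v u \<in> span {a, b}" if "u \<in> span {a, b}" for u
    proof -
      have "Y *v u = 0" using that
        by (induction u rule: span_induct_alt) (auto simp: matrix_vector.add_right matrix_vector.scaleR_right Y)
      then show ?thesis by (simp add: Z span_diff span_scale span_base)
    qed
    show "u \<bullet> x = 0" if "u \<in> span {a, b}" for u
      using that by (induction u rule: span_induct_alt) (auto simp: inner_simps x)
    show "u \<bullet> v = 0" if "u \<in> span {a, b}" "?Z *v v = 0" for u v
    proof -
      have "a \<bullet> (?Z *v v) = 0" "b \<bullet> (?Z *v v) = 0" using that(2) by simp_all
      then have v: "a \<bullet> v = 0" "b \<bullet> v = 0" using e by (simp_all add: Z inner_simps aY n ab)
      show ?thesis using that(1) v
        by (induction u rule: span_induct_alt) (auto simp: inner_simps)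
    qed
  qed
qed

lemma Abn_set_subset_closure_Ck: "Abn_set \<subseteq> closure (Ck :: 'n::finite point set)"
proof
  fix p :: "'n point" assume p: "p \<in> Abn_set"
  obtain x Y where xY: "p = (x, Y)" by (cases p)
  obtain a b where ab: "norm a = 1" "norm b = 1" "a \<bullet> b = 0" "a \<bullet> x = 0" "b \<bullet> x = 0"
    "transpose Y = - Y" "Y *v a = 0" "Y *v b = 0"
    using p unfolding Abn_set_def Gk_def xY by blast
  define q where "q n = (x, Y + (1 / real (Suc n)) *\<^sub>R wedge a b)" for n
  have "q n \<in> Ck" for n unfolding q_def by (rule perturbation_in_Ck[OF ab]) simp
  moreover have "q \<longlonglongrightarrow> (x, Y + 0 *\<^sub>R wedge a b)"
    unfolding q_def using LIMSEQ_Suc[OF lim_1_over_n[where 'a = real]] by (intro tendsto_intros) simp_all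
  ultimately show "p \<in> closure Ck"
    unfolding closure_sequential xY by (intro exI[of _ q]) simp
qed

text \<open>Minimizing the dimension of the kernel treats even and odd dimensions alike. If
  \<open>(0, Y)\<close> were abnormal, adding the wedge of the two kernel vectors would give a skew
  matrix with a strictly smaller kernel.\<close>

lemma exists_Ck_not_Abn_set:
  assumes "2 \<le> CARD('n::finite)"
  shows "\<exists>p \<in> Ck. (p :: 'n point) \<notin> Abn_set"
proof -
  define k where "k Y = dim {v. Y *v v = 0}" for Y :: "real^'n^'n"
  have "\<exists>Y :: real^'n^'n. transpose Y = - Y" by (rule exI[of _ 0]) (simp add: transpose_def vec_eq_iff)
  then obtain Y :: "real^'n^'n" where Y: "transpose Y = - Y"
    and min: "\<And>Z :: real^'n^'n. transpose Z = - Z \<Longrightarrow> k Y \<le> k Z"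
    using ex_has_least_nat[of "\<lambda>Y. transpose Y = - Y" _ k] by metis
  have nAbn: "(0, Y) \<notin> Abn_set"
  proof
    assume "(0, Y) \<in> Abn_set"
    then obtain a b where ab: "norm a = 1" "norm b = 1" "a \<bullet> b = 0" "Y *v a = 0" "Y *v b = 0"
      unfolding Abn_set_def by blast
    let ?Z = "Y + wedge a b"
    have Z: "?Z *v v = Y *v v + ((b \<bullet> v) *\<^sub>R a - (a \<bullet> v) *\<^sub>R b)" for v
      by (simp add: matrix_vector.add_left wedge_mult_vec)
    have n: "a \<bullet> a = 1" "b \<bullet> b = 1" "b \<bullet> a = 0" using ab by (simp_all add: norm_eq_1 inner_commute)
    have aY: "a \<bullet> (Y *v v) = 0" "b \<bullet> (Y *v v) = 0" for v
      using inner_skew[OF Y, of _ v] ab by simp_all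
    have sub: "subspace {v. A *v v = 0}" for A :: "real^'n^'n"
      by (auto simp: subspace_def matrix_vector.add_right matrix_vector.scaleR_right)
    have "{v. ?Z *v v = 0} \<subset> {v. Y *v v = 0}"
    proof (rule psubsetI)
      show "{v. ?Z *v v = 0} \<subseteq> {v. Y *v v = 0}"
      proof clarify
        fix v assume v: "?Z *v v = 0"
        then have "a \<bullet> (?Z *v v) = 0" "b \<bullet> (?Z *v v) = 0" by simp_all
        then have "a \<bullet> v = 0" "b \<bullet> v = 0" by (simp_all add: Z inner_simps aY n ab)
        then show "Y *v v = 0" using v by (simp add: Z)
      qed
      have "?Z *v a = - b" using n ab by (simp add: Z)
      then have "?Z *v a \<noteq> 0" using ab by auto
      then show "{v. ?Z *v v = 0} \<noteq> {v. Y *v v = 0}" using ab(4) by blast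
    qed
    then have "k ?Z < k Y"
      unfolding k_def using sub by (intro dim_psubset) (simp add: span_eq_iff[THEN iffD2])
    moreover have "transpose ?Z = - ?Z" using Y by (simp add: linear_transpose_simps transpose_wedge)
    ultimately show False using min[of ?Z] by simp
  qed
  have "Y \<noteq> 0"
  proof
    assume "Y = 0"
    \<comment> \<open>For Y = 0 any two axes would witness abnormality; this is where dimension at
      least 2 enters.\<close>
    obtain i j :: 'n where "i \<noteq> j"
      using assms by (metis (full_types) UNIV_I card_2_iff' card_le_Suc0_iff_eq finite not_less_eq_eq numeral_2_eq_2)
    then have "(0, 0) \<in> (Abn_set :: 'n point set)"
      by (intro Abn_setI[of _ "axis i 1" "axis j 1"]) (auto simp: inner_axis_axis transpose_def vec_eq_iff)
    then show False using nAbn \<open>Y = 0\<close> by simp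
  qed
  then obtain z where z: "Y *v z \<noteq> 0" by (metis matrix_eq matrix_vector_mult_0)
  have "(0, Y) \<in> Ck"
  proof (rule in_Ck_if_invariant_subspace[OF Y \<open>Y \<noteq> 0\<close>, where U = "range ((*v) Y)"])
    show "subspace (range ((*v) Y))"
      by (rule linear_subspace_image[OF matrix_vector_mul_linear subspace_UNIV])
    show "Y *v z \<in> range ((*v) Y)" by simp
    show "u \<bullet> v = 0" if "u \<in> range ((*v) Y)" "Y *v v = 0" for u v
      using that inner_skew[OF Y, of _ v] by auto
  qed (use z in auto)
  then show ?thesis using nAbn by blast
qed

lemma exists_four_indices:
  assumes "4 \<le> CARD('n::finite)"
  shows "\<exists>i j k l :: 'n. i \<noteq> j \<and> i \<noteq> k \<and> i \<noteq> l \<and> j \<noteq> k \<and> j \<noteq> l \<and> k \<noteq> l"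
proof -
  obtain S :: "'n set" where "card S = 4" using assms obtain_subset_with_card_n[of 4 "UNIV :: 'n set"] by blast
  then show ?thesis by (auto simp: card_Suc_eq numeral_eq_Suc)
qed

text \<open>One coordinate plane is rotated, which gives membership in \<open>Ck\<close>; the axes
  of a second one lie in the kernel, which gives abnormality. Hence four indices.\<close>

lemma Ck_Int_Abn_set_nonempty:
  assumes "4 \<le> CARD('n::finite)"
  shows "Ck \<inter> (Abn_set :: 'n point set) \<noteq> {}"
proof -
  obtain i j k l :: 'n where d: "i \<noteq> j" "i \<noteq> k" "i \<noteq> l" "j \<noteq> k" "j \<noteq> l" "k \<noteq> l"
    using exists_four_indices[OF assms] by blast
  let ?e = "\<lambda>i. axis i 1 :: real^'n"
  have "(0, 0 + 1 *\<^sub>R wedge (?e i) (?e j)) \<in> Ck"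
    by (rule perturbation_in_Ck) (use d in \<open>auto simp: inner_axis_axis transpose_def vec_eq_iff\<close>)
  moreover have "(0, 0 + 1 *\<^sub>R wedge (?e i) (?e j)) \<in> Abn_set"
    by (rule Abn_setI[of _ "?e k" "?e l"])
      (use d in \<open>auto simp: inner_axis_axis transpose_wedge wedge_mult_vec\<close>)
  ultimately show ?thesis by blast
qed

section \<open>Lengths and distances\<close>

lemma horizontal_cong:
  assumes "\<And>t. t \<in> {0..T} \<Longrightarrow> \<gamma> t = \<gamma>' t"
  shows "horizontal T \<gamma> u \<longleftrightarrow> horizontal T \<gamma>' u"
proof -
  have *: "horizontal T \<gamma>' u" if eq: "\<And>t. t \<in> {0..T} \<Longrightarrow> \<gamma> t = \<gamma>' t" and h: "horizontal T \<gamma> u"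
    for \<gamma> \<gamma>' :: "real \<Rightarrow> 'a point"
  proof -
    obtain C where "C-lipschitz_on {0..T} \<gamma>" using h unfolding horizontal_def by blast
    then have "C-lipschitz_on {0..T} \<gamma>'" by (rule lipschitz_on_transform) (simp add: eq)
    moreover have "negligible {t \<in> {0..T}. \<not> (\<gamma>' has_vector_derivative (u t, (1/2) *\<^sub>R wedge (fst (\<gamma>' t)) (u t))) (at t within {0..T})}"
      (is "negligible ?B")
    proof (rule negligible_subset)
      show "negligible {t \<in> {0..T}. \<not> (\<gamma> has_vector_derivative (u t, (1/2) *\<^sub>R wedge (fst (\<gamma> t)) (u t))) (at t within {0..T})}"
        (is "negligible ?A")
        using h by (simp add: horizontal_iff)
      show "?B \<subseteq> ?A"
      proof clarify
        fix t assume t: "t \<in> {0..T}" and n: "\<not> (\<gamma>' has_vector_derivative (u t, (1/2) *\<^sub>R wedge (fst (\<gamma>' t)) (u t))) (at t within {0..T})"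
          and "(\<gamma> has_vector_derivative (u t, (1/2) *\<^sub>R wedge (fst (\<gamma> t)) (u t))) (at t within {0..T})"
        then have "(\<gamma>' has_vector_derivative (u t, (1/2) *\<^sub>R wedge (fst (\<gamma> t)) (u t))) (at t within {0..T})"
          by (intro has_vector_derivative_transform[of t "{0..T}" \<gamma>' \<gamma>]) (simp_all add: eq)
        then show False using n eq[OF t] by simp
      qed
    qed
    moreover have "\<forall>t\<in>{0..T}. \<gamma>' t \<in> Gk" using h eq unfolding horizontal_def by metis
    ultimately show ?thesis using h unfolding horizontal_iff by blast
  qed
  show ?thesis using *[of \<gamma> \<gamma>'] *[of \<gamma>' \<gamma>] assms by auto
qed

text \<open>\<open>minimizing_geodesic\<close> speaks of some control of the curve; a.e. uniqueness
  allows its length to be computed with any known control.\<close>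

lemma horizontal_control_unique:
  assumes "horizontal T \<gamma> u" "horizontal T \<gamma> v" "0 < T"
  shows "AE t in lebesgue_on {0..T}. u t = v t"
  using horizontal_AE_derivative[OF assms(1)] horizontal_AE_derivative[OF assms(2)] AE_in_Icc
proof eventually_elim
  case (elim t)
  have "at t within {0..T} \<noteq> bot"
    using elim(3) assms(3) by (simp add: trivial_limit_within islimpt_Icc)
  then show ?case
    using elim by (intro vector_derivative_unique_within[of t "{0..T}"]) auto
qed

lemma arc_length_cong_AE:
  assumes "AE t in lebesgue_on {a..b}. u t = v t"
  shows "arc_length a b u = arc_length a b v"
  unfolding arc_length_def
  by (rule integral_cong_AE_Icc) (use assms in eventually_elim, simp)

lemma arc_length_nonneg: "0 \<le> arc_length a b u"
  unfolding arc_length_def by (cases "(\<lambda>t. norm (u t)) integrable_on {a..b}")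
    (auto intro: integral_nonneg simp: not_integrable_integral)

lemma arc_length_shift: "arc_length 0 (b - a) (\<lambda>t. u (a + t)) = arc_length a b u"
  unfolding arc_length_def using integral_shift_Icc_real[of 0 "b - a" "\<lambda>t. norm (u t)" a] by (simp add: o_def)

lemma arc_length_combine:
  assumes "ess_bounded_on {0..T} u" "0 \<le> t" "t \<le> T"
  shows "arc_length 0 t u + arc_length t T u = arc_length 0 T u"
  unfolding arc_length_def using norm_integrable[OF assms(1)] assms(2,3)
  by (intro Henstock_Kurzweil_Integration.integral_combine)

lemma cc_dist_le:
  assumes "0 < T" "horizontal T \<gamma> u"
  shows "cc_dist (\<gamma> 0) (\<gamma> T) \<le> arc_length 0 T u"
  unfolding cc_dist_def
proof (rule cInf_lower)
  show "bdd_below {arc_length 0 S v | S \<delta> v. 0 < S \<and> horizontal S \<delta> v \<and> \<delta> 0 = \<gamma> 0 \<and> \<delta> S = \<gamma> T}"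
    by (rule bdd_belowI[of _ 0]) (auto simp: arc_length_nonneg)
qed (use assms in blast)

text \<open>The given curve makes the set of competing lengths nonempty, without which the infimum
  would carry no information.\<close>

lemma cc_dist_greatest:
  assumes "0 < T" "horizontal T \<gamma> u"
    and "\<And>S \<delta> v. 0 < S \<Longrightarrow> horizontal S \<delta> v \<Longrightarrow> \<delta> 0 = \<gamma> 0 \<Longrightarrow> \<delta> S = \<gamma> T \<Longrightarrow> l \<le> arc_length 0 S v"
  shows "l \<le> cc_dist (\<gamma> 0) (\<gamma> T)"
  unfolding cc_dist_def by (rule cInf_greatest) (use assms in blast)+

lemma cc_dist_self:
  assumes "p \<in> Gk"
  shows "cc_dist p p = 0"
proof -
  let ?\<gamma> = "\<lambda>t. gmul p (hlift 0 (\<lambda>_. 0) t)"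
  have h: "horizontal 1 ?\<gamma> (\<lambda>_. 0)"
    by (intro horizontal_gmul horizontal_hlift ess_bounded_on_const zero_in_Gk assms)
  have "?\<gamma> 1 = p" by (simp add: hlift_const flip: zero_prod_def)
  then show ?thesis
    using cc_dist_le[OF _ h] cc_dist_greatest[OF _ h, of 0] by (simp add: arc_length_nonneg)
qed

lemma horizontal_restrict:
  assumes "horizontal T \<gamma> u" "t \<le> T"
  shows "horizontal t \<gamma> u"
  using horizontal_subinterval[OF assms(1), of 0 t] assms(2) by simp

lemma horizontal_displacement_le:
  assumes h: "horizontal T \<gamma> u" and t: "0 \<le> a" "a \<le> b" "b \<le> T"
  shows "norm (fst (\<gamma> b) - fst (\<gamma> a)) \<le> arc_length a b u"
proof -
  have h': "horizontal (b - a) (\<lambda>t. \<gamma> (a + t)) (\<lambda>t. u (a + t))"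
    using horizontal_subinterval[OF h] t by simp
  then have e: "ess_bounded_on {0..b - a} (\<lambda>t. u (a + t))" by (simp add: horizontal_def)
  have "fst (\<gamma> b) - fst (\<gamma> a) = integral {0..b - a} (\<lambda>t. u (a + t))"
    using horizontal_imp_hlift[OF h', of "b - a"] t by (simp add: hlift_def)
  also have "norm \<dots> \<le> arc_length 0 (b - a) (\<lambda>t. u (a + t))"
    unfolding arc_length_def
    by (rule integral_norm_bound_integral[OF ess_bounded_on_integrable[OF e] norm_integrable[OF e]]) simp
  finally show ?thesis by (simp only: arc_length_shift)
qed

section \<open>Calibrations\<close>

text \<open>The area of a slice of the unit half disc. As the integral of a continuous function it
  is Lipschitz on \<open>{-1..1}\<close> and has one-sided derivatives up to the ends.\<close>

definition half_disc :: "real \<Rightarrow> real" where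
  "half_disc s = integral {-1..s} (\<lambda>r. sqrt (1 - r\<^sup>2))"

text \<open>Along a horizontal curve the Y-term changes at the rate ((p . x)(q . u) - (q . x)(p .
  u)) / 2. The product term completes this to (p . x)(q . u), the last term shifts it to s (q . u)
  with s = p . x - \<alpha>, and \<open>half_disc\<close> contributes sqrt (1 - s^2) (p . u). These
  weights are the velocity components of a unit circle.\<close>

definition calibration :: "real^'n::finite \<Rightarrow> real^'n \<Rightarrow> real \<Rightarrow> 'n point \<Rightarrow> real" where
  "calibration p q \<alpha> z = half_disc (p \<bullet> fst z - \<alpha>) + p \<bullet> (snd z *v q)
     + (1/2) * ((p \<bullet> fst z) * (q \<bullet> fst z)) - \<alpha> * (q \<bullet> fst z)"

text \<open>With \<open>s = p \<bullet> x - \<alpha>\<close>, the horizontal gradient of the calibration is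
  \<open>sqrt (1 - s\<^sup>2) p + s q\<close>, a unit vector when \<open>\<bar>s\<bar> \<le> 1\<close>.\<close>

lemma calibration_has_integral:
  assumes h: "horizontal T \<gamma> u" and T: "0 \<le> T"
    and s: "\<And>t. t \<in> {0..T} \<Longrightarrow> \<bar>p \<bullet> fst (\<gamma> t) - \<alpha>\<bar> \<le> 1"
  shows "((\<lambda>t. (sqrt (1 - (p \<bullet> fst (\<gamma> t) - \<alpha>)\<^sup>2) *\<^sub>R p + (p \<bullet> fst (\<gamma> t) - \<alpha>) *\<^sub>R q) \<bullet> u t)
    has_integral calibration p q \<alpha> (\<gamma> T) - calibration p q \<alpha> (\<gamma> 0)) {0..T}"
proof -
  define x where "x t = fst (\<gamma> t)" for t
  have cont: "continuous_on {-1..1} (\<lambda>r::real. sqrt (1 - r\<^sup>2))" by (intro continuous_intros)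
  have hd: "(half_disc has_vector_derivative sqrt (1 - r\<^sup>2)) (at r within {-1..1})" if "r \<in> {-1..1}" for r
    unfolding half_disc_def[abs_def] by (rule integral_has_vector_derivative[OF cont that])
  obtain K where K: "K-lipschitz_on {-1..1} half_disc"
    unfolding half_disc_def[abs_def] using lipschitz_on_integral[OF continuous_imp_ess_bounded_on[OF cont]] by blast
  obtain C where C: "C-lipschitz_on {0..T} \<gamma>" using h unfolding horizontal_def by blast
  have lin: "\<exists>L. L-lipschitz_on {0..T} (\<lambda>t. A (\<gamma> t))" if A: "bounded_linear A" for A :: "'a point \<Rightarrow> real"
  proof -
    obtain D where "D-lipschitz_on (\<gamma> ` {0..T}) A" by (rule bounded_linear.lipschitz_boundE[OF A])
    then have "(D * C)-lipschitz_on {0..T} (\<lambda>t. A (\<gamma> t))" using lipschitz_on_compose2[OF C] by blast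
    then show ?thesis by blast
  qed
  have blin: "bounded_linear (\<lambda>z :: 'a point. r \<bullet> fst z)" "bounded_linear (\<lambda>z :: 'a point. p \<bullet> (snd z *v q))" for r
    by (intro bounded_linear_compose[OF bounded_linear_inner_right] bounded_linear_fst bounded_linear_snd
        bounded_linear_compose[OF matrix_vector.bounded_linear_left])+
  have "\<exists>L. L-lipschitz_on {0..T} (\<lambda>t. calibration p q \<alpha> (\<gamma> t))"
  proof -
    obtain L1 L2 L3 where L: "L1-lipschitz_on {0..T} (\<lambda>t. p \<bullet> x t)" "L2-lipschitz_on {0..T} (\<lambda>t. q \<bullet> x t)"
      "L3-lipschitz_on {0..T} (\<lambda>t. p \<bullet> (snd (\<gamma> t) *v q))"
      using lin[OF blin(1)[of p]] lin[OF blin(1)[of q]] lin[OF blin(2)] unfolding x_def by blast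
    obtain L4 where L4: "L4-lipschitz_on {0..T} (\<lambda>t. (p \<bullet> x t) * (q \<bullet> x t))"
      using lipschitz_on_bilinear[OF bounded_bilinear_mult L(1,2)] by blast
    have "(L1 + 0)-lipschitz_on {0..T} (\<lambda>t. p \<bullet> x t - \<alpha>)"
      by (intro lipschitz_on_diff L lipschitz_on_constant)
    moreover have "K-lipschitz_on ((\<lambda>t. p \<bullet> x t - \<alpha>) ` {0..T}) half_disc"
      using s by (intro lipschitz_on_subset[OF K]) (force simp: x_def abs_le_iff)
    ultimately have L5: "(K * (L1 + 0))-lipschitz_on {0..T} (\<lambda>t. half_disc (p \<bullet> x t - \<alpha>))"
      by (rule lipschitz_on_compose2)
    show ?thesis
      unfolding calibration_def x_def[symmetric]
      by (rule exI, rule lipschitz_on_diff[OF lipschitz_on_add[OF lipschitz_on_add[OF L5 L(3)]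
          lipschitz_on_cmult_real[OF L4]] lipschitz_on_cmult_real[OF L(2)]])
  qed
  then obtain L where L: "L-lipschitz_on {0..T} (\<lambda>t. calibration p q \<alpha> (\<gamma> t))" by blast
  have "AE t in lebesgue_on {0..T}. ((\<lambda>t. calibration p q \<alpha> (\<gamma> t)) has_vector_derivative
      (sqrt (1 - (p \<bullet> x t - \<alpha>)\<^sup>2) *\<^sub>R p + (p \<bullet> x t - \<alpha>) *\<^sub>R q) \<bullet> u t) (at t within {0..T})"
    using horizontal_AE_derivative[OF h] AE_in_Icc
  proof eventually_elim
    case (elim t)
    have dx: "(x has_vector_derivative u t) (at t within {0..T})" and
      dY: "((\<lambda>t. snd (\<gamma> t)) has_vector_derivative (1/2) *\<^sub>R wedge (x t) (u t)) (at t within {0..T})"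
      using elim unfolding x_def by auto
    have dr: "((\<lambda>t. r \<bullet> x t) has_vector_derivative r \<bullet> u t) (at t within {0..T})" for r
      by (rule bounded_linear.has_vector_derivative[OF bounded_linear_inner_right dx])
    have d1: "((\<lambda>t. p \<bullet> x t - \<alpha>) has_vector_derivative p \<bullet> u t) (at t within {0..T})"
      using has_vector_derivative_diff[OF dr[of p] has_vector_derivative_const[of \<alpha>]] by simp
    have "(half_disc has_vector_derivative sqrt (1 - (p \<bullet> x t - \<alpha>)\<^sup>2)) (at (p \<bullet> x t - \<alpha>) within (\<lambda>t. p \<bullet> x t - \<alpha>) ` {0..T})"
      using s elim(2) by (intro has_vector_derivative_within_subset[OF hd]) (force simp: x_def abs_le_iff)+
    from vector_diff_chain_within[OF d1 this]
    have d2: "((\<lambda>t. half_disc (p \<bullet> x t - \<alpha>)) has_vector_derivative (p \<bullet> u t) * sqrt (1 - (p \<bullet> x t - \<alpha>)\<^sup>2)) (at t within {0..T})"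
      by (simp add: o_def)
    have d3: "((\<lambda>t. p \<bullet> (snd (\<gamma> t) *v q)) has_vector_derivative p \<bullet> (((1/2) *\<^sub>R wedge (x t) (u t)) *v q)) (at t within {0..T})"
      by (intro bounded_linear.has_vector_derivative[OF bounded_linear_inner_right]
          bounded_linear.has_vector_derivative[OF matrix_vector.bounded_linear_left] dY)
    have d4: "((\<lambda>t. (p \<bullet> x t) * (q \<bullet> x t)) has_vector_derivative (p \<bullet> x t) * (q \<bullet> u t) + (p \<bullet> u t) * (q \<bullet> x t)) (at t within {0..T})"
      by (rule has_vector_derivative_mult[OF dr dr])
    have "((\<lambda>t. calibration p q \<alpha> (\<gamma> t)) has_vector_derivative
       (p \<bullet> u t) * sqrt (1 - (p \<bullet> x t - \<alpha>)\<^sup>2) + p \<bullet> (((1/2) *\<^sub>R wedge (x t) (u t)) *v q)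
       + (1/2) * ((p \<bullet> x t) * (q \<bullet> u t) + (p \<bullet> u t) * (q \<bullet> x t)) - \<alpha> * (q \<bullet> u t)) (at t within {0..T})"
      unfolding calibration_def x_def[symmetric]
      by (intro has_vector_derivative_diff has_vector_derivative_add d2 d3 dr d4
          has_vector_derivative_mult_right)
    moreover have "p \<bullet> (((1/2) *\<^sub>R wedge (x t) (u t)) *v q) = (1/2) * ((q \<bullet> u t) * (p \<bullet> x t) - (q \<bullet> x t) * (p \<bullet> u t))"
      by (simp add: matrix_vector.scaleR_left wedge_mult_vec inner_simps inner_commute)
    then have "(p \<bullet> u t) * sqrt (1 - (p \<bullet> x t - \<alpha>)\<^sup>2) + p \<bullet> (((1/2) *\<^sub>R wedge (x t) (u t)) *v q)
       + (1/2) * ((p \<bullet> x t) * (q \<bullet> u t) + (p \<bullet> u t) * (q \<bullet> x t)) - \<alpha> * (q \<bullet> u t)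
       = (sqrt (1 - (p \<bullet> x t - \<alpha>)\<^sup>2) *\<^sub>R p + (p \<bullet> x t - \<alpha>) *\<^sub>R q) \<bullet> u t"
      by (simp only: inner_add_left inner_scaleR_left) (simp add: field_simps)
    ultimately show ?case by (simp only:)
  qed
  then show ?thesis
    unfolding x_def by (rule has_integral_derivative_lipschitz[OF T L])
qed

text \<open>For orthonormal \<open>p\<close> and \<open>q\<close> the gradient is a unit vector as
  long as the curve stays in the slab, so Cauchy-Schwarz bounds the integrand by the speed.\<close>

lemma calibration_le_arc_length:
  assumes h: "horizontal T \<gamma> u" and T: "0 \<le> T"
    and s: "\<And>t. t \<in> {0..T} \<Longrightarrow> \<bar>p \<bullet> fst (\<gamma> t) - \<alpha>\<bar> \<le> 1"
    and pq: "norm p = 1" "norm q = 1" "p \<bullet> q = 0"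
  shows "calibration p q \<alpha> (\<gamma> T) - calibration p q \<alpha> (\<gamma> 0) \<le> arc_length 0 T u"
proof -
  have "ess_bounded_on {0..T} u" using h by (simp add: horizontal_def)
  from integrable_integral[OF norm_integrable[OF this]]
  have "((\<lambda>t. norm (u t)) has_integral arc_length 0 T u) {0..T}" by (simp add: arc_length_def)
  with calibration_has_integral[OF h T s] show ?thesis
  proof (rule has_integral_le)
    fix t assume t: "t \<in> {0..T}"
    define r where "r = p \<bullet> fst (\<gamma> t) - \<alpha>"
    define w where "w = sqrt (1 - r\<^sup>2) *\<^sub>R p + r *\<^sub>R q"
    have "r\<^sup>2 \<le> 1" using s[OF t] by (simp add: r_def abs_square_le_1)
    then have "w \<bullet> w = 1"
      using pq by (simp add: w_def inner_simps inner_commute norm_eq_1 power2_eq_square flip: real_sqrt_mult)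
    then have "norm w = 1" by (simp add: norm_eq_1)
    then show "(sqrt (1 - (p \<bullet> fst (\<gamma> t) - \<alpha>)\<^sup>2) *\<^sub>R p + (p \<bullet> fst (\<gamma> t) - \<alpha>) *\<^sub>R q) \<bullet> u t \<le> norm (u t)"
      using norm_cauchy_schwarz[of w "u t"] by (simp add: w_def r_def)
  qed
qed

text \<open>The calibration lives in a slab of half-width 1. A curve with both ends in the slab of
  half-width 1/2 either stays inside, where the calibration applies, or travels at least 1/2 out and
  1/2 back.\<close>

lemma arc_length_ge_calibration_or_exit:
  assumes h: "horizontal T \<gamma> u" and T: "0 \<le> T"
    and ends: "\<bar>p \<bullet> fst (\<gamma> 0) - \<alpha>\<bar> \<le> 1/2" "\<bar>p \<bullet> fst (\<gamma> T) - \<alpha>\<bar> \<le> 1/2"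
    and pq: "norm p = 1" "norm q = 1" "p \<bullet> q = 0"
  shows "min 1 (calibration p q \<alpha> (\<gamma> T) - calibration p q \<alpha> (\<gamma> 0)) \<le> arc_length 0 T u"
proof (cases "\<forall>t\<in>{0..T}. \<bar>p \<bullet> fst (\<gamma> t) - \<alpha>\<bar> \<le> 1")
  case True
  then show ?thesis using calibration_le_arc_length[OF h T _ pq] by (simp add: min.coboundedI2)
next
  case False
  then obtain t where t: "t \<in> {0..T}" "1 < \<bar>p \<bullet> fst (\<gamma> t) - \<alpha>\<bar>" by force
  have proj: "\<bar>p \<bullet> fst (\<gamma> b) - p \<bullet> fst (\<gamma> a)\<bar> \<le> arc_length a b u" if "0 \<le> a" "a \<le> b" "b \<le> T" for a b
  proof -
    have "\<bar>p \<bullet> (fst (\<gamma> b) - fst (\<gamma> a))\<bar> \<le> norm p * norm (fst (\<gamma> b) - fst (\<gamma> a))"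
      by (rule Cauchy_Schwarz_ineq2)
    then show ?thesis using horizontal_displacement_le[OF h that] pq by (simp add: inner_simps)
  qed
  have "arc_length 0 t u + arc_length t T u = arc_length 0 T u"
    using h t by (intro arc_length_combine) (auto simp: horizontal_def)
  moreover have "1/2 \<le> arc_length 0 t u"
    using proj[of 0 t] t ends by (simp add: abs_real_def split: if_splits)
  moreover have "1/2 \<le> arc_length t T u"
    using proj[of t T] t ends by (simp add: abs_real_def split: if_splits)
  ultimately have "1 \<le> arc_length 0 T u" by simp
  then show ?thesis by (rule min.coboundedI1)
qed

section \<open>A planar circle\<close>

definition circle_control :: "real^'n::finite \<Rightarrow> real^'n \<Rightarrow> real \<Rightarrow> real^'n" where
  "circle_control e f t = cos t *\<^sub>R e + sin t *\<^sub>R f"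

definition circle :: "real^'n::finite \<Rightarrow> real^'n \<Rightarrow> real \<Rightarrow> 'n point" where
  "circle e f = hlift 0 (circle_control e f)"

lemma ess_bounded_on_circle_control: "ess_bounded_on {a..b} (circle_control e f)"
  unfolding circle_control_def by (rule continuous_imp_ess_bounded_on) (intro continuous_intros)

lemma horizontal_circle: "horizontal T (circle e f) (circle_control e f)"
  unfolding circle_def by (rule horizontal_hlift[OF ess_bounded_on_circle_control zero_in_Gk])

lemma circle_eq:
  assumes "0 \<le> t"
  shows "circle e f t = (sin t *\<^sub>R e + (1 - cos t) *\<^sub>R f, ((t - sin t) / 2) *\<^sub>R wedge e f)"
proof -
  have "(circle_control e f has_integral (sin t *\<^sub>R e + (1 - cos t) *\<^sub>R f) - (sin 0 *\<^sub>R e + (1 - cos 0) *\<^sub>R f)) {0..t}"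
    if "0 \<le> t" for t
    unfolding circle_control_def
    by (rule fundamental_theorem_of_calculus[OF that])
      (auto intro!: derivative_eq_intros simp: has_real_derivative_iff_has_vector_derivative[symmetric])
  then have x: "integral {0..t} (circle_control e f) = sin t *\<^sub>R e + (1 - cos t) *\<^sub>R f" if "0 \<le> t" for t
    using integral_unique that by fastforce
  have int: "((\<lambda>s. (1 - cos s) *\<^sub>R wedge e f) has_integral (t - sin t) *\<^sub>R wedge e f - (0 - sin 0) *\<^sub>R wedge e f) {0..t}"
    by (rule fundamental_theorem_of_calculus[OF assms])
      (auto intro!: derivative_eq_intros simp: has_real_derivative_iff_has_vector_derivative[symmetric])
  have eq: "(1 - cos s) *\<^sub>R wedge e f = wedge (integral {0..s} (circle_control e f)) (circle_control e f s)"
    if "s \<in> {0..t}" for s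
  proof -
    have "wedge (sin s *\<^sub>R e + (1 - cos s) *\<^sub>R f) (cos s *\<^sub>R e + sin s *\<^sub>R f)
        = (sin s * sin s - (1 - cos s) * cos s) *\<^sub>R wedge e f"
      unfolding wedge.add_left wedge.add_right wedge.scaleR_left wedge.scaleR_right wedge_swap[of f e]
      by (simp add: algebra_simps) (simp flip: scaleR_add_left)
    also have "sin s * sin s - (1 - cos s) * cos s = 1 - cos s"
      using sin_cos_squared_add3[of s] by (simp add: algebra_simps)
    finally show ?thesis using that by (simp add: x circle_control_def)
  qed
  have "((\<lambda>s. wedge (integral {0..s} (circle_control e f)) (circle_control e f s))
      has_integral (t - sin t) *\<^sub>R wedge e f) {0..t}"
    using has_integral_eq[OF eq int] by simp
  then show ?thesis
    using x[OF assms] by (simp add: circle_def hlift_def integral_unique)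
qed

lemma circle_0 [simp]: "circle e f 0 = 0"
  by (simp add: circle_def)

context
  fixes e f :: "real^'n::finite"
  assumes ef: "norm e = 1" "norm f = 1" "e \<bullet> f = 0"
begin

lemma ef_inner: "e \<bullet> e = 1" "f \<bullet> f = 1" "f \<bullet> e = 0" "e \<bullet> f = 0"
  using ef by (simp_all add: norm_eq_1 inner_commute)

lemma norm_circle_control: "norm (circle_control e f t) = 1"
  by (simp add: norm_eq_1 circle_control_def inner_simps ef_inner flip: power2_eq_square)

lemma arc_length_circle: "a \<le> b \<Longrightarrow> arc_length a b (circle_control e f) = b - a"
  by (simp add: arc_length_def norm_circle_control)

text \<open>The calibration is centred at the midpoint \<open>m\<close> of the arc, with
  \<open>p\<close> the velocity there. Along the arc s = sin (t - m) and the gradient is the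
  velocity, so the calibration gains exactly the length. As the length is at most 1, the ends
  satisfy |s| <= 1/2, and a competitor that leaves the slab, having length at least 1, is no
  shorter.\<close>

lemma circle_minimizing_arc:
  assumes ab: "0 \<le> a" "a \<le> b" "b - a \<le> 1"
  shows "cc_dist (circle e f a) (circle e f b) = b - a"
proof (cases "a = b")
  case True
  have "circle e f a \<in> Gk"
    using horizontal_circle[of a e f] ab by (simp add: horizontal_def)
  then show ?thesis using True by (simp add: cc_dist_self)
next
  case False
  then have "a < b" using ab by simp
  let ?\<gamma> = "\<lambda>t. circle e f (a + t)" and ?u = "\<lambda>t. circle_control e f (a + t)"
  have h: "horizontal (b - a) ?\<gamma> ?u"
    by (rule horizontal_subinterval[OF horizontal_circle ab(1) order_refl])
  have len: "arc_length 0 (b - a) ?u = b - a"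
    using ab by (simp add: arc_length_shift arc_length_circle)
  define m where "m = (a + b) / 2"
  define p where "p = circle_control e f m"
  define q where "q = cos m *\<^sub>R f - sin m *\<^sub>R e"
  have pq: "norm p = 1" "norm q = 1" "p \<bullet> q = 0"
    by (simp_all add: norm_eq_1 p_def q_def circle_control_def inner_simps ef_inner sin_cos_squared_add3)
  have pu: "p \<bullet> circle_control e f t = cos (t - m)" "q \<bullet> circle_control e f t = sin (t - m)" for t
    by (simp_all add: p_def q_def circle_control_def inner_simps ef_inner cos_diff sin_diff)
  have px: "p \<bullet> fst (circle e f t) - sin m = sin (t - m)" if "0 \<le> t" for t
    using that by (simp add: circle_eq p_def circle_control_def inner_simps ef_inner sin_diff algebra_simps)
  have sin_le: "\<bar>sin (t - m)\<bar> \<le> 1/2" if "t \<in> {a..b}" for t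
  proof -
    have "\<bar>t - m\<bar> \<le> 1/2" using that ab unfolding m_def by (auto simp: abs_le_iff field_simps)
    then show ?thesis using abs_sin_x_le_abs_x[of "t - m"] by linarith
  qed
  have gain: "calibration p q (sin m) (circle e f b) - calibration p q (sin m) (circle e f a) = b - a"
  proof -
    have "((\<lambda>t. (sqrt (1 - (p \<bullet> fst (?\<gamma> t) - sin m)\<^sup>2) *\<^sub>R p + (p \<bullet> fst (?\<gamma> t) - sin m) *\<^sub>R q) \<bullet> ?u t)
        has_integral calibration p q (sin m) (?\<gamma> (b - a)) - calibration p q (sin m) (?\<gamma> 0)) {0..b - a}"
    proof (rule calibration_has_integral[OF h])
      fix t assume "t \<in> {0..b - a}"
      then show "\<bar>p \<bullet> fst (?\<gamma> t) - sin m\<bar> \<le> 1"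
        using px[of "a + t"] ab by (simp add: abs_sin_le_one)
    qed (use ab in simp)
    then have "((\<lambda>t. 1) has_integral calibration p q (sin m) (?\<gamma> (b - a)) - calibration p q (sin m) (?\<gamma> 0)) {0..b - a}"
    proof (rule has_integral_eq[rotated])
      fix t assume t: "t \<in> {0..b - a}"
      define r where "r = a + t - m"
      \<comment> \<open>Half the arc is shorter than pi / 2, so the cosine is nonnegative and equals
        the square root in the gradient.\<close>
      have "\<bar>r\<bar> \<le> pi / 2" using t ab pi_gt3 unfolding m_def r_def by (auto simp: abs_le_iff field_simps)
      then have "0 \<le> cos r" by (intro cos_ge_zero) auto
      then have "sqrt (1 - (sin r)\<^sup>2) = cos r" by (simp add: cos_squared_eq[symmetric])
      then show "(sqrt (1 - (p \<bullet> fst (?\<gamma> t) - sin m)\<^sup>2) *\<^sub>R p + (p \<bullet> fst (?\<gamma> t) - sin m) *\<^sub>R q) \<bullet> ?u t = 1"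
        using px[of "a + t"] t ab pu[of "a + t"]
        by (simp add: inner_simps flip: r_def power2_eq_square)
    qed
    from has_integral_unique[OF this has_integral_const_real[of "1::real" 0 "b - a"]] show ?thesis
      using ab by simp
  qed
  have "b - a \<le> cc_dist (?\<gamma> 0) (?\<gamma> (b - a))"
  proof (rule cc_dist_greatest[OF _ h])
    fix S \<delta> v assume S: "0 < S" "horizontal S \<delta> v" "\<delta> 0 = ?\<gamma> 0" "\<delta> S = ?\<gamma> (b - a)"
    have "min 1 (calibration p q (sin m) (\<delta> S) - calibration p q (sin m) (\<delta> 0)) \<le> arc_length 0 S v"
      by (rule arc_length_ge_calibration_or_exit[OF S(2) _ _ _ pq])
        (use S px sin_le ab in auto)
    then show "b - a \<le> arc_length 0 S v" using S gain ab by simp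
  qed (use \<open>a < b\<close> in simp)
  moreover have "cc_dist (?\<gamma> 0) (?\<gamma> (b - a)) \<le> b - a"
    using cc_dist_le[OF _ h] \<open>a < b\<close> len by simp
  ultimately show ?thesis by simp
qed

lemma geodesic_circle:
  assumes "0 < T"
  shows "geodesic T (circle e f)"
  unfolding geodesic_def
proof (intro conjI assms exI[of _ "circle_control e f"] ballI)
  show "horizontal T (circle e f) (circle_control e f)" by (rule horizontal_circle)
  show "\<exists>c>0. AE t in lebesgue_on {0..T}. norm (circle_control e f t) = c"
    by (intro exI[of _ 1]) (simp add: norm_circle_control)
  fix t assume "t \<in> {0..T}"
  show "\<exists>\<epsilon>>0. \<forall>a\<in>{0..T}. \<forall>b\<in>{0..T}. t - \<epsilon> < a \<and> a \<le> b \<and> b < t + \<epsilon> \<longrightarrow>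
      arc_length a b (circle_control e f) = cc_dist (circle e f a) (circle e f b)"
  \<comment> \<open>Two times within 1/2 of \<open>t\<close> differ by less than 1, the range in
    which arcs are known to minimize.\<close>
  proof (intro exI[of _ "1/2"] conjI ballI impI)
    fix a b assume "a \<in> {0..T}" "b \<in> {0..T}" "t - 1/2 < a \<and> a \<le> b \<and> b < t + 1/2"
    then show "arc_length a b (circle_control e f) = cc_dist (circle e f a) (circle e f b)"
      by (subst circle_minimizing_arc) (auto simp: arc_length_circle)
  qed simp
qed

text \<open>From time 20 on, a square loop of the same area followed by a chord beats the circle.\<close>

lemma circle_shortcut:
  assumes t: "20 \<le> t"
  shows "\<exists>l<t. reachable UNIV (circle e f t) l"
proof -
  define A where "A = (t - sin t) / 2"
  \<comment> \<open>The loop is the commutator of r e and r f: it has length 4 r and contributes r^2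
    times \<open>wedge e f\<close>.\<close>
  define r where "r = sqrt A"
  define x where "x = sin t *\<^sub>R e + (1 - cos t) *\<^sub>R f"
  have "0 \<le> t - sin t" using t sin_le_one[of t] by linarith
  moreover have "t - sin t \<le> t + 1" using sin_ge_minus_one[of t] by linarith
  ultimately have A: "0 \<le> A" "A \<le> (t + 1) / 2" unfolding A_def by (simp, intro divide_right_mono) auto
  have "reachable UNIV (0, wedge (r *\<^sub>R e) (r *\<^sub>R f)) (2 * norm (r *\<^sub>R e) + 2 * norm (r *\<^sub>R f))"
    using reachable_wedge[OF reachable_0, of UNIV "r *\<^sub>R e" "r *\<^sub>R f"] by simp
  moreover have "wedge (r *\<^sub>R e) (r *\<^sub>R f) = A *\<^sub>R wedge e f"
    using A by (simp add: wedge.scaleR_left wedge.scaleR_right r_def)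
  ultimately have "reachable UNIV (0, A *\<^sub>R wedge e f) (4 * r)"
    using A ef by (simp add: r_def)
  then have "reachable UNIV (gmul (0, A *\<^sub>R wedge e f) (x, 0)) (4 * r + norm x)"
    by (rule reachable_segment) simp
  then have "reachable UNIV (circle e f t) (4 * r + norm x)"
    using t by (simp add: gmul_def wedge.zero_left circle_eq x_def A_def)
  moreover have "4 * r + norm x < t"
  proof -
    have "norm x \<le> norm (sin t *\<^sub>R e) + norm ((1 - cos t) *\<^sub>R f)" unfolding x_def by (rule norm_triangle_ineq)
    also have "\<dots> = \<bar>sin t\<bar> + (1 - cos t)" using ef by simp
    also have "\<dots> \<le> 3" using abs_sin_le_one[of t] cos_ge_minus_one[of t] by linarith
    finally have "norm x \<le> 3" .
    moreover have "r < (t - 3) / 4"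
    proof -
      \<comment> \<open>Clearing denominators in (t + 1) / 2 < ((t - 3) / 4)^2 gives (t - 7)^2 > 48;
        from t = 20 on the left side is at least 169.\<close>
      have "0 < (t - 7) * (t - 7) - 48" using mult_mono[of 13 "t - 7" 13 "t - 7"] t by simp
      then have "(t + 1) / 2 < ((t - 3) / 4)\<^sup>2" by (simp add: power2_eq_square field_simps)
      then have "A < ((t - 3) / 4)\<^sup>2" using A(2) by linarith
      then show ?thesis unfolding r_def using t by (intro real_less_lsqrt) auto
    qed
    ultimately show ?thesis by simp
  qed
  ultimately show ?thesis by blast
qed

text \<open>Replacing the arc up to time 20 by the shortcut shortens the curve, whatever it does
  afterwards. Covering all curves that start like the circle is what the description in
  \<open>cut_time\<close> calls for.\<close>

lemma not_minimizing_circle_extension: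
  assumes t: "20 \<le> t" and eq: "\<And>s. s \<in> {0..20} \<Longrightarrow> \<gamma> s = circle e f s"
  shows "\<not> minimizing_geodesic t \<gamma>"
proof
  assume "minimizing_geodesic t \<gamma>"
  then obtain u where h: "horizontal t \<gamma> u" and min: "arc_length 0 t u = cc_dist (\<gamma> 0) (\<gamma> t)"
    unfolding minimizing_geodesic_def by blast
  have eb: "ess_bounded_on {0..t} u" using h by (simp add: horizontal_def)
  have "horizontal 20 (circle e f) u"
    using horizontal_restrict[OF h t] horizontal_cong[of 20 \<gamma> "circle e f" u] eq by simp
  from horizontal_control_unique[OF this horizontal_circle]
  have "arc_length 0 20 u = arc_length 0 20 (circle_control e f)"
    by (intro arc_length_cong_AE) simp
  then have len: "arc_length 0 20 u = 20" by (simp add: arc_length_circle)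
  obtain S \<delta> v where S: "0 < S" "horizontal S \<delta> v" "\<delta> 0 = 0" "\<delta> S = circle e f 20" "arc_length 0 S v < 20"
    using circle_shortcut[of 20] unfolding reachable_def by auto
  have h': "horizontal (t - 20) (\<lambda>s. \<gamma> (20 + s)) (\<lambda>s. u (20 + s))"
    using horizontal_subinterval[OF h, of 20 t] by simp
  let ?\<eta> = "\<lambda>s. if s \<le> S then \<delta> s else \<gamma> (20 + (s - S))"
  let ?w = "\<lambda>s. if s \<le> S then v s else u (20 + (s - S))"
  have "horizontal (S + (t - 20)) ?\<eta> ?w"
    by (rule horizontal_concat[OF S(2) h']) (use S t eq in auto)
  then have "cc_dist (?\<eta> 0) (?\<eta> (S + (t - 20))) \<le> arc_length 0 (S + (t - 20)) ?w"
    using S t by (intro cc_dist_le) auto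
  moreover have "?\<eta> 0 = \<gamma> 0" using S eq[of 0] by simp
  moreover have "?\<eta> (S + (t - 20)) = \<gamma> t" using S t eq[of 20] by auto
  moreover have "arc_length 0 (S + (t - 20)) ?w = arc_length 0 S v + arc_length 20 t u"
    using arc_length_concat[of S v "t - 20" "\<lambda>s. u (20 + s)"] S t h' arc_length_shift[of t 20 u]
    by (simp add: horizontal_def)
  ultimately have "arc_length 0 t u \<le> arc_length 0 S v + arc_length 20 t u" using min by simp
  moreover have "arc_length 0 20 u + arc_length 20 t u = arc_length 0 t u"
    using arc_length_combine[OF eb, of 20] t by simp
  ultimately show False using len S by simp
qed

section \<open>The cut time of the circle\<close>

lemma minimizing_geodesic_cong:
  assumes "\<And>s. s \<in> {0..t} \<Longrightarrow> \<gamma> s = \<gamma>' s"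
  shows "minimizing_geodesic t \<gamma> \<longleftrightarrow> minimizing_geodesic t \<gamma>'"
proof (cases "0 < t")
  case True
  then have "\<gamma> 0 = \<gamma>' 0" "\<gamma> t = \<gamma>' t" using assms by simp_all
  moreover have "horizontal t \<gamma> = horizontal t \<gamma>'"
    by (intro ext horizontal_cong) (rule assms)
  moreover have "(\<forall>a\<in>{0..t}. \<forall>b\<in>{0..t}. Q a b \<longrightarrow> L a b = cc_dist (\<gamma> a) (\<gamma> b)) \<longleftrightarrow>
      (\<forall>a\<in>{0..t}. \<forall>b\<in>{0..t}. Q a b \<longrightarrow> L a b = cc_dist (\<gamma>' a) (\<gamma>' b))" for Q L
    using assms by (intro ball_cong) auto
  then have "geodesic t \<gamma> \<longleftrightarrow> geodesic t \<gamma>'"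
    unfolding geodesic_def \<open>horizontal t \<gamma> = horizontal t \<gamma>'\<close> by presburger
  ultimately show ?thesis unfolding minimizing_geodesic_def by simp
qed (simp add: minimizing_geodesic_def geodesic_def)

definition circle_cut_time :: ereal where
  "circle_cut_time = Sup {ereal t | t. 0 < t \<and> t < 20 \<and> minimizing_geodesic t (circle e f)}"

text \<open>Minimality at times below 20 depends on the shared arc alone, and all later times are
  excluded, so every candidate extension in \<open>cut_time\<close> yields the same value.\<close>

lemma maximal_cut_time_circle_extension:
  assumes J: "{0..20} \<subseteq> J" and eq: "\<And>s. s \<in> {0..20} \<Longrightarrow> \<gamma> s = circle e f s"
  shows "maximal_cut_time J \<gamma> = circle_cut_time"
proof -
  have "0 < t \<and> t \<in> J \<and> minimizing_geodesic t \<gamma> \<longleftrightarrow> 0 < t \<and> t < 20 \<and> minimizing_geodesic t (circle e f)" for t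
  proof (cases "t < 20")
    case True
    then have "minimizing_geodesic t \<gamma> \<longleftrightarrow> minimizing_geodesic t (circle e f)"
      using eq by (intro minimizing_geodesic_cong) simp
    then show ?thesis using True J by auto
  next
    case False
    then show ?thesis using not_minimizing_circle_extension[of t \<gamma>] eq by simp
  qed
  then show ?thesis unfolding maximal_cut_time_def circle_cut_time_def by simp
qed

lemma circle_cut_time_less: "circle_cut_time < \<infinity>"
proof -
  have "circle_cut_time \<le> 20"
    unfolding circle_cut_time_def by (rule Sup_least) auto
  then show ?thesis by (auto simp: less_ereal.simps(4) elim: le_less_trans)
qed

text \<open>Domains of geodesics are subsets of \<open>{0..}\<close> by definition, so a curve that
  is geodesic on every \<open>{0..T}\<close> cannot be extended.\<close>

lemma maximal_geodesic_circle: "maximal_geodesic {0..} (circle e f)"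
proof -
  have "\<not> {0..} \<subset> J" if "geodesic_on J \<gamma>'" for J and \<gamma>' :: "real \<Rightarrow> 'n point"
    using that unfolding geodesic_on_def by auto
  then show ?thesis
    unfolding maximal_geodesic_def geodesic_on_def using geodesic_circle by blast
qed

lemma maximal_cut_time_circle: "maximal_cut_time {0..} (circle e f) = circle_cut_time"
  by (rule maximal_cut_time_circle_extension) auto

lemma cut_time_circle: "cut_time 20 (circle e f) = circle_cut_time"
  unfolding cut_time_def
proof (rule the_equality)
  show "\<exists>J \<gamma>'. maximal_geodesic J \<gamma>' \<and> {0..20} \<subseteq> J \<and> (\<forall>t\<in>{0..20}. \<gamma>' t = circle e f t) \<and>
      circle_cut_time = maximal_cut_time J \<gamma>'"
    using maximal_geodesic_circle maximal_cut_time_circle[symmetric]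
    by (intro exI[of _ "{0..}"] exI[of _ "circle e f"] conjI ballI refl) simp_all
qed (use maximal_cut_time_circle_extension in blast)

section \<open>Circles orthogonal to two further directions\<close>

context
  fixes a b :: "real^'n"
  assumes ab: "norm a = 1" "norm b = 1" "a \<bullet> b = 0"
    and perp: "a \<bullet> e = 0" "a \<bullet> f = 0" "b \<bullet> e = 0" "b \<bullet> f = 0"
begin

text \<open>Asserted for every real \<open>t\<close>, so that it applies at the cut time whatever
  its value. For t < 0 the integrals in \<open>hlift\<close> run over an empty interval, and the
  point is the origin.\<close>

lemma circle_in_Abn_set: "circle e f t \<in> Abn_set"
proof -
  have *: "circle e f t \<in> Abn_set" if "0 \<le> t" for t
    unfolding circle_eq[OF that] using ab perp inner_commute[of e a] inner_commute[of e b]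
      inner_commute[of f a] inner_commute[of f b]
    by (intro Abn_setI[of _ a b])
      (simp_all add: inner_simps linear_transpose_simps transpose_wedge matrix_vector.scaleR_left wedge_mult_vec)
  show ?thesis
  proof (cases "0 \<le> t")
    case False
    then have "circle e f t = circle e f 0" by (simp add: circle_def hlift_def)
    then show ?thesis using *[of 0] by simp
  qed (rule *)
qed

text \<open>The control stays in the plane of \<open>e\<close> and \<open>f\<close>, so
  \<open>a\<close> and \<open>b\<close> witness that it is critical. The duration 20 matches
  \<open>cut_time_circle\<close>.\<close>

lemma abnormal_geodesic_circle: "abnormal_geodesic 20 (circle e f)"
  unfolding abnormal_geodesic_def
proof (intro conjI exI[of _ "circle_control e f"] horizontal_circle geodesic_circle)
  have "ess_bounded_on {0..1} (\<lambda>s. circle_control e f (0 + 20 * s))"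
    by (rule ess_bounded_on_affine[OF ess_bounded_on_circle_control[of 0 20]]) auto
  then have "ess_bounded_on {0..1} (\<lambda>s. 20 *\<^sub>R circle_control e f (20 * s))"
    by (intro ess_bounded_on_scaleR) simp
  then show "critical (abs_Linf (\<lambda>s. 20 *\<^sub>R circle_control e f (20 * s)))"
    by (rule critical_abs_Linf[OF ab]) (simp add: circle_control_def inner_simps perp)
qed simp

lemma Cut0_Int_Abn_set: "Cut0 \<inter> Abn_set \<noteq> ({} :: 'n point set)"
proof -
  have "circle e f (real_of_ereal (maximal_cut_time {0..} (circle e f))) \<in> Cut0"
    unfolding Cut0_def mem_Collect_eq using maximal_geodesic_circle circle_cut_time_less
    by (intro exI conjI) (rule refl, simp_all add: maximal_cut_time_circle)
  then show ?thesis using circle_in_Abn_set by blast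
qed

end

end

theorem proposition12:
  shows "(2 \<le> CARD('n::finite) \<longrightarrow>
            closure Ck - Ck \<subseteq> (Abn0 :: 'n point set) \<and> (Abn0 :: 'n point set) \<subset> closure Ck) \<and>
         (4 \<le> CARD('n) \<longrightarrow>
            closure Ck - Ck \<subset> (Abn0 :: 'n point set) \<and>
            (Cut0 \<inter> Abn0 :: 'n point set) \<noteq> {} \<and>
            (\<exists>T (\<gamma> :: real \<Rightarrow> 'n point). abnormal_geodesic T \<gamma> \<and> cut_time T \<gamma> < \<infinity>))"
proof (intro conjI impI)
  show "closure Ck - Ck \<subseteq> (Abn0 :: 'n point set)"
    unfolding Abn0_eq by (rule closure_Ck_diff_subset)
  show "(Abn0 :: 'n point set) \<subset> closure Ck" if "2 \<le> CARD('n)"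
    unfolding Abn0_eq using exists_Ck_not_Abn_set[OF that] Abn_set_subset_closure_Ck closure_subset by blast
  assume n: "4 \<le> CARD('n)"
  show "closure Ck - Ck \<subset> (Abn0 :: 'n point set)"
    unfolding Abn0_eq using closure_Ck_diff_subset Ck_Int_Abn_set_nonempty[OF n] by blast
  obtain i j k l :: 'n where d: "i \<noteq> j" "i \<noteq> k" "i \<noteq> l" "j \<noteq> k" "j \<noteq> l" "k \<noteq> l"
    using exists_four_indices[OF n] by blast
  \<comment> \<open>\<open>e\<close> and \<open>f\<close> span the plane of the circle;
    \<open>a\<close> and \<open>b\<close> are two directions that its control never uses.\<close>
  define e f a b :: "real^'n" where "e = axis i 1" and "f = axis j 1" and "a = axis k 1" and "b = axis l 1"
  have ef: "norm e = 1" "norm f = 1" "e \<bullet> f = 0" and ab: "norm a = 1" "norm b = 1" "a \<bullet> b = 0"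
    and perp: "a \<bullet> e = 0" "a \<bullet> f = 0" "b \<bullet> e = 0" "b \<bullet> f = 0"
    using d by (simp_all add: e_def f_def a_def b_def inner_axis_axis)
  show "(Cut0 \<inter> Abn0 :: 'n point set) \<noteq> {}"
    unfolding Abn0_eq by (rule Cut0_Int_Abn_set[OF ef ab perp])
  have "cut_time 20 (circle e f) < \<infinity>"
    using cut_time_circle[OF ef] circle_cut_time_less[OF ef] by simp
  then show "\<exists>T (\<gamma> :: real \<Rightarrow> 'n point). abnormal_geodesic T \<gamma> \<and> cut_time T \<gamma> < \<infinity>"
    using abnormal_geodesic_circle[OF ef ab perp] by blast
qed

end
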